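(* For $|q|<1$, $$\mathrm{C}\Phi_{13}(q)=\frac{1}{(q^{13};q^{13})_\infty}+169\Big(q\frac{(q^{13};q^{13})_\infty}{(q;q)_\infty^2}+36q^2\frac{(q^{13};q^{13})_\infty^3}{(q;q)_\infty^4}+494q^3\frac{(q^{13};q^{13})_\infty^5}{(q;q)_\infty^6}+3380q^4\frac{(q^{13};q^{13})_\infty^7}{(q;q)_\infty^8}$$ $$+13182q^5\frac{(q^{13};q^{13})_\infty^9}{(q;q)_\infty^{10}}+28561q^6\frac{(q^{13};q^{13})_\infty^{11}}{(q;q)_\infty^{12}}+28561q^7\frac{(q^{13};q^{13})_\infty^{13}}{(q;q)_\infty^{14}}\Big)$$ $$=\frac{1}{(q^{13};q^{13})_\infty}+13\sum_{j=1}^\infty p(13j-7)q^j+26q\frac{(q^{13};q^{13})_\infty}{(q;q)_\infty^2}.$$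
   Context: A $k$-colored generalized Frobenius symbol is a two-row array with $d\ge 0$ columns whose entries are colored nonnegative integers $\ell_c$ ($\ell\ge 0$, color $c\in\{1,\dots,k\}$), each row strictly decreasing with respect to the total order $0_1\prec 0_2\prec\cdots\prec 0_k\prec 1_1\prec\cdots\prec 1_k\prec 2_1\prec\cdots$. It is a $k$-colored generalized Frobenius partition of $n=d+\sum(\text{integer values of all entries})$. $c\phi_k(n)$ is the number of such partitions of $n$ (with $c\phi_k(0)=1$), and $\mathrm{C}\Phi_k(q)=\sum_{n\ge0}c\phi_k(n)q^n$. $(a;q)_\infty=\prod_{j\ge1}(1-aq^{j-1})$ and $p(n)$ is the number of ordinary partitions of $n$. *)

theory Defs
  imports "HOL-Analysis.Analysis" "HOL-Library.Multiset"
begin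

text \<open>The pair \<open>(l, c)\<close> encodes the colored integer \<open>l\<^sub>c\<close>.\<close>

type_synonym colored_nat = "nat \<times> nat"

definition colored_less :: "colored_nat \<Rightarrow> colored_nat \<Rightarrow> bool" where
  "colored_less x y \<longleftrightarrow> fst x < fst y \<or> (fst x = fst y \<and> snd x < snd y)"

definition frobenius_row :: "nat \<Rightarrow> colored_nat list \<Rightarrow> bool" where
  "frobenius_row k r \<longleftrightarrow>
     (\<forall>x \<in> set r. snd x \<in> {1..k}) \<and> sorted_wrt (\<lambda>x y. colored_less y x) r"

definition frobenius_symbol :: "nat \<Rightarrow> colored_nat list \<times> colored_nat list \<Rightarrow> bool" where
  "frobenius_symbol k s \<longleftrightarrow>
     length (fst s) = length (snd s) \<and> frobenius_row k (fst s) \<and> frobenius_row k (snd s)"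

definition frobenius_weight :: "colored_nat list \<times> colored_nat list \<Rightarrow> nat" where
  "frobenius_weight s =
     length (fst s) + (\<Sum>x\<leftarrow>fst s. fst x) + (\<Sum>x\<leftarrow>snd s. fst x)"

definition cphi :: "nat \<Rightarrow> nat \<Rightarrow> nat" where
  "cphi k n = card {s. frobenius_symbol k s \<and> frobenius_weight s = n}"

definition CPhi :: "nat \<Rightarrow> complex \<Rightarrow> complex" where
  "CPhi k q = (\<Sum>n. of_nat (cphi k n) * q ^ n)"

definition qpoch_inf :: "complex \<Rightarrow> complex \<Rightarrow> complex" where
  "qpoch_inf a q = (\<Prod>j. 1 - a * q ^ j)"

definition num_partitions :: "nat \<Rightarrow> nat" where
  "num_partitions n = card {M :: nat multiset. 0 \<notin># M \<and> sum_mset M = n}"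

text \<open>
  The facts below exclude the junk values of \<^const>\<open>card\<close> on infinite sets and of
  \<^const>\<open>prodinf\<close> on divergent products, as well as division by zero.
\<close>

lemma finite_frobenius_symbols:
  "finite {s. frobenius_symbol k s \<and> frobenius_weight s = n}"
proof -
  let ?R = "{r. set r \<subseteq> {..n} \<times> {1..k} \<and> length r \<le> n}"
  have fin: "finite ?R"
    by (rule finite_lists_length_le) simp
  have "{s. frobenius_symbol k s \<and> frobenius_weight s = n} \<subseteq> ?R \<times> ?R"
  proof
    fix s assume s: "s \<in> {s. frobenius_symbol k s \<and> frobenius_weight s = n}"
    have le: "fst x \<le> (\<Sum>x\<leftarrow>r. fst x)" if "x \<in> set r" for x and r :: "colored_nat list"
      using that by (intro member_le_sum_list) auto
    have 1: "length (fst s) \<le> n" "length (snd s) \<le> n"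
      "(\<Sum>x\<leftarrow>fst s. fst x) \<le> n" "(\<Sum>x\<leftarrow>snd s. fst x) \<le> n"
      using s by (auto simp: frobenius_symbol_def frobenius_weight_def)
    have "set (fst s) \<subseteq> {..n} \<times> {1..k}" "set (snd s) \<subseteq> {..n} \<times> {1..k}"
      using s le 1 by (fastforce simp: frobenius_symbol_def frobenius_row_def)+
    with 1 show "s \<in> ?R \<times> ?R"
      by (cases s) auto
  qed
  thus ?thesis
    by (rule finite_subset) (use fin in blast)
qed

lemma cphi_0: "cphi k 0 = 1"
proof -
  have "{s. frobenius_symbol k s \<and> frobenius_weight s = 0} = {([], [])}"
    by (auto simp: frobenius_symbol_def frobenius_weight_def frobenius_row_def)
  thus ?thesis
    by (simp add: cphi_def)
qed

lemma finite_partitions: "finite {M :: nat multiset. 0 \<notin># M \<and> sum_mset M = n}"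
proof -
  have "{M :: nat multiset. 0 \<notin># M \<and> sum_mset M = n} \<subseteq>
          mset ` {xs. set xs \<subseteq> {..n} \<and> length xs \<le> n}"
  proof
    fix M :: "nat multiset" assume M: "M \<in> {M. 0 \<notin># M \<and> sum_mset M = n}"
    obtain xs where xs: "mset xs = M"
      using ex_mset by blast
    have 0: "0 \<notin> set xs" and sum: "sum_list xs = n"
      using M by (auto simp flip: xs simp: sum_mset_sum_list)
    have "length xs \<le> sum_list xs"
      using 0 by (induction xs) auto
    moreover have "x \<le> sum_list xs" if "x \<in> set xs" for x
      using that by (intro member_le_sum_list) auto
    ultimately show "M \<in> mset ` {xs. set xs \<subseteq> {..n} \<and> length xs \<le> n}"
      using xs sum by auto
  qed
  thus ?thesis
    by (rule finite_subset) (auto intro: finite_lists_length_le)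
qed

lemma convergent_prod_qpoch_inf:
  fixes a q :: complex
  assumes "norm q < 1"
  shows "convergent_prod (\<lambda>j. 1 - a * q ^ j)"
proof -
  have "summable (\<lambda>j. norm (1 - a * q ^ j - 1))"
    using assms by (auto simp: norm_mult norm_power intro!: summable_mult summable_geometric)
  thus ?thesis
    by (intro abs_convergent_prod_imp_convergent_prod summable_imp_abs_convergent_prod)
qed

lemma qpoch_inf_nonzero:
  fixes a q :: complex
  assumes "norm a < 1" "norm q < 1"
  shows "qpoch_inf a q \<noteq> 0"
  unfolding qpoch_inf_def
proof (rule prodinf_nonzero)
  show "convergent_prod (\<lambda>j. 1 - a * q ^ j)"
    by (rule convergent_prod_qpoch_inf) fact
  fix j
  have "norm (a * q ^ j) \<le> norm a * 1"
    unfolding norm_mult norm_power using assms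
    by (intro mult_left_mono power_le_one) auto
  hence "norm (a * q ^ j) < 1"
    using assms by simp
  thus "1 - a * q ^ j \<noteq> 0"
    by (metis norm_one order_less_irrefl right_minus_eq)
qed

end

theory Submission
  imports
    Defs
    "HOL-Complex_Analysis.Complex_Analysis"
    "HOL-Computational_Algebra.Primes"
    "HOL-Library.Landau_Symbols"
begin

text \<open>
  By the triple product, \<open>C\<Phi>\<^sub>k\<close> is the constant term in \<open>z\<close> of the \<open>k\<close>-th power of a theta function
  divided by \<open>(q;q)\<^sup>k\<close>. For \<open>k = 13\<close>, averaging over the points of order 13 turns \<open>C\<Phi>\<^bsub>13\<^esub> (q\<^sup>1\<^sup>3;q\<^sup>1\<^sup>3)\<close>
  into a quotient \<open>(\<Sum>\<^sub>P \<kappa>\<^sub>P\<^sup>1\<^sup>3) / (13 \<Prod>\<^sub>P \<kappa>\<^sub>P)\<close> of Klein forms, \<open>P\<close> running through a subgroup of order 13,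
  which is visibly a modular function for \<open>\<Gamma>\<^sub>0(13)\<close>. So is \<open>(q\<^sup>1\<^sup>3;q\<^sup>1\<^sup>3) \<Sum> p(13j - 7) q\<^sup>j\<close>, a sum of
  quotients of products of Klein forms over different subgroups. Both are compared with polynomials in the
  Hauptmodul \<open>u = q (q\<^sup>1\<^sup>3;q\<^sup>1\<^sup>3)\<^sup>2 / (q;q)\<^sup>2\<close>: the differences vanish at the cusp infinity and are bounded at the
  cusp 0 (seven coefficients in \<open>x = q\<^bsup>1/13\<^esup>\<close>), hence are zero by the maximum principle.
\<close>


section \<open>The infinite product\<close>

text \<open>The subgroup of order 13 contains the origin, where the Klein form vanishes, so the
  quotient makes sense only at a shifted argument \<open>z\<close>. Inversion moves this argument
  (1/2 becomes t/2), which is why independence of \<open>z\<close> is a step of its own. All torsion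
  points carry a factor 2: an index shift by 13 then moves them by twice a lattice vector, where no
  sign appears, and the remaining 13th roots of unity die in 13th powers or because the sums of
  squares 182 and 91 are divisible by 13. Modularity is only ever checked for t+1 and -1/t acting on
  index pairs. At the cusp 0 the Hauptmodul has a simple pole in x, while its polynomial of degree 7
  and the theta quotient have poles of order 7; this is where seven coefficients come from. In the
  second identity one of the 14 lines of the trace is responsible for the pole, which up to sign is
  (x;x)/(13 x^7) to the order needed. It reproduces all polar coefficients of the theta quotient
  except that of 1/x, and the term 26 u supplies the difference.\<close>

lemma qpoch_inf_has_prod:
  assumes "norm q < 1"
  shows "(\<lambda>j. 1 - a * q ^ j) has_prod qpoch_inf a q"
  unfolding qpoch_inf_def
  using convergent_prod_has_prod convergent_prod_qpoch_inf[OF assms] by blast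

lemma qpoch_inf_tendsto:
  assumes "norm q < 1"
  shows "(\<lambda>n. \<Prod>j<n. 1 - a * q ^ j) \<longlonglongrightarrow> qpoch_inf a q"
  by (rule has_prod_imp_tendsto'[OF qpoch_inf_has_prod[OF assms]])

lemma qpoch_inf_0 [simp]: "qpoch_inf 0 q = 1"
  by (simp add: qpoch_inf_def)

lemma qpoch_inf_zero_right: "qpoch_inf a 0 = 1 - a"
proof -
  have "(\<lambda>n. \<Prod>j<Suc n. 1 - a * 0 ^ j) \<longlonglongrightarrow> qpoch_inf a 0"
    by (rule LIMSEQ_Suc[OF qpoch_inf_tendsto]) simp
  moreover have "(\<Prod>j<Suc n. 1 - a * 0 ^ j) = 1 - a" for n
    by (subst prod.lessThan_Suc_shift) simp
  ultimately show ?thesis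
    using LIMSEQ_unique tendsto_const by (simp add: LIMSEQ_const_iff)
qed

lemma qpoch_inf_split:
  assumes "norm q < 1"
  shows "qpoch_inf a q = (\<Prod>j<n. 1 - a * q ^ j) * qpoch_inf (a * q ^ n) q"
proof -
  have "(\<lambda>m. (\<Prod>j<n. 1 - a * q ^ j) * (\<Prod>j<m. 1 - (a * q ^ n) * q ^ j))
      \<longlonglongrightarrow> (\<Prod>j<n. 1 - a * q ^ j) * qpoch_inf (a * q ^ n) q"
    by (intro tendsto_intros qpoch_inf_tendsto assms)
  moreover have "(\<Prod>j<n. 1 - a * q ^ j) * (\<Prod>j<m. 1 - (a * q ^ n) * q ^ j)
      = (\<Prod>j<m + n. 1 - a * q ^ j)" for m
    by (induction m) (simp_all add: power_add mult_ac)
  ultimately have "(\<lambda>m. \<Prod>j<m + n. 1 - a * q ^ j)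
      \<longlonglongrightarrow> (\<Prod>j<n. 1 - a * q ^ j) * qpoch_inf (a * q ^ n) q"
    by simp
  moreover have "(\<lambda>m. \<Prod>j<m + n. 1 - a * q ^ j) \<longlonglongrightarrow> qpoch_inf a q"
    by (rule LIMSEQ_ignore_initial_segment[OF qpoch_inf_tendsto[OF assms]])
  ultimately show ?thesis
    using LIMSEQ_unique by blast
qed

lemma qpoch_inf_rec:
  assumes "norm q < 1"
  shows "qpoch_inf a q = (1 - a) * qpoch_inf (a * q) q"
  using qpoch_inf_split[OF assms, of a 1] by simp

text \<open>The factors are grouped by the residue of their exponent modulo
  \<open>m\<close>.\<close>

lemma qpoch_inf_multisection:
  assumes "norm q < 1" "m > 0"
  shows "qpoch_inf a q = (\<Prod>r<m. qpoch_inf (a * q ^ r) (q ^ m))"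
proof -
  have q': "norm (q ^ m) < 1"
    using assms by (simp add: norm_power power_less_one_iff)
  have "(\<lambda>n. \<Prod>r<m. \<Prod>j<n. 1 - a * q ^ r * (q ^ m) ^ j) \<longlonglongrightarrow> (\<Prod>r<m. qpoch_inf (a * q ^ r) (q ^ m))"
    by (intro tendsto_intros qpoch_inf_tendsto q')
  moreover have "(\<Prod>r<m. \<Prod>j<n. 1 - a * q ^ r * (q ^ m) ^ j) = (\<Prod>j<n * m. 1 - a * q ^ j)" for n
  proof -
    have "(\<Prod>r<m. \<Prod>j<n. 1 - a * q ^ r * (q ^ m) ^ j) = (\<Prod>j<n. \<Prod>r<m. 1 - a * q ^ (j * m + r))"
      by (subst prod.swap) (simp add: power_add power_mult[symmetric] mult_ac)
    also have "\<dots> = (\<Prod>j<n. \<Prod>i\<in>{j * m..<j * m + m}. 1 - a * q ^ i)"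
      by (rule prod.cong[OF refl]) (simp add: prod.atLeastLessThan_shift_0 o_def atLeast0LessThan)
    also have "\<dots> = (\<Prod>j<n * m. 1 - a * q ^ j)"
      by (rule prod.nat_group)
    finally show ?thesis .
  qed
  ultimately have "(\<lambda>n. \<Prod>j<n * m. 1 - a * q ^ j) \<longlonglongrightarrow> (\<Prod>r<m. qpoch_inf (a * q ^ r) (q ^ m))"
    by simp
  moreover have "(\<lambda>n. \<Prod>j<n * m. 1 - a * q ^ j) \<longlonglongrightarrow> qpoch_inf a q"
    by (rule filterlim_compose[OF qpoch_inf_tendsto[OF assms(1)]])
       (use assms(2) in \<open>auto intro!: filterlim_subseq strict_monoI\<close>)
  ultimately show ?thesis
    using LIMSEQ_unique by blast
qed

lemma qpoch_inf_minus_1_bound: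
  assumes "norm q < 1"
  shows "norm (qpoch_inf a q - 1) \<le> exp (norm a / (1 - norm q)) - 1"
proof (rule tendsto_upperbound)
  show "(\<lambda>n. norm ((\<Prod>j<n. 1 - a * q ^ j) - 1)) \<longlonglongrightarrow> norm (qpoch_inf a q - 1)"
    by (intro tendsto_intros qpoch_inf_tendsto assms)
  have "norm ((\<Prod>j<n. 1 - a * q ^ j) - 1) \<le> exp (norm a / (1 - norm q)) - 1" for n
  proof -
    have "norm ((\<Prod>j<n. 1 + (- a * q ^ j)) - 1) \<le> (\<Prod>j<n. 1 + norm (- a * q ^ j)) - 1"
      by (rule norm_prod_minus1_le_prod_minus1)
    also have "(\<Prod>j<n. 1 + norm (- a * q ^ j)) \<le> (\<Prod>j<n. exp (norm (- a * q ^ j)))"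
      by (intro prod_mono conjI) (auto intro: exp_ge_add_one_self)
    also have "\<dots> = exp (\<Sum>j<n. norm (- a * q ^ j))"
      by (simp add: exp_sum)
    also have "(\<Sum>j<n. norm (- a * q ^ j)) = norm a * (\<Sum>j<n. norm q ^ j)"
      by (simp add: norm_mult norm_power sum_distrib_left)
    also have "\<dots> \<le> norm a * (\<Sum>j. norm q ^ j)"
      using assms by (intro mult_left_mono sum_le_suminf summable_geometric) auto
    also have "(\<Sum>j. norm q ^ j) = 1 / (1 - norm q)"
      using assms by (intro suminf_geometric) auto
    finally show ?thesis
      by simp
  qed
  thus "\<forall>\<^sub>F n in sequentially. norm ((\<Prod>j<n. 1 - a * q ^ j) - 1) \<le> exp (norm a / (1 - norm q)) - 1"
    by simp
qed auto

text \<open>On a unit disc around any point the partial products have a common bound, and the tail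
  \<open>qpoch_inf (a * q ^ n) q\<close> tends to 1 uniformly by
  \<open>qpoch_inf_minus_1_bound\<close>; hence the convergence is locally uniform.\<close>

lemma qpoch_inf_holomorphic:
  assumes "norm q < 1"
  shows "(\<lambda>a. qpoch_inf a q) holomorphic_on UNIV"
proof (rule holomorphic_uniform_sequence[where f = "\<lambda>n a. \<Prod>j<n. 1 - a * q ^ j"])
  show "(\<lambda>a. \<Prod>j<n. 1 - a * q ^ j) holomorphic_on UNIV" for n
    by (intro holomorphic_intros)
  fix x :: complex
  define R where "R = norm x + 1"
  define C where "C = exp (R / (1 - norm q))"
  have R: "norm a \<le> R" if "a \<in> cball x 1" for a
    using that norm_triangle_ineq2[of a x] by (simp add: R_def dist_norm norm_minus_commute)
  have C: "norm (\<Prod>j<n. 1 - a * q ^ j) \<le> C" if "norm a \<le> R" for a n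
  proof -
    have "norm (\<Prod>j<n. 1 - a * q ^ j) = (\<Prod>j<n. norm (1 - a * q ^ j))"
      by (simp add: prod_norm)
    also have "\<dots> \<le> (\<Prod>j<n. exp (R * norm q ^ j))"
    proof (intro prod_mono conjI)
      fix j
      have "norm (1 - a * q ^ j) \<le> 1 + norm a * norm q ^ j"
        using norm_triangle_ineq4[of 1 "a * q ^ j"] by (simp add: norm_mult norm_power)
      also have "\<dots> \<le> 1 + R * norm q ^ j"
        using that by (intro add_left_mono mult_right_mono) auto
      also have "\<dots> \<le> exp (R * norm q ^ j)"
        by (rule exp_ge_add_one_self)
      finally show "norm (1 - a * q ^ j) \<le> exp (R * norm q ^ j)" .
    qed auto
    also have "\<dots> = exp (R * (\<Sum>j<n. norm q ^ j))"
      by (simp add: exp_sum sum_distrib_left)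
    also have "\<dots> \<le> exp (R * (\<Sum>j. norm q ^ j))"
      using assms by (subst exp_le_cancel_iff, intro mult_left_mono sum_le_suminf summable_geometric)
                     (auto simp: R_def)
    also have "\<dots> = C"
      using assms by (simp add: C_def suminf_geometric)
    finally show ?thesis .
  qed
  have "uniform_limit (cball x 1) (\<lambda>n a. \<Prod>j<n. 1 - a * q ^ j) (\<lambda>a. qpoch_inf a q) sequentially"
  proof (rule uniform_limitI)
    fix e :: real assume e: "e > 0"
    have "(\<lambda>n. C * (exp (R * norm q ^ n / (1 - norm q)) - 1)) \<longlonglongrightarrow> C * (exp (R * 0 / (1 - norm q)) - 1)"
      using assms by (intro tendsto_intros LIMSEQ_power_zero) auto
    hence "(\<lambda>n. C * (exp (R * norm q ^ n / (1 - norm q)) - 1)) \<longlonglongrightarrow> 0"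
      by simp
    from order_tendstoD(2)[OF this e]
    have "\<forall>\<^sub>F n in sequentially. C * (exp (R * norm q ^ n / (1 - norm q)) - 1) < e" .
    thus "\<forall>\<^sub>F n in sequentially. \<forall>a\<in>cball x 1. dist (\<Prod>j<n. 1 - a * q ^ j) (qpoch_inf a q) < e"
    proof eventually_elim
      case (elim n)
      show ?case
      proof
        fix a assume a: "a \<in> cball x 1"
        have "dist (\<Prod>j<n. 1 - a * q ^ j) (qpoch_inf a q)
            = norm ((\<Prod>j<n. 1 - a * q ^ j) * (qpoch_inf (a * q ^ n) q - 1))"
          by (subst qpoch_inf_split[OF assms, of a n])
             (simp add: dist_norm norm_minus_commute algebra_simps)
        also have "\<dots> \<le> C * (exp (norm (a * q ^ n) / (1 - norm q)) - 1)"
          unfolding norm_mult using qpoch_inf_minus_1_bound[OF assms, of "a * q ^ n"] C[OF R[OF a], of n]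
          by (intro mult_mono) (auto simp: C_def norm_mult)
        also have "\<dots> \<le> C * (exp (R * norm q ^ n / (1 - norm q)) - 1)"
          using R[OF a] assms
          by (intro mult_left_mono diff_right_mono)
             (auto simp: C_def norm_mult norm_power intro!: divide_right_mono mult_right_mono)
        finally show "dist (\<Prod>j<n. 1 - a * q ^ j) (qpoch_inf a q) < e"
          using elim by simp
      qed
    qed
  qed
  thus "\<exists>d>0. cball x d \<subseteq> UNIV \<and>
      uniform_limit (cball x d) (\<lambda>n a. \<Prod>j<n. 1 - a * q ^ j) (\<lambda>a. qpoch_inf a q) sequentially"
    by (intro exI[of _ 1]) auto
qed auto

lemma qpoch_inf_holomorphic' [holomorphic_intros]:
  assumes "norm q < 1" "f holomorphic_on S"
  shows "(\<lambda>z. qpoch_inf (f z) q) holomorphic_on S"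
  using holomorphic_on_compose_gen[OF assms(2) qpoch_inf_holomorphic[OF assms(1)]]
  by (simp add: o_def)

lemma qpoch_inf_eq_0_iff:
  assumes "norm q < 1"
  shows "qpoch_inf a q = 0 \<longleftrightarrow> (\<exists>j. a * q ^ j = 1)"
  using has_prod_eq_0_iff[OF qpoch_inf_has_prod[OF assms, of a]] by auto

section \<open>The exponential e(z) and roots of unity\<close>

definition cis1 :: "complex \<Rightarrow> complex" where
  "cis1 z = exp (2 * of_real pi * \<i> * z)"

lemma cis1_add: "cis1 (a + b) = cis1 a * cis1 b"
  by (simp add: cis1_def exp_add ring_distribs)

lemma cis1_minus: "cis1 (- a) = inverse (cis1 a)"
  by (simp add: cis1_def exp_minus)

lemma cis1_diff: "cis1 (a - b) = cis1 a / cis1 b"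
  by (simp add: cis1_def exp_diff ring_distribs)

lemma cis1_0 [simp]: "cis1 0 = 1"
  by (simp add: cis1_def)

lemma cis1_nonzero [simp]: "cis1 a \<noteq> 0"
  by (simp add: cis1_def)

lemma cis1_power: "cis1 a ^ n = cis1 (of_nat n * a)"
  by (simp add: cis1_def exp_of_nat_mult[symmetric] mult_ac)

lemma cis1_eq_1_iff: "cis1 z = 1 \<longleftrightarrow> (\<exists>n::int. z = of_int n)"
proof
  assume "cis1 z = 1"
  then obtain n :: int where n: "2 * pi * \<i> * z = \<i> * (of_int (2 * n) * pi)"
    unfolding cis1_def exp_eq_1 by (auto simp: complex_eq_iff)
  hence "z = of_int n"
    by (simp add: field_simps)
  thus "\<exists>n::int. z = of_int n" by blast
next
  assume "\<exists>n::int. z = of_int n"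
  thus "cis1 z = 1"
    by (auto simp: cis1_def exp_eq_1)
qed

lemma cis1_of_int [simp]: "cis1 (of_int n) = 1" and cis1_1 [simp]: "cis1 1 = 1"
  and cis1_of_nat [simp]: "cis1 (of_nat m) = 1" and cis1_numeral [simp]: "cis1 (numeral k) = 1"
  unfolding cis1_eq_1_iff by (metis of_int_of_nat_eq of_int_1 of_int_numeral)+

lemma cis1_half [simp]: "cis1 (1 / 2) = -1"
  by (simp add: cis1_def)

lemma cis1_quarter [simp]: "cis1 (1 / 4) = \<i>"
  by (simp add: cis1_def exp_eq_polar cis_def complex_eq_iff exp_Euler)

lemma norm_cis1: "norm (cis1 z) = exp (- 2 * pi * Im z)"
  by (simp add: cis1_def)

lemma cis1_holomorphic [holomorphic_intros]:
  "f holomorphic_on S \<Longrightarrow> (\<lambda>z. cis1 (f z)) holomorphic_on S"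
  unfolding cis1_def by (intro holomorphic_intros)

lemma cis1_cong:
  assumes "a - b = of_int n"
  shows "cis1 a = cis1 b"
proof -
  have "cis1 a = cis1 (of_int n + b)"
    by (simp add: assms[symmetric])
  thus ?thesis
    by (simp add: cis1_add del: of_int_add)
qed

lemma sum_roots_of_unity:
  assumes "m > 0"
  shows "(\<Sum>r<m. cis1 (of_nat r * of_int n / of_nat m)) = (if int m dvd n then of_nat m else 0)"
proof (cases "int m dvd n")
  case True
  then obtain k where k: "n = int m * k" ..
  have "cis1 (of_nat r * of_int n / of_nat m) = 1" for r
  proof -
    have "of_nat r * of_int n / of_nat m = (of_int (int r * k) :: complex)"
      using assms by (simp add: k field_simps)
    thus ?thesis
      by (simp only: cis1_of_int)
  qed
  thus ?thesis
    using True by simp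
next
  case False
  define w where "w = cis1 (of_int n / of_nat m)"
  have "w \<noteq> 1"
  proof
    assume "w = 1"
    then obtain k :: int where k: "of_int n / of_nat m = (of_int k :: complex)"
      unfolding w_def cis1_eq_1_iff by blast
    hence "of_int n = (of_int (k * int m) :: complex)"
      using assms by (simp add: field_simps)
    hence "n = k * int m"
      by (simp only: of_int_eq_iff)
    thus False
      using False by simp
  qed
  moreover have "w ^ m = 1"
    using assms by (simp add: w_def cis1_power)
  ultimately have "(\<Sum>r<m. w ^ r) = 0"
    using geometric_sum[of w m] by simp
  thus ?thesis
    using False by (simp add: w_def cis1_power)
qed

text \<open>The polynomial X^m - 1 and the product over its roots are both monic of degree
  \<open>m\<close>, so their difference has degree below \<open>m\<close> but \<open>m\<close>
  roots. Putting X = 1/a and multiplying by \<open>a ^ m\<close> gives the reversed form stated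
  here.\<close>

lemma prod_one_minus_roots_of_unity:
  assumes "m > 0"
  shows "(\<Prod>r<m. 1 - a * cis1 (of_nat r / of_nat m)) = 1 - a ^ m"
proof (cases "a = 0")
  case False
  have "(\<Prod>r<m. x - cis1 (of_nat r / of_nat m)) = x ^ m - 1" for x
  proof -
    have inj: "inj_on (\<lambda>r. cis1 (of_nat r / of_nat m)) {..<m}"
    proof (rule inj_onI)
      fix r s assume rs: "r \<in> {..<m}" "s \<in> {..<m}"
        and eq: "cis1 (of_nat r / of_nat m) = cis1 (of_nat s / of_nat m)"
      have "cis1 ((of_nat r - of_nat s) / of_nat m) = 1"
        using eq by (simp add: diff_divide_distrib cis1_diff)
      then obtain k :: int where k: "(of_nat r - of_nat s) / of_nat m = (of_int k :: complex)"
        unfolding cis1_eq_1_iff by blast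
      have "(of_int (int r - int s) :: complex) = of_int (k * int m)"
        using k assms by (simp add: field_simps)
      hence "int r - int s = k * int m"
        by (simp only: of_int_eq_iff)
      moreover have "\<bar>int r - int s\<bar> < int m"
        using rs by auto
      ultimately have "\<bar>k\<bar> * int m < 1 * int m"
        by (simp add: abs_mult)
      hence "k = 0"
        using assms by (simp only: mult_less_cancel_right) auto
      thus "r = s"
        using \<open>int r - int s = k * int m\<close> by simp
    qed
    define p where "p = monom 1 m - (1 :: complex poly)"
    define r where "r = (\<Prod>w\<in>(\<lambda>r. cis1 (of_nat r / of_nat m)) ` {..<m}. [:- w, 1:])"
    have "degree p \<le> m"
      unfolding p_def using degree_diff_le[of "monom 1 m" m "1 :: complex poly"] by (simp add: degree_monom_le)
    moreover have cp: "coeff p m = 1"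
      using assms by (simp add: p_def)
    ultimately have degp: "degree p = m"
      by (metis le_antisym le_degree zero_neq_one)
    hence lcp: "lead_coeff p = 1"
      using cp by simp
    have degr: "degree r = m"
      unfolding r_def by (subst degree_prod_eq_sum_degree) (auto simp: card_image[OF inj])
    have lcr: "lead_coeff r = 1"
      unfolding r_def by (simp add: lead_coeff_prod)
    have "p = r"
    proof (rule ccontr)
      assume "p \<noteq> r"
      define d where "d = p - r"
      have "d \<noteq> 0" using \<open>p \<noteq> r\<close> by (simp add: d_def)
      have "degree d < m"
        unfolding d_def using degp degr lcp lcr assms
        by (metis (no_types, lifting) coeff_diff degree_diff_le diff_self eq_zero_or_degree_less le_refl d_def \<open>d \<noteq> 0\<close>)
      moreover have "card {x. poly d x = 0} \<le> degree d"
        by (rule card_poly_roots_bound[OF \<open>d \<noteq> 0\<close>])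
      moreover have "(\<lambda>r. cis1 (of_nat r / of_nat m)) ` {..<m} \<subseteq> {x. poly d x = 0}"
        using assms by (auto simp: d_def p_def r_def poly_prod poly_monom cis1_power prod_zero_iff)
      hence "card ((\<lambda>r. cis1 (of_nat r / of_nat m)) ` {..<m}) \<le> card {x. poly d x = 0}"
        by (intro card_mono poly_roots_finite \<open>d \<noteq> 0\<close>)
      ultimately show False
        by (simp add: card_image[OF inj])
    qed
    have "poly r x = poly p x"
      using \<open>p = r\<close> by simp
    thus ?thesis
      by (simp add: p_def r_def poly_prod poly_monom prod.reindex[OF inj])
  qed
  from this[of "1 / a"] have "a ^ m * (\<Prod>r<m. 1 / a - cis1 (of_nat r / of_nat m)) = a ^ m * ((1 / a) ^ m - 1)"
    by simp
  also have "a ^ m * (\<Prod>r<m. 1 / a - cis1 (of_nat r / of_nat m)) = (\<Prod>r<m. a * (1 / a - cis1 (of_nat r / of_nat m)))"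
    by (simp add: prod.distrib)
  also have "\<dots> = (\<Prod>r<m. 1 - a * cis1 (of_nat r / of_nat m))"
    using False by (intro prod.cong refl) (simp add: right_diff_distrib)
  finally show ?thesis
    using False by (simp add: right_diff_distrib power_one_over)
qed (use assms in simp)

lemma qpoch_inf_roots_of_unity:
  assumes "norm q < 1" "m > 0"
  shows "(\<Prod>r<m. qpoch_inf (a * cis1 (of_nat r / of_nat m)) q) = qpoch_inf (a ^ m) (q ^ m)"
proof -
  have q': "norm (q ^ m) < 1"
    using assms by (simp add: norm_power power_less_one_iff)
  have "(\<lambda>n. \<Prod>r<m. \<Prod>j<n. 1 - a * cis1 (of_nat r / of_nat m) * q ^ j)
      \<longlonglongrightarrow> (\<Prod>r<m. qpoch_inf (a * cis1 (of_nat r / of_nat m)) q)"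
    by (intro tendsto_intros qpoch_inf_tendsto assms)
  also have "(\<lambda>n. \<Prod>r<m. \<Prod>j<n. 1 - a * cis1 (of_nat r / of_nat m) * q ^ j)
      = (\<lambda>n. \<Prod>j<n. 1 - a ^ m * (q ^ m) ^ j)"
  proof
    fix n
    have "(\<Prod>r<m. \<Prod>j<n. 1 - a * cis1 (of_nat r / of_nat m) * q ^ j)
        = (\<Prod>j<n. \<Prod>r<m. 1 - (a * q ^ j) * cis1 (of_nat r / of_nat m))"
      by (subst prod.swap) (simp add: mult_ac)
    also have "\<dots> = (\<Prod>j<n. 1 - a ^ m * (q ^ m) ^ j)"
      using assms(2)
      by (simp only: prod_one_minus_roots_of_unity power_mult_distrib power_mult[symmetric] mult.commute)
    finally show "(\<Prod>r<m. \<Prod>j<n. 1 - a * cis1 (of_nat r / of_nat m) * q ^ j)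
        = (\<Prod>j<n. 1 - a ^ m * (q ^ m) ^ j)" .
  qed
  finally show ?thesis
    using LIMSEQ_unique[OF _ qpoch_inf_tendsto[OF q', of "a ^ m"]] by blast
qed

no_notation Infinite_Set_Sum.abs_summable_on (infix \<open>abs'_summable'_on\<close> 50)

section \<open>The generating function of Frobenius symbols\<close>

text \<open>Serves to collect terms by a statistic \<open>d\<close>: by weight for
  \<open>cphi\<close> and \<open>num_partitions\<close>, by charge for the Laurent
  coefficients.\<close>

lemma has_sum_fibers:
  fixes f :: "'a \<Rightarrow> 'b :: {topological_comm_monoid_add, t3_space}"
  assumes "(f has_sum s) X" and "\<And>n. (f has_sum g n) {x \<in> X. d x = n}"
  shows "(g has_sum s) UNIV"
proof (rule has_sum_SigmaD)
  show "((\<lambda>(n, x). f x) has_sum s) (SIGMA n:UNIV. {x \<in> X. d x = n})"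
    using assms(1)
    by (subst has_sum_reindex_bij_witness[where i = "\<lambda>x. (d x, x)" and j = snd and T = X and h = f]) auto
qed (use assms(2) in auto)

lemma has_sum_times:
  fixes f :: "'a \<Rightarrow> complex" and g :: "'b \<Rightarrow> complex"
  assumes f: "f abs_summable_on A" and g: "g abs_summable_on B"
  shows "(\<lambda>(x, y). f x * g y) abs_summable_on A \<times> B"
    and "((\<lambda>(x, y). f x * g y) has_sum infsum f A * infsum g B) (A \<times> B)"
proof -
  show *: "(\<lambda>(x, y). f x * g y) abs_summable_on A \<times> B"
    unfolding Infinite_Sum.abs_summable_on_Sigma_iff
  proof (intro conjI ballI)
    show "(\<lambda>y. case (x, y) of (x, y) \<Rightarrow> f x * g y) abs_summable_on B" for x
      using g by (auto simp: norm_mult intro!: summable_on_cmult_right)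
    have "(\<lambda>x. norm (f x) * (\<Sum>\<^sub>\<infinity>y\<in>B. norm (g y))) summable_on A"
      by (intro summable_on_cmult_left f)
    moreover have "(\<Sum>\<^sub>\<infinity>y\<in>B. norm (case (x, y) of (x, y) \<Rightarrow> f x * g y)) = norm (f x) * (\<Sum>\<^sub>\<infinity>y\<in>B. norm (g y))" for x
      by (simp add: norm_mult infsum_cmult_right' )
    ultimately show "(\<lambda>x. \<Sum>\<^sub>\<infinity>y\<in>B. norm (case (x, y) of (x, y) \<Rightarrow> f x * g y)) abs_summable_on A"
      by (simp add: infsum_nonneg abs_mult)
  qed
  show "((\<lambda>(x, y). f x * g y) has_sum infsum f A * infsum g B) (A \<times> B)"
  proof (rule has_sum_SigmaI)
    show "(\<lambda>(x, y). f x * g y) summable_on A \<times> B"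
      using * by (rule abs_summable_summable)
    show "((\<lambda>y. case (x, y) of (x, y) \<Rightarrow> f x * g y) has_sum f x * infsum g B) B" for x
      using abs_summable_summable[OF g] by (auto intro!: has_sum_cmult_right)
    show "((\<lambda>x. f x * infsum g B) has_sum infsum f A * infsum g B) A"
      using abs_summable_summable[OF f] by (auto intro!: has_sum_cmult_left)
  qed
qed

lemma sum_Pow_prod_eq:
  fixes f :: "'a \<Rightarrow> 'b :: comm_semiring_1"
  assumes "finite A"
  shows "(\<Sum>S\<in>Pow A. \<Prod>x\<in>S. f x) = (\<Prod>x\<in>A. 1 + f x)"
  using prod_add[OF assms, of f "\<lambda>_. 1"] by (simp add: add.commute)

text \<open>Finitely many subsets lie in the power set of a finite \<open>U\<close>, over which the
  sum of products factors into \<open>1 + norm (f x)\<close>; this is at most the exponential of the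
  total sum of norms.\<close>

lemma prod_finite_subsets_abs_summable:
  fixes f :: "'a \<Rightarrow> complex"
  assumes "f abs_summable_on I"
  shows "(\<lambda>S. \<Prod>x\<in>S. f x) abs_summable_on Fpow I"
proof (rule nonneg_bdd_above_summable_on)
  show "bdd_above (sum (\<lambda>S. norm (\<Prod>x\<in>S. f x)) ` {F. F \<subseteq> Fpow I \<and> finite F})"
  proof (rule bdd_aboveI2)
    fix F assume F: "F \<in> {F. F \<subseteq> Fpow I \<and> finite F}"
    define U where "U = \<Union>F"
    have U: "finite U" "U \<subseteq> I"
      using F by (auto simp: U_def Fpow_def)
    have "(\<Sum>S\<in>F. norm (\<Prod>x\<in>S. f x)) = (\<Sum>S\<in>F. \<Prod>x\<in>S. norm (f x))"
      by (simp add: prod_norm)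
    also have "\<dots> \<le> (\<Sum>S\<in>Pow U. \<Prod>x\<in>S. norm (f x))"
      using U by (intro sum_mono2 prod_nonneg) (auto simp: U_def)
    also have "\<dots> = (\<Prod>x\<in>U. 1 + norm (f x))"
      using U by (intro sum_Pow_prod_eq) auto
    also have "\<dots> \<le> (\<Prod>x\<in>U. exp (norm (f x)))"
      by (intro prod_mono conjI) (auto intro: exp_ge_add_one_self)
    also have "\<dots> = exp (\<Sum>x\<in>U. norm (f x))"
      using U by (simp add: exp_sum)
    also have "\<dots> \<le> exp (\<Sum>\<^sub>\<infinity>x\<in>I. norm (f x))"
      using finite_sum_le_infsum[OF assms U] by simp
    finally show "(\<Sum>S\<in>F. norm (\<Prod>x\<in>S. f x)) \<le> exp (\<Sum>\<^sub>\<infinity>x\<in>I. norm (f x))" .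
  qed
qed auto

section \<open>Frobenius rows as finite sets of colored integers\<close>

definition colored_nats :: "nat \<Rightarrow> (nat \<times> nat) set" where
  "colored_nats k = UNIV \<times> {1..k}"

lemma geometric_colored_abs_summable:
  fixes a q :: complex
  assumes "norm q < 1"
  shows "(\<lambda>x. a * q ^ fst x) abs_summable_on colored_nats k"
proof -
  have "(\<lambda>(n, c). (a * q ^ n) * 1) abs_summable_on UNIV \<times> {1..k}"
  proof (rule has_sum_times)
    have "summable (\<lambda>n. norm (norm (a * q ^ n)))"
      using assms by (auto simp: norm_mult norm_power intro!: summable_mult summable_geometric)
    thus "(\<lambda>n. a * q ^ n) abs_summable_on UNIV"
      by (rule norm_summable_imp_summable_on)
  qed auto
  thus ?thesis
    by (simp add: colored_nats_def case_prod_unfold)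
qed

definition row_sum :: "(nat \<times> nat) set \<Rightarrow> nat" where
  "row_sum S = (\<Sum>x\<in>S. fst x)"

text \<open>A strictly decreasing row is determined by its set of entries. Each entry is present or
  absent independently, which gives one factor \<open>1 + a * q ^ n\<close> per integer and
  color.\<close>

lemma has_sum_colored_subsets:
  assumes "norm q < 1"
  shows "(\<lambda>S. a ^ card S * q ^ row_sum S) abs_summable_on Fpow (colored_nats k)"
    and "((\<lambda>S. a ^ card S * q ^ row_sum S) has_sum qpoch_inf (- a) q ^ k) (Fpow (colored_nats k))"
proof -
  define f where "f = (\<lambda>x :: nat \<times> nat. a * q ^ fst x)"
  have eq: "(\<Prod>x\<in>S. f x) = a ^ card S * q ^ row_sum S" for S
    by (simp add: f_def prod.distrib power_sum row_sum_def)
  have *: "(\<lambda>S. \<Prod>x\<in>S. f x) abs_summable_on Fpow (colored_nats k)"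
    unfolding f_def by (intro prod_finite_subsets_abs_summable geometric_colored_abs_summable assms)
  thus "(\<lambda>S. a ^ card S * q ^ row_sum S) abs_summable_on Fpow (colored_nats k)"
    by (simp add: eq)
  obtain s where s: "((\<lambda>S. \<Prod>x\<in>S. f x) has_sum s) (Fpow (colored_nats k))"
    using abs_summable_summable[OF *] by (auto simp: summable_on_def)
  define A where "A = (\<lambda>N :: nat. {..<N} \<times> {1..k})"
  \<comment> \<open>The families \<open>Pow (A N)\<close> are cofinal among the finite families of
    sets, so the unordered sum is a limit of partial products.\<close>
  have "filterlim (\<lambda>N. Pow (A N)) (finite_subsets_at_top (Fpow (colored_nats k))) sequentially"
    unfolding filterlim_finite_subsets_at_top
  proof safe
    fix X assume X: "finite X" "X \<subseteq> Fpow (colored_nats k)"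
    have "finite (\<Union>X)"
      using X by (auto simp: Fpow_def)
    hence "finite (fst ` \<Union>X)"
      by blast
    then obtain M where M: "fst ` \<Union>X \<subseteq> {..<M}"
      using finite_nat_iff_bounded by blast
    have "X \<subseteq> Pow (A N)" if "N \<ge> M" for N
    proof (rule subsetI, rule PowI, rule subsetI)
      fix S x assume Sx: "S \<in> X" "x \<in> S"
      hence "fst x \<in> {..<M}" "x \<in> colored_nats k"
        using M X by (auto simp: Fpow_def)
      thus "x \<in> A N"
        using that by (auto simp: A_def colored_nats_def mem_Times_iff)
    qed
    thus "\<forall>\<^sub>F N in sequentially. finite (Pow (A N)) \<and> X \<subseteq> Pow (A N) \<and> Pow (A N) \<subseteq> Fpow (colored_nats k)"
      by (intro eventually_mono[OF eventually_ge_at_top[of M]])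
         (auto simp: A_def Fpow_def colored_nats_def intro: finite_subset[OF _ finite_cartesian_product])
  qed
  with s have "(\<lambda>N. \<Sum>S\<in>Pow (A N). \<Prod>x\<in>S. f x) \<longlonglongrightarrow> s"
    unfolding has_sum_def using filterlim_compose by blast
  also have "(\<lambda>N. \<Sum>S\<in>Pow (A N). \<Prod>x\<in>S. f x) = (\<lambda>N. (\<Prod>n<N. 1 - (- a) * q ^ n) ^ k)"
  proof
    fix N
    have "(\<Sum>S\<in>Pow (A N). \<Prod>x\<in>S. f x) = (\<Prod>x\<in>A N. 1 + f x)"
      by (intro sum_Pow_prod_eq) (auto simp: A_def)
    also have "\<dots> = (\<Prod>n<N. \<Prod>c=1..k. 1 + a * q ^ n)"
      unfolding A_def f_def by (subst prod.cartesian_product) (simp add: case_prod_unfold)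
    finally show "(\<Sum>S\<in>Pow (A N). \<Prod>x\<in>S. f x) = (\<Prod>n<N. 1 - (- a) * q ^ n) ^ k"
      by (simp add: prod_power_distrib)
  qed
  finally have "s = qpoch_inf (- a) q ^ k"
    using LIMSEQ_unique tendsto_power[OF qpoch_inf_tendsto[OF assms]] by blast
  thus "((\<lambda>S. a ^ card S * q ^ row_sum S) has_sum qpoch_inf (- a) q ^ k) (Fpow (colored_nats k))"
    using s by (simp add: eq)
qed

text \<open>Symbols freed from the condition of equal row lengths. \<open>pair_charge\<close>
  measures the defect, and charge 0 gives back the genuine symbols.\<close>

definition symbol_pairs :: "nat \<Rightarrow> ((nat \<times> nat) set \<times> (nat \<times> nat) set) set" where
  "symbol_pairs k = Fpow (colored_nats k) \<times> Fpow (colored_nats k)"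

text \<open>When the rows have unequal length, the number of columns is replaced by the length of
  the first row; each entry of the first row then carries a factor \<open>z * q\<close>, each entry
  of the second a factor \<open>1 / z\<close>.\<close>

definition pair_weight :: "(nat \<times> nat) set \<times> (nat \<times> nat) set \<Rightarrow> nat" where
  "pair_weight x = card (fst x) + row_sum (fst x) + row_sum (snd x)"

definition pair_charge :: "(nat \<times> nat) set \<times> (nat \<times> nat) set \<Rightarrow> int" where
  "pair_charge x = int (card (fst x)) - int (card (snd x))"

definition theta_prod :: "complex \<Rightarrow> complex \<Rightarrow> complex" where
  "theta_prod q z = qpoch_inf (- z * q) q * qpoch_inf (- 1 / z) q"

lemma has_sum_symbol_pairs:
  assumes "norm q < 1" "z \<noteq> 0"
  shows "(\<lambda>x. q ^ pair_weight x * z powi pair_charge x) abs_summable_on symbol_pairs k"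
    and "((\<lambda>x. q ^ pair_weight x * z powi pair_charge x) has_sum theta_prod q z ^ k) (symbol_pairs k)"
proof -
  let ?f = "\<lambda>S. (z * q) ^ card S * q ^ row_sum S" and ?g = "\<lambda>S. (1 / z) ^ card S * q ^ row_sum S"
  let ?I = "Fpow (colored_nats k)"
  have eq: "(\<lambda>(x, y). ?f x * ?g y) = (\<lambda>x. q ^ pair_weight x * z powi pair_charge x)"
    using assms(2)
    by (auto simp: fun_eq_iff pair_weight_def pair_charge_def power_int_diff power_add power_mult_distrib
        field_simps)
  have infsum: "infsum ?f ?I * infsum ?g ?I = theta_prod q z ^ k"
    unfolding theta_prod_def
    using has_sum_colored_subsets(2)[OF assms(1), of "z * q" k] has_sum_colored_subsets(2)[OF assms(1), of "1 / z" k]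
    by (simp add: has_sum_iff power_mult_distrib)
  show "(\<lambda>x. q ^ pair_weight x * z powi pair_charge x) abs_summable_on symbol_pairs k"
    using has_sum_times(1)[OF has_sum_colored_subsets(1)[OF assms(1), of "z * q" k]
        has_sum_colored_subsets(1)[OF assms(1), of "1 / z" k]]
    unfolding eq symbol_pairs_def .
  show "((\<lambda>x. q ^ pair_weight x * z powi pair_charge x) has_sum theta_prod q z ^ k) (symbol_pairs k)"
    using has_sum_times(2)[OF has_sum_colored_subsets(1)[OF assms(1), of "z * q" k]
        has_sum_colored_subsets(1)[OF assms(1), of "1 / z" k]]
    unfolding eq symbol_pairs_def infsum .
qed

text \<open>Colors stay below \<open>k + 1\<close>, so the base \<open>k + 1\<close> code
  \<open>f\<close> turns \<open>colored_less\<close> into \<open><\<close> on numbers, with decoder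
  \<open>g\<close>. The claim becomes that a strictly sorted list of numbers is determined by its
  set.\<close>

lemma bij_betw_rows_sets:
  "bij_betw set {r. frobenius_row k r} (Fpow (colored_nats k))"
proof -
  define f where "f = (\<lambda>x :: nat \<times> nat. fst x * (k + 1) + snd x)"
  define g where "g = (\<lambda>n. (n div (k + 1), n mod (k + 1)))"
  have gf: "g (f x) = x" if "x \<in> colored_nats k" for x
  proof -
    have "snd x < k + 1"
      using that by (auto simp: colored_nats_def)
    thus ?thesis
      unfolding f_def g_def by (simp only: div_mult_self3 mod_mult_self3) simp
  qed
  have less: "colored_less x y \<longleftrightarrow> f x < f y" if "x \<in> colored_nats k" "y \<in> colored_nats k" for x y
  proof -
    have *: "f x < f y" if "fst x < fst y" "x \<in> colored_nats k" for x y
    proof -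
      have "f x < (fst x + 1) * (k + 1)"
        using that by (auto simp: f_def colored_nats_def)
      also have "\<dots> \<le> fst y * (k + 1)"
        using that by (intro mult_right_mono) auto
      also have "\<dots> \<le> f y"
        by (simp add: f_def)
      finally show ?thesis .
    qed
    show ?thesis
    proof (cases "fst x" "fst y" rule: linorder_cases)
      case equal
      thus ?thesis by (auto simp: colored_less_def f_def)
    qed (use *[of x y] *[of y x] that in \<open>auto simp: colored_less_def\<close>)
  qed
  have row: "frobenius_row k r \<longleftrightarrow> set r \<subseteq> colored_nats k \<and> sorted_wrt (<) (rev (map f r))" for r
  proof -
    have "sorted_wrt (\<lambda>x y. colored_less y x) r \<longleftrightarrow> sorted_wrt (\<lambda>x y. f y < f x) r"
      if "set r \<subseteq> colored_nats k"
    proof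
      assume "sorted_wrt (\<lambda>x y. colored_less y x) r"
      thus "sorted_wrt (\<lambda>x y. f y < f x) r"
        by (rule sorted_wrt_mono_rel[rotated]) (use that less in blast)
    next
      assume "sorted_wrt (\<lambda>x y. f y < f x) r"
      thus "sorted_wrt (\<lambda>x y. colored_less y x) r"
        by (rule sorted_wrt_mono_rel[rotated]) (use that less in blast)
    qed
    moreover have "(\<forall>x\<in>set r. snd x \<in> {1..k}) \<longleftrightarrow> set r \<subseteq> colored_nats k"
      by (auto simp: colored_nats_def mem_Times_iff)
    ultimately show ?thesis
      by (auto simp: frobenius_row_def sorted_wrt_rev sorted_wrt_map)
  qed
  show ?thesis
  proof (rule bij_betwI')
    fix r s assume rs: "r \<in> {r. frobenius_row k r}" "s \<in> {r. frobenius_row k r}"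
    show "set r = set s \<longleftrightarrow> r = s"
    proof
      assume eq: "set r = set s"
      have "rev (map f r) = rev (map f s)"
        using rs eq by (intro strict_sorted_equal) (auto simp: row)
      hence "map g (map f r) = map g (map f s)"
        by simp
      moreover have "map g (map f t) = t" if "set t \<subseteq> colored_nats k" for t
        unfolding map_map using that gf by (intro map_idI) (auto simp: subset_iff)
      ultimately show "r = s"
        using rs by (auto simp: row)
    qed auto
  next
    fix r assume "r \<in> {r. frobenius_row k r}"
    thus "set r \<in> Fpow (colored_nats k)"
      by (auto simp: row Fpow_def)
  next
    fix S assume "S \<in> Fpow (colored_nats k)"
    hence S: "finite S" "S \<subseteq> colored_nats k"
      by (auto simp: Fpow_def)
    define r where "r = map g (rev (sorted_list_of_set (f ` S)))"
    have "set r = S"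
      using S gf by (force simp: r_def image_image subset_iff)
    moreover have "map f r = rev (sorted_list_of_set (f ` S))"
      unfolding r_def map_map
      using S gf by (intro map_idI) (auto simp: subset_iff)
    hence "sorted_wrt (<) (rev (map f r))"
      by simp
    ultimately show "\<exists>r\<in>{r. frobenius_row k r}. S = set r"
      using S row by blast
  qed
qed

lemma frobenius_row_distinct: "frobenius_row k r \<Longrightarrow> distinct r"
proof -
  assume "frobenius_row k r"
  hence "sorted_wrt (\<lambda>x y. colored_less y x) r"
    by (simp add: frobenius_row_def)
  thus "distinct r"
    by (induction r) (auto simp: colored_less_def)
qed

lemma bij_betw_symbols_pairs:
  "bij_betw (map_prod set set) {s. frobenius_symbol k s \<and> frobenius_weight s = n}
     {x \<in> symbol_pairs k. pair_charge x = 0 \<and> pair_weight x = n}"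
proof -
  have len: "length r = card (set r)" and sum: "(\<Sum>x\<leftarrow>r. fst x) = row_sum (set r)"
    if "frobenius_row k r" for r
    using frobenius_row_distinct[OF that]
    by (simp_all add: distinct_card row_sum_def sum_list_distinct_conv_sum_set)
  have "bij_betw (map_prod set set) ({r. frobenius_row k r} \<times> {r. frobenius_row k r}) (symbol_pairs k)"
    unfolding symbol_pairs_def by (intro bij_betw_map_prod bij_betw_rows_sets)
  thus ?thesis
  proof (rule bij_betw_subset)
    let ?A = "{s. frobenius_symbol k s \<and> frobenius_weight s = n}"
    show sub: "?A \<subseteq> {r. frobenius_row k r} \<times> {r. frobenius_row k r}"
      by (auto simp: frobenius_symbol_def)
    let ?D = "{r. frobenius_row k r} \<times> {r. frobenius_row k r}"
    have img: "map_prod set set ` ?D = symbol_pairs k"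
      unfolding symbol_pairs_def map_prod_image
      using bij_betw_rows_sets[of k] by (simp add: map_prod_surj_on bij_betw_def)
    have iff: "s \<in> ?A \<longleftrightarrow> pair_charge (map_prod set set s) = 0 \<and> pair_weight (map_prod set set s) = n"
      if "s \<in> ?D" for s
      using that len sum
      by (auto simp: frobenius_symbol_def frobenius_weight_def pair_charge_def pair_weight_def)
    show "map_prod set set ` ?A = {x \<in> symbol_pairs k. pair_charge x = 0 \<and> pair_weight x = n}"
      (is "_ = ?B")
    proof (intro equalityI subsetI)
      fix x assume "x \<in> map_prod set set ` ?A"
      then obtain s where s: "s \<in> ?A" "x = map_prod set set s"
        by (elim imageE)
      have "s \<in> ?D"
        using s(1) sub by (rule subsetD[rotated])
      thus "x \<in> ?B"
        unfolding img[symmetric] using iff s by simp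
    next
      fix x assume x: "x \<in> ?B"
      then obtain s where s: "s \<in> ?D" "x = map_prod set set s"
        unfolding img[symmetric] by (elim CollectE conjE imageE)
      hence "s \<in> ?A"
        using iff x by simp
      thus "x \<in> map_prod set set ` ?A"
        unfolding s(2) by (rule imageI)
    qed
  qed
qed

lemma cphi_eq_card_pairs:
  "cphi k n = card {x \<in> symbol_pairs k. pair_charge x = 0 \<and> pair_weight x = n}"
  unfolding cphi_def by (rule bij_betw_same_card[OF bij_betw_symbols_pairs])

text \<open>The coefficient of \<open>z powi N\<close> in \<open>theta_prod q z ^ k\<close>; charge
  0 will be \<open>CPhi k q\<close>.\<close>

definition charge_coeff :: "nat \<Rightarrow> complex \<Rightarrow> int \<Rightarrow> complex" where
  "charge_coeff k q N = (\<Sum>\<^sub>\<infinity>x\<in>{x \<in> symbol_pairs k. pair_charge x = N}. q ^ pair_weight x)"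

lemma charge_coeff_abs_summable:
  fixes q :: complex
  assumes "norm q < 1"
  shows "(\<lambda>x. q ^ pair_weight x) abs_summable_on symbol_pairs k"
  using has_sum_symbol_pairs(1)[OF assms, of 1 k] by simp

lemma cphi_sums_charge_coeff:
  assumes "norm q < 1"
  shows "(\<lambda>n. of_nat (cphi k n) * q ^ n) sums charge_coeff k q 0"
proof (rule has_sum_imp_sums, rule has_sum_fibers)
  let ?X = "{x \<in> symbol_pairs k. pair_charge x = 0}"
  have sm: "(\<lambda>x. q ^ pair_weight x) summable_on symbol_pairs k"
    by (rule abs_summable_summable[OF charge_coeff_abs_summable[OF assms]])
  show "((\<lambda>x. q ^ pair_weight x) has_sum charge_coeff k q 0) ?X"
    unfolding charge_coeff_def
    by (intro has_sum_infsum summable_on_subset[OF sm]) auto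
  fix n
  have eq: "{x \<in> ?X. pair_weight x = n} = {x \<in> symbol_pairs k. pair_charge x = 0 \<and> pair_weight x = n}"
    by auto
  have "finite {x \<in> ?X. pair_weight x = n}"
    unfolding eq using bij_betw_finite[OF bij_betw_symbols_pairs, of k n] finite_frobenius_symbols[of k n] by simp
  thus "((\<lambda>x. q ^ pair_weight x) has_sum of_nat (cphi k n) * q ^ n) {x \<in> ?X. pair_weight x = n}"
    by (intro has_sum_finiteI) (auto simp: cphi_eq_card_pairs eq)
qed

lemma CPhi_eq_charge_coeff:
  assumes "norm q < 1"
  shows "CPhi k q = charge_coeff k q 0"
  using cphi_sums_charge_coeff[OF assms] by (simp add: CPhi_def sums_iff)

lemma charge_coeff_has_sum:
  assumes "norm q < 1" "z \<noteq> 0"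
  shows "(\<lambda>N. charge_coeff k q N * z powi N) abs_summable_on UNIV"
    and "((\<lambda>N. charge_coeff k q N * z powi N) has_sum theta_prod q z ^ k) UNIV"
proof -
  have sm: "(\<lambda>x. q ^ pair_weight x) summable_on {x \<in> symbol_pairs k. pair_charge x = N}" for N
    by (rule summable_on_subset[OF abs_summable_summable[OF charge_coeff_abs_summable[OF assms(1)]]]) auto
  show "((\<lambda>N. charge_coeff k q N * z powi N) has_sum theta_prod q z ^ k) UNIV"
  proof (rule has_sum_fibers[OF has_sum_symbol_pairs(2)[OF assms]])
    fix N
    show "((\<lambda>x. q ^ pair_weight x * z powi pair_charge x) has_sum charge_coeff k q N * z powi N)
        {x \<in> symbol_pairs k. pair_charge x = N}"
      unfolding charge_coeff_def
      by (subst has_sum_cong[where g = "\<lambda>x. q ^ pair_weight x * z powi N"])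
         (auto intro!: has_sum_cmult_left has_sum_infsum sm)
  qed
  have "(\<lambda>N. charge_coeff k q N * z powi N) summable_on UNIV"
    using \<open>((\<lambda>N. charge_coeff k q N * z powi N) has_sum _) UNIV\<close> has_sum_imp_summable by blast
  thus "(\<lambda>N. charge_coeff k q N * z powi N) abs_summable_on UNIV"
    by (rule iffD1[OF summable_on_iff_abs_summable_on_complex])
qed

section \<open>Laurent coefficients and the triple product\<close>

lemma cis1_powi: "cis1 a powi N = cis1 (of_int N * a)"
proof (cases "N \<ge> 0")
  case True
  then obtain n where "N = int n"
    using nonneg_eq_int by blast
  thus ?thesis by (simp add: cis1_power)
next
  case False
  then obtain n where "N = - int n"
    by (metis nle_le neg_0_le_iff_le nonneg_eq_int minus_minus)
  thus ?thesis by (simp add: power_int_minus cis1_power cis1_minus)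
qed

lemma power_powi: "(x ^ k) powi m = x powi (int k * m)" for x :: "'a :: field"
  by (simp add: power_int_mult)

text \<open>Averaging over the \<open>M\<close>-th roots of unity against the character belonging to
  \<open>n\<close> leaves only the exponents congruent to \<open>n\<close>.\<close>

lemma roots_of_unity_filter:
  fixes c :: "int \<Rightarrow> complex"
  assumes "M > 0" "\<And>r. r < M \<Longrightarrow> ((\<lambda>N. c N * (z * cis1 (of_nat r / of_nat M)) powi N) has_sum S r) UNIV"
  shows "((\<lambda>N. if int M dvd N - n then c N * z powi N else 0) has_sum
           (\<Sum>r<M. cis1 (- (of_nat r * of_int n / of_nat M)) * S r) / of_nat M) UNIV"
proof -
  have *: "((\<lambda>N. \<Sum>r<K. cis1 (- (of_nat r * of_int n / of_nat M)) * (c N * (z * cis1 (of_nat r / of_nat M)) powi N))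
      has_sum (\<Sum>r<K. cis1 (- (of_nat r * of_int n / of_nat M)) * S r)) UNIV" if "K \<le> M" for K
    using that by (induction K) (auto intro!: has_sum_add has_sum_cmult_right assms(2))
  have "((\<lambda>N. (\<Sum>r<M. cis1 (- (of_nat r * of_int n / of_nat M)) * (c N * (z * cis1 (of_nat r / of_nat M)) powi N)) / of_nat M)
      has_sum (\<Sum>r<M. cis1 (- (of_nat r * of_int n / of_nat M)) * S r) / of_nat M) UNIV"
    by (intro has_sum_divide_const *) simp
  moreover have "(\<Sum>r<M. cis1 (- (of_nat r * of_int n / of_nat M)) * (c N * (z * cis1 (of_nat r / of_nat M)) powi N)) / of_nat M
      = (if int M dvd N - n then c N * z powi N else 0)" for N
  proof -
    have "(\<Sum>r<M. cis1 (- (of_nat r * of_int n / of_nat M)) * (c N * (z * cis1 (of_nat r / of_nat M)) powi N))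
        = (\<Sum>r<M. c N * z powi N * cis1 (of_nat r * of_int (N - n) / of_nat M))"
    proof (intro sum.cong refl)
      fix r
      have "of_nat r * of_int (N - n) / of_nat M
          = - (of_nat r * of_int n / of_nat M) + of_int N * (of_nat r / of_nat M :: complex)"
        by (simp add: diff_divide_distrib right_diff_distrib mult_ac)
      hence "cis1 (of_nat r * of_int (N - n) / of_nat M)
          = cis1 (- (of_nat r * of_int n / of_nat M)) * cis1 (of_int N * (of_nat r / of_nat M))"
        by (simp only: cis1_add)
      thus "cis1 (- (of_nat r * of_int n / of_nat M)) * (c N * (z * cis1 (of_nat r / of_nat M)) powi N)
          = c N * z powi N * cis1 (of_nat r * of_int (N - n) / of_nat M)"
        by (simp only: power_int_mult_distrib cis1_powi mult_ac)
    qed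
    also have "\<dots> = c N * z powi N * (if int M dvd N - n then of_nat M else 0)"
      by (simp only: sum_distrib_left[symmetric] sum_roots_of_unity[OF assms(1)])
    finally show ?thesis
      using assms(1) by simp
  qed
  ultimately show ?thesis
    by simp
qed

text \<open>Choose a finite \<open>K\<close> containing \<open>n\<close> outside which the norms sum
  to at most half of \<open>norm (c n)\<close>. With a modulus \<open>M\<close> exceeding all
  distances from \<open>n\<close> inside \<open>K\<close>, the filter leaves only \<open>c n\<close>
  from \<open>K\<close>, and the tail is too small to cancel it.\<close>

lemma laurent_coeffs_zero:
  fixes c :: "int \<Rightarrow> complex"
  assumes "\<And>z. norm z = 1 \<Longrightarrow> ((\<lambda>N. c N * z powi N) has_sum 0) UNIV"
  shows "c n = 0"
proof (rule ccontr)
  assume nz: "c n \<noteq> 0"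
  have "c summable_on UNIV"
    using assms[of 1] by (auto simp: summable_on_def)
  hence sm: "(\<lambda>N. norm (c N)) summable_on UNIV"
    by (rule iffD1[OF summable_on_iff_abs_summable_on_complex])
  obtain K0 where K0: "finite K0" "dist (\<Sum>N\<in>K0. norm (c N)) (\<Sum>\<^sub>\<infinity>N. norm (c N)) \<le> norm (c n) / 2"
    using infsum_finite_approximation[OF sm, of "norm (c n) / 2"] nz by auto
  define K where "K = insert n K0"
  have K: "finite K" "n \<in> K"
    using K0 by (auto simp: K_def)
  have "(\<Sum>\<^sub>\<infinity>N\<in>UNIV - K. norm (c N)) \<le> norm (c n) / 2"
  proof -
    have "(\<Sum>\<^sub>\<infinity>N. norm (c N)) = (\<Sum>\<^sub>\<infinity>N\<in>K \<union> (UNIV - K). norm (c N))"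
      by simp
    also have "\<dots> = (\<Sum>\<^sub>\<infinity>N\<in>K. norm (c N)) + (\<Sum>\<^sub>\<infinity>N\<in>UNIV - K. norm (c N))"
      using K by (intro infsum_Un_disjoint summable_on_subset[OF sm]) auto
    also have "(\<Sum>\<^sub>\<infinity>N\<in>K. norm (c N)) = (\<Sum>N\<in>K. norm (c N))"
      using K by simp
    finally have "(\<Sum>\<^sub>\<infinity>N\<in>UNIV - K. norm (c N)) = (\<Sum>\<^sub>\<infinity>N. norm (c N)) - (\<Sum>N\<in>K. norm (c N))"
      by simp
    moreover have "(\<Sum>N\<in>K. norm (c N)) \<ge> (\<Sum>N\<in>K0. norm (c N))"
      using K by (intro sum_mono2) (auto simp: K_def)
    ultimately show ?thesis
      using K0(2) unfolding dist_real_def by linarith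
  qed
  define M where "M = Suc (\<Sum>m\<in>K. nat \<bar>m - n\<bar>)"
  define g where "g = (\<lambda>N. if int M dvd N - n then c N else 0)"
  have "((\<lambda>N. if int M dvd N - n then c N * 1 powi N else 0) has_sum
      (\<Sum>r<M. cis1 (- (of_nat r * of_int n / of_nat M)) * 0) / of_nat M) UNIV"
  proof (rule roots_of_unity_filter)
    fix r
    show "((\<lambda>N. c N * (1 * cis1 (of_nat r / of_nat M)) powi N) has_sum 0) UNIV"
      using assms[of "cis1 (of_nat r / of_nat M)"] by (simp add: norm_cis1)
  qed (simp add: M_def)
  hence g: "(g has_sum 0) UNIV"
    unfolding g_def by (simp cong: if_cong)
  hence gs: "g summable_on UNIV"
    by (auto simp: summable_on_def)
  have "g m = 0" if "m \<in> K" "m \<noteq> n" for m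
  proof -
    have "nat \<bar>m - n\<bar> \<le> (\<Sum>m\<in>K. nat \<bar>m - n\<bar>)"
      using K that by (intro member_le_sum) auto
    hence "\<bar>m - n\<bar> < int M"
      unfolding M_def by linarith
    hence "\<not> int M dvd m - n"
      using that zdvd_not_zless[of "\<bar>m - n\<bar>" "int M"] by auto
    thus ?thesis
      by (simp add: g_def)
  qed
  hence "(\<Sum>m\<in>K. g m) = (\<Sum>m\<in>{n}. g m)"
    using K by (intro sum.mono_neutral_right) auto
  hence gK: "(\<Sum>m\<in>K. g m) = c n"
    by (simp add: g_def)
  have "0 = infsum g (K \<union> (UNIV - K))"
    using g by (simp add: has_sum_iff)
  also have "\<dots> = infsum g K + infsum g (UNIV - K)"
    using K by (intro infsum_Un_disjoint summable_on_subset[OF gs]) auto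
  also have "infsum g K = c n"
    using K gK by simp
  finally have "infsum g (UNIV - K) = - c n"
    by (simp add: eq_neg_iff_add_eq_0 add.commute)
  hence "norm (c n) = norm (infsum g (UNIV - K))"
    by simp
  also have "\<dots> \<le> (\<Sum>\<^sub>\<infinity>N\<in>UNIV - K. norm (c N))"
  proof (rule norm_infsum_le)
    show "(g has_sum infsum g (UNIV - K)) (UNIV - K)"
      by (intro has_sum_infsum summable_on_subset[OF gs]) auto
    show "((\<lambda>N. norm (c N)) has_sum (\<Sum>\<^sub>\<infinity>N\<in>UNIV - K. norm (c N))) (UNIV - K)"
      by (intro has_sum_infsum summable_on_subset[OF sm]) auto
  qed (auto simp: g_def)
  finally show False
    using \<open>(\<Sum>\<^sub>\<infinity>N\<in>UNIV - K. norm (c N)) \<le> norm (c n) / 2\<close> zero_less_norm_iff[of "c n"] nz by linarith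
qed

text \<open>The two products exchange the single factor \<open>1 + z * q\<close>.\<close>

lemma theta_prod_shift:
  assumes "norm q < 1" "q \<noteq> 0" "z \<noteq> 0"
  shows "theta_prod q (z * q) * (z * q) = theta_prod q z"
proof -
  have 1: "qpoch_inf (- 1 / (z * q)) q * (z * q) = (1 + z * q) * qpoch_inf (- 1 / z) q"
    using assms by (subst qpoch_inf_rec) (simp_all add: field_simps)
  have 2: "qpoch_inf (- z * q) q = (1 + z * q) * qpoch_inf (- (z * q) * q) q"
    using assms by (subst qpoch_inf_rec) simp_all
  have "theta_prod q (z * q) * (z * q)
      = qpoch_inf (- (z * q) * q) q * (qpoch_inf (- 1 / (z * q)) q * (z * q))"
    by (simp only: theta_prod_def mult.assoc)
  thus ?thesis
    unfolding 1 theta_prod_def 2 by (simp only: mult_ac)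
qed

text \<open>The \<open>k\<close>-th power of \<open>theta_prod_shift\<close> is a relation between
  two Laurent series in \<open>z\<close>, whose coefficients are unique by
  \<open>laurent_coeffs_zero\<close>.\<close>

lemma charge_coeff_rec:
  assumes "norm q < 1" "q \<noteq> 0"
  shows "charge_coeff k q (N + int k) = charge_coeff k q N * q powi (N + int k)"
proof -
  define c where "c = (\<lambda>N. charge_coeff k q N * q powi N - charge_coeff k q (N + int k) * q powi (- int k))"
  have "c N = 0"
  proof (rule laurent_coeffs_zero)
    fix z :: complex assume "norm z = 1"
    hence z: "z \<noteq> 0" by auto
    have "((\<lambda>N. charge_coeff k q N * (z * q) powi N) has_sum theta_prod q (z * q) ^ k) UNIV"
      using assms z by (intro charge_coeff_has_sum) auto
    moreover have "((\<lambda>N. charge_coeff k q N * z powi N) has_sum theta_prod q z ^ k) UNIV"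
      using assms z by (intro charge_coeff_has_sum) auto
    hence "((\<lambda>N. charge_coeff k q (N + int k) * z powi (N + int k)) has_sum theta_prod q z ^ k) UNIV"
      by (subst has_sum_reindex_bij_witness[where i = "\<lambda>N. N - int k" and j = "\<lambda>N. N + int k" and T = UNIV
            and h = "\<lambda>N. charge_coeff k q N * z powi N"]) auto
    hence "((\<lambda>N. charge_coeff k q (N + int k) * z powi (N + int k) * (z * q) powi (- int k))
        has_sum theta_prod q z ^ k * (z * q) powi (- int k)) UNIV"
      by (rule has_sum_cmult_left)
    moreover have "theta_prod q z ^ k * (z * q) powi (- int k) = theta_prod q (z * q) ^ k"
      using assms z theta_prod_shift[OF assms z, symmetric]
      by (simp add: power_int_minus power_mult_distrib field_simps)
    moreover have "(\<lambda>N. charge_coeff k q (N + int k) * z powi (N + int k) * (z * q) powi (- int k))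
        = (\<lambda>N. charge_coeff k q (N + int k) * q powi (- int k) * z powi N)"
      using z assms by (simp add: fun_eq_iff power_int_add power_int_minus power_mult_distrib field_simps)
    ultimately have "((\<lambda>N. charge_coeff k q N * (z * q) powi N
          + (- charge_coeff k q (N + int k) * q powi (- int k) * z powi N))
        has_sum theta_prod q (z * q) ^ k + - (theta_prod q (z * q) ^ k)) UNIV"
      by (intro has_sum_add) (auto simp: has_sum_uminus)
    thus "((\<lambda>N. c N * z powi N) has_sum 0) UNIV"
      by (simp add: c_def power_int_mult_distrib algebra_simps)
  qed
  thus ?thesis
    using assms by (simp add: c_def power_int_add power_int_minus field_simps)
qed

text \<open>Iterating \<open>charge_coeff_rec\<close> from charge 0 collects the exponents
  \<open>k\<close>, \<open>2 * k\<close>, ..., \<open>m * k\<close>, in both directions; hence the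
  triangular number.\<close>

lemma charge_coeff_multiple:
  assumes "norm q < 1" "q \<noteq> 0"
  shows "charge_coeff k q (int k * m) = charge_coeff k q 0 * (q ^ k) powi (m * (m + 1) div 2)"
proof (induction m rule: int_induct[where k = 0])
  case base
  show ?case by simp
next
  case (step1 m)
  have e: "(m + 1) * (m + 1 + 1) div 2 = m * (m + 1) div 2 + (m + 1)"
  proof -
    have "(m + 1) * (m + 1 + 1) = m * (m + 1) + (m + 1) * 2"
      by (simp add: algebra_simps)
    thus ?thesis by simp
  qed
  have "charge_coeff k q (int k * (m + 1)) = charge_coeff k q (int k * m + int k)"
    by (simp add: algebra_simps)
  also have "\<dots> = charge_coeff k q (int k * m) * q powi (int k * m + int k)"
    by (rule charge_coeff_rec[OF assms])
  also have "q powi (int k * m + int k) = (q ^ k) powi (m + 1)"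
    by (simp add: power_powi distrib_left)
  finally show ?case
    unfolding e using assms step1 by (simp add: power_int_add)
next
  case (step2 m)
  have e: "m * (m + 1) div 2 = (m - 1) * (m - 1 + 1) div 2 + m"
  proof -
    have "m * (m + 1) = (m - 1) * (m - 1 + 1) + m * 2"
      by (simp add: algebra_simps)
    thus ?thesis by simp
  qed
  have "charge_coeff k q (int k * m) = charge_coeff k q (int k * (m - 1) + int k)"
    by (simp add: algebra_simps)
  also have "\<dots> = charge_coeff k q (int k * (m - 1)) * q powi (int k * (m - 1) + int k)"
    by (rule charge_coeff_rec[OF assms])
  also have "q powi (int k * (m - 1) + int k) = (q ^ k) powi m"
    by (simp add: power_powi right_diff_distrib)
  finally have "charge_coeff k q (int k * (m - 1)) * (q ^ k) powi m
      = charge_coeff k q 0 * (q ^ k) powi ((m - 1) * (m - 1 + 1) div 2) * (q ^ k) powi m"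
    using assms step2 by (simp add: e power_int_add)
  thus ?case
    using assms by simp
qed

text \<open>The Jacobi triple product up to its constant, which appears here as
  \<open>CPhi 1 q\<close> and is evaluated in \<open>CPhi_1_eq\<close>.\<close>

lemma theta_prod_has_sum:
  assumes "norm q < 1" "q \<noteq> 0" "z \<noteq> 0"
  shows "((\<lambda>m. CPhi 1 q * q powi (m * (m + 1) div 2) * z powi m) has_sum theta_prod q z) UNIV"
proof -
  have "charge_coeff 1 q m = CPhi 1 q * q powi (m * (m + 1) div 2)" for m
    using charge_coeff_multiple[of q 1 m] assms by (simp add: CPhi_eq_charge_coeff)
  thus ?thesis
    using charge_coeff_has_sum(2)[of q z 1] assms by simp
qed

text \<open>The average retains the charges divisible by \<open>k\<close>, whose coefficients are
  \<open>CPhi k q\<close> times those of the triple product series for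
  \<open>(q ^ k, z ^ k)\<close>. The factor \<open>CPhi 1 (q ^ k)\<close> is the constant of that
  series.\<close>

lemma CPhi_theta_average:
  assumes "norm q < 1" "q \<noteq> 0" "z \<noteq> 0" "k > 0"
  shows "CPhi k q * theta_prod (q ^ k) (z ^ k)
       = CPhi 1 (q ^ k) * ((\<Sum>r<k. theta_prod q (z * cis1 (of_nat r / of_nat k)) ^ k) / of_nat k)"
proof -
  have qk: "norm (q ^ k) < 1" "q ^ k \<noteq> 0" "z ^ k \<noteq> 0"
    using assms by (auto simp: norm_power power_less_one_iff)
  have "((\<lambda>N. if int k dvd N - 0 then charge_coeff k q N * z powi N else 0) has_sum
      (\<Sum>r<k. cis1 (- (of_nat r * of_int 0 / of_nat k)) * theta_prod q (z * cis1 (of_nat r / of_nat k)) ^ k) / of_nat k) UNIV"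
    using assms by (intro roots_of_unity_filter charge_coeff_has_sum) auto
  hence "((\<lambda>N. charge_coeff k q N * z powi N) has_sum
      (\<Sum>r<k. theta_prod q (z * cis1 (of_nat r / of_nat k)) ^ k) / of_nat k) {N. int k dvd N}"
    by (subst has_sum_cong_neutral[where T = UNIV and g = "\<lambda>N. if int k dvd N then charge_coeff k q N * z powi N else 0"])
       auto
  hence "((\<lambda>m. charge_coeff k q (int k * m) * z powi (int k * m)) has_sum
      (\<Sum>r<k. theta_prod q (z * cis1 (of_nat r / of_nat k)) ^ k) / of_nat k) UNIV"
    using assms
    by (subst has_sum_reindex_bij_witness[where i = "\<lambda>N. N div int k" and j = "\<lambda>m. int k * m" and T = "{N. int k dvd N}"
            and h = "\<lambda>N. charge_coeff k q N * z powi N"]) auto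
  hence "((\<lambda>m. CPhi k q * (q ^ k) powi (m * (m + 1) div 2) * (z ^ k) powi m) has_sum
      (\<Sum>r<k. theta_prod q (z * cis1 (of_nat r / of_nat k)) ^ k) / of_nat k) UNIV"
    unfolding charge_coeff_multiple[OF assms(1,2)] CPhi_eq_charge_coeff[OF assms(1)]
    by (simp add: power_powi)
  hence "((\<lambda>m. CPhi 1 (q ^ k) * (CPhi k q * (q ^ k) powi (m * (m + 1) div 2) * (z ^ k) powi m)) has_sum
      CPhi 1 (q ^ k) * ((\<Sum>r<k. theta_prod q (z * cis1 (of_nat r / of_nat k)) ^ k) / of_nat k)) UNIV"
    by (rule has_sum_cmult_right)
  moreover have "((\<lambda>m. CPhi k q * (CPhi 1 (q ^ k) * (q ^ k) powi (m * (m + 1) div 2) * (z ^ k) powi m)) has_sum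
      CPhi k q * theta_prod (q ^ k) (z ^ k)) UNIV"
    by (intro has_sum_cmult_right theta_prod_has_sum qk)
  ultimately show ?thesis
    by (simp add: has_sum_iff mult_ac)
qed

lemma CPhi_0: "CPhi k 0 = 1"
proof -
  have "(\<lambda>n. of_nat (cphi k n) * 0 ^ n) sums (of_nat (cphi k 0) :: complex)"
    by (rule powser_sums_zero)
  thus ?thesis
    by (simp add: CPhi_def sums_iff cphi_0)
qed

lemma CPhi_holomorphic: "CPhi k holomorphic_on ball 0 1"
proof (rule power_series_holomorphic)
  fix w :: complex assume "w \<in> ball 0 1"
  thus "(\<lambda>n. of_nat (cphi k n) * (w - 0) ^ n) sums CPhi k w"
    using cphi_sums_charge_coeff[of w k] by (simp add: CPhi_eq_charge_coeff)
qed

lemma tendsto_qpoch_inf_self: "((\<lambda>q. qpoch_inf q q) \<longlongrightarrow> 1) (at 0)"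
proof (rule LIM_zero_cancel, rule Lim_null_comparison)
  have "eventually (\<lambda>q :: complex. q \<in> ball 0 1) (at 0)"
    by (intro eventually_at_in_open') auto
  thus "\<forall>\<^sub>F q :: complex in at 0. norm (qpoch_inf q q - 1) \<le> exp (norm q / (1 - norm q)) - 1"
    by eventually_elim (auto intro: qpoch_inf_minus_1_bound)
  have "((\<lambda>q :: complex. exp (norm q / (1 - norm q)) - 1) \<longlongrightarrow> exp (norm (0::complex) / (1 - norm (0 :: complex))) - 1) (at 0)"
    by (intro tendsto_intros) auto
  thus "((\<lambda>q :: complex. exp (norm q / (1 - norm q)) - 1) \<longlongrightarrow> 0) (at 0)"
    by simp
qed

section \<open>The constant of the triple product\<close>

lemma prod_lessThan_2: "(\<Prod>s<2. f s) = f 0 * f (1 :: nat)"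
  by (simp add: numeral_2_eq_2)

text \<open>The terms \<open>f m\<close> form the triple product series at
  \<open>(r ^ 2, \<i> / r)\<close>, those with even \<open>m\<close> the one at
  \<open>(r ^ 8, - 1 / r ^ 4)\<close>. Terms with odd \<open>m\<close> cancel against
  \<open>- m\<close>, so both sums equal \<open>S\<close>, and eliminating \<open>S\<close> leaves
  an identity of infinite products.\<close>

lemma CPhi_1_times_qpoch_pow4:
  assumes "norm r < 1" "r \<noteq> 0"
  shows "CPhi 1 (r ^ 2) * qpoch_inf (r ^ 2) (r ^ 2) = CPhi 1 (r ^ 8) * qpoch_inf (r ^ 8) (r ^ 8)"
proof -
  have nr: "norm (r ^ n) < 1" if "n > 0" for n
    using assms that by (simp add: norm_power power_less_one_iff)
  define f where "f = (\<lambda>m :: int. r powi (m * m) * \<i> powi m)"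
  have i_even: "\<i> powi (2 * j) = (-1) powi j" for j :: int
    by (simp add: power_int_mult)
  have sum1: "((\<lambda>m. CPhi 1 (r ^ 2) * f m) has_sum qpoch_inf (- (r ^ 2)) (r ^ 4)) UNIV"
  proof -
    have "theta_prod (r ^ 2) (\<i> / r) = qpoch_inf (- \<i> * r) (r ^ 2) * qpoch_inf (\<i> * r) (r ^ 2)"
      using assms by (simp add: theta_prod_def power2_eq_square field_simps)
    also have "\<dots> = (\<Prod>s<2. qpoch_inf (\<i> * r * cis1 (of_nat s / of_nat 2)) (r ^ 2))"
      using cis1_half by (simp add: numeral_2_eq_2 del: cis1_half)
    also have "\<dots> = qpoch_inf ((\<i> * r) ^ 2) ((r ^ 2) ^ 2)"
      using nr[of 2] by (intro qpoch_inf_roots_of_unity) auto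
    finally have th: "theta_prod (r ^ 2) (\<i> / r) = qpoch_inf (- (r ^ 2)) (r ^ 4)"
      by (simp add: power_mult_distrib power_mult[symmetric])
    have "(r ^ 2) powi (m * (m + 1) div 2) * (\<i> / r) powi m = f m" for m :: int
    proof -
      have "2 * (m * (m + 1) div 2) = m * m + m"
        by (simp add: algebra_simps)
      hence "(r ^ 2) powi (m * (m + 1) div 2) = r powi (m * m) * r powi m"
        using assms by (simp add: power_int_add power_powi)
      thus ?thesis
        using assms by (simp add: f_def power_int_divide_distrib)
    qed
    thus ?thesis
      using theta_prod_has_sum[of "r ^ 2" "\<i> / r"] nr[of 2] assms by (simp add: th mult.assoc)
  qed
  have sum2: "((\<lambda>j. CPhi 1 (r ^ 8) * f (2 * j)) has_sum qpoch_inf (r ^ 4) (r ^ 8) ^ 2) UNIV"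
  proof -
    have th: "theta_prod (r ^ 8) (- 1 / r ^ 4) = qpoch_inf (r ^ 4) (r ^ 8) ^ 2"
    proof -
      have "r ^ 8 = r ^ 4 * r ^ 4"
        by (simp flip: power_add)
      hence "r ^ 8 / r ^ 4 = r ^ 4"
        using assms by (simp only: nonzero_mult_div_cancel_right power_not_zero not_False_eq_True)
      thus ?thesis
        by (simp add: theta_prod_def power2_eq_square)
    qed
    have "(r ^ 8) powi (j * (j + 1) div 2) * (- 1 / r ^ 4) powi j = f (2 * j)" for j :: int
    proof -
      have "8 * (j * (j + 1) div 2) = 4 * (2 * (j * (j + 1) div 2))"
        by simp
      also have "2 * (j * (j + 1) div 2) = j * j + j"
        by (simp add: algebra_simps)
      finally have "(r ^ 8) powi (j * (j + 1) div 2) = r powi (4 * (j * j)) * r powi (4 * j)"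
        using assms by (simp add: power_int_add power_powi distrib_left)
      moreover have "(r ^ 4) powi j = r powi (4 * j)"
        by (simp add: power_powi)
      moreover have "(- 1 / r ^ 4) powi j = (-1) powi j / (r ^ 4) powi j"
        by (rule power_int_divide_distrib)
      moreover have "f (2 * j) = r powi (4 * (j * j)) * (-1) powi j"
        unfolding f_def i_even by (simp add: mult_ac)
      ultimately show ?thesis
        using assms by simp
    qed
    thus ?thesis
      using theta_prod_has_sum[of "r ^ 8" "- 1 / r ^ 4"] nr[of 8] assms by (simp add: th[symmetric] mult.assoc)
  qed
  \<comment> \<open>Allows the passage from summability of the multiples of \<open>f\<close> to
    summability of \<open>f\<close>.\<close>
  have "CPhi 1 (r ^ 2) \<noteq> 0"
  proof
    assume "CPhi 1 (r ^ 2) = 0"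
    hence "qpoch_inf (- (r ^ 2)) (r ^ 4) = 0"
      using sum1 by (simp add: has_sum_iff)
    thus False
      using qpoch_inf_nonzero[of "- (r ^ 2)" "r ^ 4"] nr[of 2] nr[of 4] by simp
  qed
  hence "f summable_on UNIV"
    using has_sum_imp_summable[OF sum1] summable_on_cmult_right'[of "CPhi 1 (r ^ 2)" f UNIV] by simp
  then obtain S where S: "(f has_sum S) UNIV"
    by (auto simp: summable_on_def)
  have f_odd: "f m + f (- m) = (if even m then 2 * f m else 0)" for m
  proof (cases "even m")
    case True
    then obtain j where j: "m = 2 * j" by blast
    have "(-1 :: complex) powi (- j) = (-1) powi j"
      by (simp add: power_int_minus flip: power_int_inverse)
    thus ?thesis
      using i_even[of j] i_even[of "- j"] by (simp add: f_def j)
  next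
    case False
    then obtain j where j: "m = 2 * j + 1" by (elim oddE)
    have odd: "\<i> powi (2 * a + 1) = (-1) powi a * \<i>" for a :: int
      by (simp add: power_int_add i_even)
    have "(-1 :: complex) powi (- a) = (-1) powi a" for a :: int
      by (simp add: power_int_minus flip: power_int_inverse)
    from this[of "j + 1"] have "(-1 :: complex) powi (- j - 1) = - ((-1) powi j)"
      by (simp add: power_int_add)
    moreover have "- m = 2 * (- j - 1) + 1"
      by (simp add: j)
    ultimately have "\<i> powi (- m) = - (\<i> powi m)"
      by (simp only: odd j mult_minus_left)
    thus ?thesis
      using False by (simp add: f_def)
  qed
  have "((\<lambda>m. f (- m)) has_sum S) UNIV"
    using S by (subst has_sum_reindex_bij_witness[where i = uminus and j = uminus and T = UNIV and h = f]) auto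
  from has_sum_add[OF S this] have "((\<lambda>m. if even m then 2 * f m else 0) has_sum S + S) UNIV"
    by (simp only: f_odd)
  hence "((\<lambda>m. 2 * f m) has_sum S + S) {m. even m}"
    by (subst has_sum_cong_neutral[where T = UNIV and g = "\<lambda>m. if even m then 2 * f m else 0"]) auto
  hence "((\<lambda>j. 2 * f (2 * j)) has_sum 2 * S) UNIV"
    by (subst has_sum_reindex_bij_witness[where i = "\<lambda>m. m div 2" and j = "\<lambda>j. 2 * j" and T = "{m. even m}"
            and h = "\<lambda>m. 2 * f m"]) auto
  hence S': "((\<lambda>j. f (2 * j)) has_sum S) UNIV"
    by (subst (asm) has_sum_cmult_right_iff) auto
  have e1: "CPhi 1 (r ^ 2) * S = qpoch_inf (- (r ^ 2)) (r ^ 4)"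
    by (rule has_sum_unique[OF has_sum_cmult_right[OF S] sum1])
  have e2: "CPhi 1 (r ^ 8) * S = qpoch_inf (r ^ 4) (r ^ 8) ^ 2"
    by (rule has_sum_unique[OF has_sum_cmult_right[OF S'] sum2])
  have pw: "r ^ 2 * r ^ 2 = r ^ 4" "(r ^ 2) ^ 2 = r ^ 4" "r ^ 4 * r ^ 4 = r ^ 8" "(r ^ 4) ^ 2 = r ^ 8"
    by (simp_all flip: power_add power_mult)
  have p1: "qpoch_inf (r ^ 2) (r ^ 2) = qpoch_inf (r ^ 2) (r ^ 4) * qpoch_inf (r ^ 4) (r ^ 4)"
    using qpoch_inf_multisection[of "r ^ 2" 2 "r ^ 2"] nr[of 2]
    by (simp add: prod_lessThan_2 pw)
  have p2: "qpoch_inf (r ^ 4) (r ^ 4) = qpoch_inf (r ^ 4) (r ^ 8) * qpoch_inf (r ^ 8) (r ^ 8)"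
    using qpoch_inf_multisection[of "r ^ 4" 2 "r ^ 4"] nr[of 4]
    by (simp add: prod_lessThan_2 pw)
  have p3: "qpoch_inf (r ^ 2) (r ^ 4) * qpoch_inf (- (r ^ 2)) (r ^ 4) = qpoch_inf (r ^ 4) (r ^ 8)"
    using qpoch_inf_roots_of_unity[of "r ^ 4" 2 "r ^ 2"] nr[of 4]
    by (simp add: prod_lessThan_2 pw)
  have nz: "qpoch_inf (r ^ 4) (r ^ 8) \<noteq> 0"
    using nr[of 4] nr[of 8] by (intro qpoch_inf_nonzero) auto
  have "S \<noteq> 0"
    using e2 nz by auto
  have "CPhi 1 (r ^ 2) * qpoch_inf (r ^ 2) (r ^ 2) * S
      = qpoch_inf (- (r ^ 2)) (r ^ 4) * qpoch_inf (r ^ 2) (r ^ 2)"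
    by (simp add: e1[symmetric])
  also have "\<dots> = (qpoch_inf (r ^ 2) (r ^ 4) * qpoch_inf (- (r ^ 2)) (r ^ 4)) * qpoch_inf (r ^ 4) (r ^ 8) * qpoch_inf (r ^ 8) (r ^ 8)"
    unfolding p1 p2 by (simp only: mult_ac)
  also have "\<dots> = qpoch_inf (r ^ 4) (r ^ 8) ^ 2 * qpoch_inf (r ^ 8) (r ^ 8)"
    unfolding p3 by (simp only: power2_eq_square)
  also have "\<dots> = CPhi 1 (r ^ 8) * qpoch_inf (r ^ 8) (r ^ 8) * S"
    unfolding e2[symmetric] by (simp only: mult_ac)
  finally show ?thesis
    using \<open>S \<noteq> 0\<close> by simp
qed

text \<open>The triple product series for \<open>(q, \<i>/\<surd>q)\<close> and \<open>(q\<^sup>4, -1/q\<^sup>2)\<close> coincide, so the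
  normalising factor takes the same value at \<open>q\<close> and \<open>q\<^sup>4\<close>, hence its value at \<open>0\<close>.\<close>

lemma CPhi_1_eq:
  assumes "norm q < 1"
  shows "CPhi 1 q = 1 / qpoch_inf q q"
proof (cases "q = 0")
  case False
  define D where "D = (\<lambda>q. CPhi 1 q * qpoch_inf q q)"
  have step: "D (q ^ 4) = D q" if "norm q < 1" for q
  proof (cases "q = 0")
    case False
    have "norm (csqrt q) < 1"
      using that by (simp add: norm_csqrt)
    from CPhi_1_times_qpoch_pow4[OF this] show ?thesis
      using False power_mult[of "csqrt q" 2 4] by (simp add: D_def)
  qed (simp add: D_def)
  have D: "D (q ^ (4 ^ n)) = D q" for n
  proof (induction n)
    case (Suc n)
    have "norm (q ^ (4 ^ n)) < 1"
      using assms by (simp add: norm_power power_less_one_iff)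
    from step[OF this] Suc show ?case
      by (simp add: power_mult[symmetric] mult.commute)
  qed simp
  have "isCont (CPhi 1) 0"
    using holomorphic_on_imp_continuous_on[OF CPhi_holomorphic[of 1]]
    by (simp add: continuous_on_eq_continuous_at)
  hence "(CPhi 1 \<longlongrightarrow> 1) (at 0)"
    by (metis CPhi_0 isCont_def)
  hence lim: "(D \<longlongrightarrow> 1) (at 0)"
    unfolding D_def using tendsto_mult[OF _ tendsto_qpoch_inf_self] by fastforce
  have "filterlim (\<lambda>n. q ^ (4 ^ n)) (at 0) sequentially"
  proof (rule filterlim_atI)
    have "strict_mono (\<lambda>n. 4 ^ n :: nat)"
      by (simp add: strict_mono_def)
    hence "filterlim (\<lambda>n. 4 ^ n :: nat) sequentially sequentially"
      by (rule filterlim_subseq)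
    thus "(\<lambda>n. q ^ (4 ^ n)) \<longlonglongrightarrow> 0"
      using filterlim_compose[OF LIMSEQ_power_zero[OF assms]] by blast
  qed (use False in auto)
  from filterlim_compose[OF lim this] have "(\<lambda>n. D q) \<longlonglongrightarrow> 1"
    by (simp only: D)
  hence "D q = 1"
    by (simp add: LIMSEQ_const_iff)
  thus ?thesis
    using qpoch_inf_nonzero[OF assms assms] by (simp add: D_def field_simps)
qed (use CPhi_0[of 1] in simp)

section \<open>The generating function of partitions\<close>

text \<open>A multiset over \<open>insert a A\<close> is a multiplicity of \<open>a\<close> together
  with a multiset over \<open>A\<close>; each admissible part contributes a geometric
  series.\<close>

lemma has_sum_multisets_finite:
  fixes q :: complex
  assumes "finite A" "0 \<notin> A" "norm q < 1"
  shows "(\<lambda>M. q ^ sum_mset M) abs_summable_on {M. set_mset M \<subseteq> A} \<and>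
         ((\<lambda>M. q ^ sum_mset M) has_sum (\<Prod>a\<in>A. 1 / (1 - q ^ a))) {M. set_mset M \<subseteq> A}"
  using assms(1,2)
proof (induction rule: finite_induct)
  case empty
  have "{M. set_mset M \<subseteq> {}} = {{#} :: nat multiset}"
    by auto
  thus ?case
    using has_sum_finite[of "{{#}}" "\<lambda>M. q ^ sum_mset M"] by simp
next
  case (insert a A)
  define f where "f = (\<lambda>n. (q ^ a) ^ n)"
  define g where "g = (\<lambda>M. q ^ sum_mset M)"
  let ?B = "{M. set_mset M \<subseteq> A}" and ?C = "{M. set_mset M \<subseteq> insert a A}"
  have qa: "norm (q ^ a) < 1"
    using insert.prems assms(3) by (auto simp: norm_power power_less_one_iff)
  have "summable (\<lambda>n. norm (f n))"
    using qa by (simp add: f_def norm_power[of "q ^ a"] summable_geometric)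
  hence f1: "f abs_summable_on UNIV"
    using norm_summable_imp_summable_on[of "\<lambda>n. norm (f n)"] by simp
  have "(\<lambda>n. (q ^ a) ^ n) sums (1 / (1 - q ^ a))"
    using qa by (rule geometric_sums)
  hence f2: "infsum f UNIV = 1 / (1 - q ^ a)"
    using norm_summable_imp_has_sum[OF \<open>summable (\<lambda>n. norm (f n))\<close>] unfolding f_def
    by (simp add: has_sum_iff)
  have g: "g abs_summable_on ?B" "infsum g ?B = (\<Prod>a\<in>A. 1 / (1 - q ^ a))"
    using insert by (auto simp: g_def has_sum_iff)
  have reindex: "((\<lambda>(n, M). F (replicate_mset n a + M)) has_sum S) (UNIV \<times> ?B) \<longleftrightarrow> (F has_sum S) ?C"
    for F :: "nat multiset \<Rightarrow> complex" and S
  proof (rule has_sum_reindex_bij_witness[where i = "\<lambda>M. (count M a, filter_mset (\<lambda>x. x \<noteq> a) M)"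
        and j = "\<lambda>(n, M). replicate_mset n a + M"])
    fix x :: "nat \<times> nat multiset" assume x: "x \<in> UNIV \<times> ?B"
    obtain n M where [simp]: "x = (n, M)" by (cases x)
    have a: "a \<notin># M"
      using x insert.hyps by auto
    show "(count (case x of (n, M) \<Rightarrow> replicate_mset n a + M) a,
          filter_mset (\<lambda>x. x \<noteq> a) (case x of (n, M) \<Rightarrow> replicate_mset n a + M)) = x"
      using a by (auto simp: not_in_iff filter_mset_eq_conv multiset_eq_iff)
    show "(case x of (n, M) \<Rightarrow> replicate_mset n a + M) \<in> ?C"
      using x by (auto split: if_splits)
  next
    fix M assume M: "M \<in> ?C"
    show "(case (count M a, filter_mset (\<lambda>x. x \<noteq> a) M) of (n, M) \<Rightarrow> replicate_mset n a + M) = M"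
      by (auto simp: multiset_eq_iff)
    show "(count M a, filter_mset (\<lambda>x. x \<noteq> a) M) \<in> UNIV \<times> ?B"
      using M by auto
  qed auto
  have eq: "(\<lambda>(n, M). f n * g M) = (\<lambda>(n, M). q ^ sum_mset (replicate_mset n a + M))"
    by (simp add: f_def g_def fun_eq_iff power_add power_mult sum_mset_replicate_mset mult.commute flip: power_mult)
  have "((\<lambda>(n, M). q ^ sum_mset (replicate_mset n a + M)) has_sum infsum f UNIV * infsum g ?B) (UNIV \<times> ?B)"
    using has_sum_times(2)[OF f1 g(1)] unfolding eq .
  hence hs: "((\<lambda>M. q ^ sum_mset M) has_sum (\<Prod>a\<in>insert a A. 1 / (1 - q ^ a))) ?C"
    unfolding reindex[where F = "\<lambda>M. q ^ sum_mset M"] f2 g(2) using insert.hyps by simp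
  hence "(\<lambda>M. q ^ sum_mset M) summable_on ?C"
    by (rule has_sum_imp_summable)
  hence "(\<lambda>M. q ^ sum_mset M) abs_summable_on ?C"
    by (rule iffD1[OF summable_on_iff_abs_summable_on_complex])
  with hs show ?case
    by blast
qed

lemma tendsto_inverse_qpoch:
  assumes "norm q < 1"
  shows "(\<lambda>m. \<Prod>a\<in>{1..m}. 1 / (1 - q ^ a)) \<longlonglongrightarrow> 1 / qpoch_inf q q"
proof -
  have "(\<lambda>m. 1 / (\<Prod>j<m. 1 - q * q ^ j)) \<longlonglongrightarrow> 1 / qpoch_inf q q"
    by (intro tendsto_intros qpoch_inf_tendsto qpoch_inf_nonzero assms)
  moreover have "(\<Prod>a\<in>{1..m}. 1 / (1 - q ^ a)) = 1 / (\<Prod>j<m. 1 - q * q ^ j)" for m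
    by (simp add: prod.atLeast1_atMost_eq prod_dividef)
  ultimately show ?thesis
    by simp
qed

lemma finite_multisets_bounded:
  assumes "finite F" "F \<subseteq> {M :: nat multiset. 0 \<notin># M}"
  obtains m where "F \<subseteq> {M. set_mset M \<subseteq> {1..m}}"
proof -
  have "finite (\<Union>(set_mset ` F))"
    using assms by auto
  then obtain m where m: "\<Union>(set_mset ` F) \<subseteq> {..m}"
    using finite_nat_iff_bounded_le by blast
  have "F \<subseteq> {M. set_mset M \<subseteq> {1..m}}"
  proof safe
    fix M x assume "M \<in> F" "x \<in># M"
    moreover from this have "x \<noteq> 0"
      using assms(2) by (metis mem_Collect_eq subsetD)
    ultimately show "x \<in> {1..m}"
      using m by (auto simp: Suc_le_eq)
  qed
  thus ?thesis
    by (rule that)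
qed

text \<open>Finite sums of norms are bounded by the convergent products taken at
  \<open>norm q\<close>, so the series over all multisets is summable; its value is identified
  through the multisets with parts at most \<open>m\<close>.\<close>

lemma num_partitions_sums:
  fixes q :: complex
  assumes "norm q < 1"
  shows "(\<lambda>n. of_nat (num_partitions n) * q ^ n) sums (1 / qpoch_inf q q)"
proof (rule has_sum_imp_sums, rule has_sum_fibers)
  let ?X = "{M :: nat multiset. 0 \<notin># M}"
  define r where "r = complex_of_real (norm q)"
  have r: "norm r < 1"
    using assms by (simp add: r_def)
  have "Bseq (\<lambda>m. \<Prod>a\<in>{1..m}. 1 / (1 - r ^ a))"
    using tendsto_inverse_qpoch[OF r] convergentI convergent_imp_Bseq by blast
  then obtain B where B: "\<And>m. norm (\<Prod>a\<in>{1..m}. 1 / (1 - r ^ a)) \<le> B"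
    unfolding Bseq_def by blast
  have "(\<lambda>M. norm (q ^ sum_mset M)) summable_on ?X"
  proof (rule nonneg_bdd_above_summable_on)
    show "bdd_above (sum (\<lambda>M. norm (q ^ sum_mset M)) ` {F. F \<subseteq> ?X \<and> finite F})"
    proof (rule bdd_aboveI2)
      fix F assume F: "F \<in> {F. F \<subseteq> ?X \<and> finite F}"
      then obtain m where m: "F \<subseteq> {M. set_mset M \<subseteq> {1..m}}"
        using finite_multisets_bounded by blast
      have hs: "((\<lambda>M. r ^ sum_mset M) has_sum (\<Prod>a\<in>{1..m}. 1 / (1 - r ^ a))) {M. set_mset M \<subseteq> {1..m}}"
        using has_sum_multisets_finite[of "{1..m}" r] r by auto
      have sm: "(\<lambda>M. norm (q ^ sum_mset M)) summable_on {M. set_mset M \<subseteq> {1..m}}"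
        using has_sum_multisets_finite[of "{1..m}" q] assms by auto
      have "(\<Sum>M\<in>F. norm (q ^ sum_mset M)) \<le> (\<Sum>\<^sub>\<infinity>M\<in>{M. set_mset M \<subseteq> {1..m}}. norm (q ^ sum_mset M))"
        using F m by (intro finite_sum_le_infsum sm) auto
      also have "\<dots> = norm (complex_of_real (\<Sum>\<^sub>\<infinity>M\<in>{M. set_mset M \<subseteq> {1..m}}. norm (q ^ sum_mset M)))"
        by (simp add: infsum_nonneg)
      also have "complex_of_real (\<Sum>\<^sub>\<infinity>M\<in>{M. set_mset M \<subseteq> {1..m}}. norm (q ^ sum_mset M))
          = (\<Prod>a\<in>{1..m}. 1 / (1 - r ^ a))"
        using has_sum_unique[OF _ hs] has_sum_of_real[OF has_sum_infsum[OF sm], where ?'a = complex]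
        by (simp add: r_def norm_power)
      also have "norm \<dots> \<le> B"
        by (rule B)
      finally show "(\<Sum>M\<in>F. norm (q ^ sum_mset M)) \<le> B" .
    qed
  qed auto
  hence "(\<lambda>M. q ^ sum_mset M) summable_on ?X"
    by (rule abs_summable_summable)
  then obtain s where s: "((\<lambda>M. q ^ sum_mset M) has_sum s) ?X"
    by (auto simp: summable_on_def)
  have sub: "{M. set_mset M \<subseteq> {1..m}} \<subseteq> ?X" for m
    by auto
  have "s = 1 / qpoch_inf q q"
  proof (rule ccontr)
    assume neq: "s \<noteq> 1 / qpoch_inf q q"
    define e where "e = dist s (1 / qpoch_inf q q) / 4"
    have e: "e > 0"
      using neq by (simp add: e_def)
    from s have "\<forall>\<^sub>F F in finite_subsets_at_top ?X. dist (\<Sum>M\<in>F. q ^ sum_mset M) s < e"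
      unfolding has_sum_def using e tendstoD by blast
    then obtain F where "finite F \<and> F \<subseteq> ?X \<and>
        (\<forall>G. finite G \<and> F \<subseteq> G \<and> G \<subseteq> ?X \<longrightarrow> dist (\<Sum>M\<in>G. q ^ sum_mset M) s < e)"
      unfolding eventually_finite_subsets_at_top by (rule exE)
    hence F: "finite F" "F \<subseteq> ?X"
        "\<And>G. finite G \<Longrightarrow> F \<subseteq> G \<Longrightarrow> G \<subseteq> ?X \<Longrightarrow> dist (\<Sum>M\<in>G. q ^ sum_mset M) s < e"
      by simp_all
    obtain m0 where m0: "F \<subseteq> {M. set_mset M \<subseteq> {1..m0}}"
      using finite_multisets_bounded[OF F(1,2)] by blast
    obtain m where m: "m \<ge> m0" "dist (\<Prod>a\<in>{1..m}. 1 / (1 - q ^ a)) (1 / qpoch_inf q q) < e"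
    proof -
      have "\<forall>\<^sub>F m in sequentially. m \<ge> m0 \<and> dist (\<Prod>a\<in>{1..m}. 1 / (1 - q ^ a)) (1 / qpoch_inf q q) < e"
        using tendstoD[OF tendsto_inverse_qpoch[OF assms] e] by (intro eventually_conj eventually_ge_at_top)
      thus ?thesis
        using that eventually_happens'[OF sequentially_bot] by blast
    qed
    have "((\<lambda>M. q ^ sum_mset M) has_sum (\<Prod>a\<in>{1..m}. 1 / (1 - q ^ a))) {M. set_mset M \<subseteq> {1..m}}"
      using has_sum_multisets_finite[of "{1..m}" q] assms by auto
    hence "\<forall>\<^sub>F G in finite_subsets_at_top {M. set_mset M \<subseteq> {1..m}}.
        dist (\<Sum>M\<in>G. q ^ sum_mset M) (\<Prod>a\<in>{1..m}. 1 / (1 - q ^ a)) < e"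
      unfolding has_sum_def using e tendstoD by blast
    then obtain H where "finite H \<and> H \<subseteq> {M. set_mset M \<subseteq> {1..m}} \<and>
        (\<forall>G. finite G \<and> H \<subseteq> G \<and> G \<subseteq> {M. set_mset M \<subseteq> {1..m}} \<longrightarrow>
          dist (\<Sum>M\<in>G. q ^ sum_mset M) (\<Prod>a\<in>{1..m}. 1 / (1 - q ^ a)) < e)"
      unfolding eventually_finite_subsets_at_top by (rule exE)
    hence H: "finite H" "H \<subseteq> {M. set_mset M \<subseteq> {1..m}}"
      "\<And>G. finite G \<Longrightarrow> H \<subseteq> G \<Longrightarrow> G \<subseteq> {M. set_mset M \<subseteq> {1..m}} \<Longrightarrow>
          dist (\<Sum>M\<in>G. q ^ sum_mset M) (\<Prod>a\<in>{1..m}. 1 / (1 - q ^ a)) < e"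
      by simp_all
    \<comment> \<open>One finite set close to both sums: it contains \<open>F\<close> and
      \<open>H\<close>, and its multisets have parts at most \<open>m\<close>.\<close>
    define G where "G = F \<union> H"
    have "{M. set_mset M \<subseteq> {1..m0}} \<subseteq> {M. set_mset M \<subseteq> {1..m}}"
      using m(1) by auto
    hence G: "finite G" "F \<subseteq> G" "H \<subseteq> G" "G \<subseteq> {M. set_mset M \<subseteq> {1..m}}" "G \<subseteq> ?X"
      using F H m0 sub[of m] by (auto simp: G_def)
    have "dist s (1 / qpoch_inf q q) \<le> dist (\<Sum>M\<in>G. q ^ sum_mset M) s
        + dist (\<Sum>M\<in>G. q ^ sum_mset M) (1 / qpoch_inf q q)"
      by (metis dist_commute dist_triangle)
    also have "dist (\<Sum>M\<in>G. q ^ sum_mset M) (1 / qpoch_inf q q)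
        \<le> dist (\<Sum>M\<in>G. q ^ sum_mset M) (\<Prod>a\<in>{1..m}. 1 / (1 - q ^ a))
          + dist (\<Prod>a\<in>{1..m}. 1 / (1 - q ^ a)) (1 / qpoch_inf q q)"
      by (rule dist_triangle)
    finally have "dist s (1 / qpoch_inf q q) < e + (e + e)"
      using F(3)[OF G(1,2,5)] H(3)[OF G(1,3,4)] m(2) by linarith
    thus False
      using e by (simp add: e_def)
  qed
  with s show "((\<lambda>M. q ^ sum_mset M) has_sum (1 / qpoch_inf q q)) ?X"
    by simp
  fix n
  have "{M \<in> ?X. sum_mset M = n} = {M. 0 \<notin># M \<and> sum_mset M = n}"
    by auto
  thus "((\<lambda>M. q ^ sum_mset M) has_sum of_nat (num_partitions n) * q ^ n) {M \<in> ?X. sum_mset M = n}"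
    using finite_partitions[of n] by (intro has_sum_finiteI) (auto simp: num_partitions_def)
qed

text \<open>Both arguments vary here, so \<open>qpoch_inf_holomorphic\<close> does not apply; the
  reciprocal is the partition power series and has no zeros.\<close>

lemma qpoch_inf_self_holomorphic: "(\<lambda>q. qpoch_inf q q) holomorphic_on ball 0 1"
proof -
  have "(\<lambda>q. 1 / qpoch_inf q q) holomorphic_on ball 0 1"
  proof (rule power_series_holomorphic)
    fix w :: complex assume "w \<in> ball 0 1"
    thus "(\<lambda>n. of_nat (num_partitions n) * (w - 0) ^ n) sums (1 / qpoch_inf w w)"
      using num_partitions_sums[of w] by simp
  qed
  hence "(\<lambda>q. 1 / (1 / qpoch_inf q q)) holomorphic_on ball 0 1"
    by (rule holomorphic_on_divide[OF holomorphic_on_const]) (auto simp: qpoch_inf_nonzero)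
  thus ?thesis
    by simp
qed

section \<open>Klein forms\<close>

lemma norm_cis1_less_1: "Im t > 0 \<Longrightarrow> norm (cis1 t) < 1"
  by (simp add: norm_cis1)

lemma Im_invert_pos: "Im t > 0 \<Longrightarrow> Im (- 1 / t) > 0"
  by (simp add: Im_divide field_simps) (simp add: divide_pos_pos sum_power2_gt_zero_iff complex_neq_0)

text \<open>In classical terms i theta_1(z) / eta^3: an odd function of \<open>z\<close> that
  vanishes exactly on the lattice and has derivative 2 pi i at 0.\<close>

definition klein :: "complex \<Rightarrow> complex \<Rightarrow> complex" where
  "klein z t = (cis1 (z / 2) - cis1 (- z / 2)) * qpoch_inf (cis1 (t + z)) (cis1 t)
     * qpoch_inf (cis1 (t - z)) (cis1 t) / qpoch_inf (cis1 t) (cis1 t) ^ 2"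

lemma klein_uminus: "klein (- z) t = - klein z t"
proof -
  have "cis1 (- z / 2) - cis1 (z / 2) = - (cis1 (z / 2) - cis1 (- z / 2))"
    by simp
  thus ?thesis
    by (simp only: klein_def minus_minus diff_minus_eq_add add_uminus_conv_diff mult_minus_left
        minus_divide_left) (simp only: mult_ac)
qed

lemma klein_add_1: "klein (z + 1) t = - klein z t"
proof -
  have "cis1 ((z + 1) / 2) = - cis1 (z / 2)" "cis1 (- (z + 1) / 2) = - cis1 (- z / 2)"
    using cis1_half by (simp_all add: add_divide_distrib diff_divide_distrib cis1_add cis1_diff del: cis1_half)
  moreover have "cis1 (t + (z + 1)) = cis1 (t + z)" "cis1 (t - (z + 1)) = cis1 (t - z)"
    by (simp_all add: cis1_add cis1_diff)
  moreover have "- cis1 (z / 2) - - cis1 (- z / 2) = - (cis1 (z / 2) - cis1 (- z / 2))"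
    by simp
  ultimately show ?thesis
    by (simp only: klein_def mult_minus_left minus_divide_left)
qed

text \<open>In the half-argument exponentials \<open>s\<close> and \<open>u\<close>, and after
  splitting off one factor of each product, the claim is a rational identity.\<close>

lemma klein_add_tau:
  assumes "Im t > 0"
  shows "klein (z + t) t = - cis1 (- t / 2 - z) * klein z t"
proof -
  define s u where "s = cis1 (z / 2)" and "u = cis1 (t / 2)"
  have nz [simp]: "s \<noteq> 0" "u \<noteq> 0"
    by (simp_all add: s_def u_def)
  have sz: "cis1 z = s ^ 2" and ut: "cis1 t = u ^ 2"
    by (simp_all add: s_def u_def cis1_power)
  have q: "norm (u ^ 2) < 1"
    using norm_cis1_less_1[OF assms] by (simp add: ut)
  define X Y where "X = qpoch_inf (u ^ 2 * s ^ 2 * u ^ 2) (u ^ 2)" and "Y = qpoch_inf (u ^ 2 / s ^ 2) (u ^ 2)"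
  have 1: "qpoch_inf (u ^ 2 * s ^ 2) (u ^ 2) = (1 - u ^ 2 * s ^ 2) * X"
    unfolding X_def by (rule qpoch_inf_rec[OF q])
  have 2: "qpoch_inf (1 / s ^ 2) (u ^ 2) = (1 - 1 / s ^ 2) * Y"
    unfolding Y_def by (subst qpoch_inf_rec[OF q]) simp
  have 3: "klein (z + t) t = (s * u - 1 / (s * u)) * X * ((1 - 1 / s ^ 2) * Y) / qpoch_inf (u ^ 2) (u ^ 2) ^ 2"
  proof -
    have "cis1 ((z + t) / 2) = s * u" "cis1 (- (z + t) / 2) = 1 / (s * u)"
      by (simp_all only: s_def u_def minus_divide_left[symmetric] cis1_minus add_divide_distrib cis1_add
          inverse_eq_divide)
    moreover have "cis1 (t + (z + t)) = u ^ 2 * s ^ 2 * u ^ 2"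
      by (simp only: cis1_add sz ut mult.assoc)
    moreover have "cis1 (t - (z + t)) = 1 / s ^ 2"
      by (simp add: cis1_minus sz inverse_eq_divide)
    ultimately show ?thesis
      by (simp only: klein_def X_def 2 ut)
  qed
  have 4: "klein z t = (s - 1 / s) * ((1 - u ^ 2 * s ^ 2) * X) * Y / qpoch_inf (u ^ 2) (u ^ 2) ^ 2"
  proof -
    have "cis1 (- z / 2) = 1 / s"
      by (simp only: s_def cis1_minus inverse_eq_divide minus_divide_left[symmetric])
    moreover have "cis1 (t + z) = u ^ 2 * s ^ 2" "cis1 (t - z) = u ^ 2 / s ^ 2"
      by (simp_all add: cis1_add cis1_diff sz ut)
    ultimately show ?thesis
      by (simp only: klein_def 1 Y_def ut s_def[symmetric])
  qed
  have 5: "cis1 (- t / 2 - z) = 1 / (u * s ^ 2)"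
    by (simp only: cis1_diff cis1_minus u_def sz inverse_eq_divide divide_divide_eq_left minus_divide_left[symmetric])
  have "(s * u - 1 / (s * u)) * X * ((1 - 1 / s ^ 2) * Y)
      = - (1 / (u * s ^ 2)) * ((s - 1 / s) * ((1 - u ^ 2 * s ^ 2) * X) * Y)"
    by (simp add: field_simps power2_eq_square)
  thus ?thesis
    unfolding 3 4 5 by simp
qed

lemma klein_tau_add_1: "klein z (t + 1) = klein z t"
  by (simp add: klein_def cis1_add cis1_diff)

lemma klein_holomorphic [holomorphic_intros]:
  assumes "Im t > 0" "f holomorphic_on S"
  shows "(\<lambda>z. klein (f z) t) holomorphic_on S"
  unfolding klein_def using norm_cis1_less_1[OF assms(1)] assms(2)
  by (intro holomorphic_intros) (auto simp: qpoch_inf_nonzero)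

lemma cis1_half_diff_eq_0_iff: "cis1 (z / 2) - cis1 (- z / 2) = 0 \<longleftrightarrow> cis1 z = 1"
proof -
  have "cis1 z = cis1 (z / 2) / cis1 (- z / 2)"
    by (simp flip: cis1_diff)
  thus ?thesis
    by simp
qed

text \<open>The three factors of \<open>klein\<close> vanish on the lattice points with
  \<open>n = 0\<close>, \<open>n < 0\<close> and \<open>n > 0\<close> respectively; the converse
  propagates the zero at the origin by the quasi-periods.\<close>

lemma klein_eq_0_iff:
  assumes "Im t > 0"
  shows "klein z t = 0 \<longleftrightarrow> (\<exists>m n :: int. z = of_int m + of_int n * t)"
proof
  have q: "norm (cis1 t) < 1"
    by (rule norm_cis1_less_1[OF assms])
  assume "klein z t = 0"
  then consider "cis1 z = 1" | j where "cis1 (t + z) * cis1 t ^ j = 1" | j where "cis1 (t - z) * cis1 t ^ j = 1"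
    using qpoch_inf_nonzero[OF q q] cis1_half_diff_eq_0_iff[of z]
    by (auto simp: klein_def qpoch_inf_eq_0_iff[OF q])
  thus "\<exists>m n :: int. z = of_int m + of_int n * t"
  proof cases
    case 1
    then obtain m :: int where "z = of_int m"
      by (auto simp: cis1_eq_1_iff)
    thus ?thesis
      by (intro exI[of _ m] exI[of _ 0]) simp
  next
    case (2 j)
    hence "cis1 (t + z + of_nat j * t) = 1"
      by (simp add: cis1_power cis1_add)
    then obtain m :: int where "t + z + of_nat j * t = of_int m"
      by (auto simp: cis1_eq_1_iff)
    hence "z = of_int m + of_int (- int j - 1) * t"
      by (simp add: algebra_simps)
    thus ?thesis by blast
  next
    case (3 j)
    hence "cis1 (t - z + of_nat j * t) = 1"
      by (simp add: cis1_power cis1_add)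
    then obtain m :: int where "t - z + of_nat j * t = of_int m"
      by (auto simp: cis1_eq_1_iff)
    hence "z = of_int (- m) + of_int (int j + 1) * t"
      by (simp add: algebra_simps)
    thus ?thesis by blast
  qed
next
  assume "\<exists>m n :: int. z = of_int m + of_int n * t"
  then obtain m n :: int where z: "z = of_int m + of_int n * t"
    by blast
  have shift_tau: "klein (w + t) t = 0 \<longleftrightarrow> klein w t = 0" for w
    by (simp add: klein_add_tau[OF assms])
  have "klein (of_int n * t) t = 0"
  proof (induction n rule: int_induct[where k = 0])
    case base
    show ?case by (simp add: klein_def)
  next
    case (step1 i)
    thus ?case
      using shift_tau[of "of_int i * t"] by (simp add: distrib_right)
  next
    case (step2 i)
    thus ?case
      using shift_tau[of "of_int (i - 1) * t"] by (simp add: left_diff_distrib)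
  qed
  hence "klein (of_int m + of_int n * t) t = 0"
  proof (induction m rule: int_induct[where k = 0])
    case (step1 i)
    thus ?case
      using klein_add_1[of "of_int i + of_int n * t" t] by (simp add: add_ac)
  next
    case (step2 i)
    thus ?case
      using klein_add_1[of "of_int (i - 1) + of_int n * t" t] by (simp add: algebra_simps)
  qed simp
  thus "klein z t = 0"
    by (simp add: z)
qed

lemma klein_deriv_0:
  assumes "Im t > 0"
  shows "((\<lambda>z. klein z t) has_field_derivative 2 * of_real pi * \<i>) (at 0)"
proof -
  have q: "norm (cis1 t) < 1"
    by (rule norm_cis1_less_1[OF assms])
  define h where "h = (\<lambda>z. qpoch_inf (cis1 (t + z)) (cis1 t)
     * qpoch_inf (cis1 (t - z)) (cis1 t) / qpoch_inf (cis1 t) (cis1 t) ^ 2)"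
  have "h holomorphic_on UNIV"
    unfolding h_def using q by (intro holomorphic_intros) (auto simp: qpoch_inf_nonzero)
  hence "(h has_field_derivative deriv h 0) (at 0)"
    by (auto intro: holomorphic_derivI)
  moreover have "((\<lambda>z. cis1 (z / 2) - cis1 (- z / 2)) has_field_derivative 2 * of_real pi * \<i>) (at 0)"
    unfolding cis1_def by (auto intro!: derivative_eq_intros)
  ultimately have "((\<lambda>z. (cis1 (z / 2) - cis1 (- z / 2)) * h z) has_field_derivative
      2 * of_real pi * \<i> * h 0 + deriv h 0 * (cis1 (0 / 2) - cis1 (- 0 / 2))) (at 0)"
    by (rule DERIV_mult[rotated])
  moreover have "h 0 = 1"
    using qpoch_inf_nonzero[OF q q] by (simp add: h_def power2_eq_square)
  ultimately show ?thesis
    by (simp add: klein_def h_def mult.assoc)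
qed

lemma lattice_reduce:
  assumes "Im t > 0"
  obtains m n :: int and a b :: real
  where "z = of_int m + of_int n * t + (of_real a + of_real b * t)" "a \<in> {0..1}" "b \<in> {0..1}"
proof -
  define y where "y = Im z / Im t"
  define x where "x = Re z - y * Re t"
  have "z = of_real x + of_real y * t"
    using assms by (simp add: complex_eq_iff x_def y_def)
  moreover have "x = of_int \<lfloor>x\<rfloor> + frac x" "y = of_int \<lfloor>y\<rfloor> + frac y"
    by (simp_all add: frac_def)
  ultimately have "z = of_int \<lfloor>x\<rfloor> + of_int \<lfloor>y\<rfloor> * t + (of_real (frac x) + of_real (frac y) * t)"
    by (simp add: frac_def algebra_simps)
  thus ?thesis
    by (intro that) (auto simp: frac_lt_1 less_imp_le)
qed

text \<open>Both sides have the same simple zeros and the same quasi-periods, so their quotient is a bounded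
  entire function; its value is read off from the derivatives at \<open>0\<close>.\<close>

lemma klein_inversion:
  assumes t: "Im t > 0"
  shows "klein (z / t) (- 1 / t) = 1 / t * cis1 (z ^ 2 / (2 * t)) * klein z t"
proof -
  have t0: "t \<noteq> 0"
    using t by auto
  define t' where "t' = - 1 / t"
  have t': "Im t' > 0"
    unfolding t'_def by (rule Im_invert_pos[OF t])
  \<comment> \<open>The Gaussian factor is chosen so that \<open>f\<close> has the quasi-periods of
    \<open>klein z t\<close>.\<close>
  define f where "f = (\<lambda>z. klein (z / t) t' * cis1 (- (z ^ 2) / (2 * t)))"
  \<comment> \<open>The value \<open>1 / t\<close> at lattice points is the ratio of the derivatives
    at \<open>0\<close>, so the singularities are removable and \<open>R\<close> is entire.\<close>
  define R where "R = (\<lambda>z. if klein z t = 0 then 1 / t else f z / klein z t)"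
  have f_1: "f (z + 1) = - f z" for z
  proof -
    have "klein (z / t) t' = klein ((z + 1) / t + t') t'"
      using t0 by (simp add: t'_def field_simps)
    also have "\<dots> = - cis1 (- t' / 2 - (z + 1) / t) * klein ((z + 1) / t) t'"
      by (rule klein_add_tau[OF t'])
    finally have "f z = - (cis1 (- t' / 2 - (z + 1) / t) * cis1 (- (z ^ 2) / (2 * t))) * klein ((z + 1) / t) t'"
      by (simp add: f_def)
    also have "cis1 (- t' / 2 - (z + 1) / t) * cis1 (- (z ^ 2) / (2 * t)) = cis1 (- ((z + 1) ^ 2) / (2 * t))"
      unfolding cis1_add[symmetric] using t0
      by (intro arg_cong[of _ _ cis1]) (simp add: t'_def field_simps power2_eq_square)
    finally show ?thesis
      by (simp add: f_def)
  qed
  have f_t: "f (z + t) = - cis1 (- t / 2 - z) * f z" for z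
  proof -
    have "klein ((z + t) / t) t' = - klein (z / t) t'"
      using t0 klein_add_1[of "z / t" t'] by (simp add: add_divide_distrib)
    moreover have "cis1 (- ((z + t) ^ 2) / (2 * t)) = cis1 (- t / 2 - z) * cis1 (- (z ^ 2) / (2 * t))"
      unfolding cis1_add[symmetric] using t0
      by (intro arg_cong[of _ _ cis1]) (simp add: field_simps power2_eq_square)
    ultimately show ?thesis
      by (simp add: f_def)
  qed
  have R_1: "R (z + 1) = R z" for z
    by (simp add: R_def f_1 klein_add_1)
  have R_t: "R (z + t) = R z" for z
    by (simp add: R_def f_t klein_add_tau[OF t])
  have R_int: "R (z + of_int m) = R z" for z m
  proof (induction m rule: int_induct[where k = 0])
    case (step1 i)
    thus ?case
      using R_1[of "z + of_int i"] by (simp add: add_ac)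
  next
    case (step2 i)
    thus ?case
      using R_1[of "z + of_int (i - 1)"] by (simp add: algebra_simps)
  qed simp
  have R_tint: "R (z + of_int m * t) = R z" for z m
  proof (induction m rule: int_induct[where k = 0])
    case (step1 i)
    thus ?case
      using R_t[of "z + of_int i * t"] by (simp add: algebra_simps)
  next
    case (step2 i)
    thus ?case
      using R_t[of "z + of_int (i - 1) * t"] by (simp add: algebra_simps)
  qed simp
  have R_lat: "R (z + (of_int m + of_int n * t)) = R z" for z m n
    using R_tint[of "z + of_int m" n] R_int[of z m] by (simp add: add.assoc)
  have holf: "f holomorphic_on UNIV"
    unfolding f_def using t0 by (intro holomorphic_intros t') auto
  have holk: "(\<lambda>z. klein z t) holomorphic_on UNIV"
    by (intro holomorphic_intros t)
  have diff_off: "R field_differentiable at w" if "klein w t \<noteq> 0" for w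
  proof -
    define U where "U = {z. klein z t \<noteq> 0}"
    have "open U"
      unfolding U_def using holomorphic_on_imp_continuous_on[OF holk]
      by (intro open_Collect_neq continuous_on_const)
    moreover have "(\<lambda>z. f z / klein z t) holomorphic_on U"
      by (intro holomorphic_on_divide holomorphic_on_subset[OF holf] holomorphic_on_subset[OF holk])
         (auto simp: U_def)
    hence "R holomorphic_on U"
      by (rule holomorphic_transform) (simp add: R_def U_def)
    ultimately show ?thesis
      using that holomorphic_on_imp_differentiable_at[of R U w] by (simp add: U_def)
  qed
  have klim: "((\<lambda>z. klein z t / z) \<longlongrightarrow> 2 * of_real pi * \<i>) (at 0)"
    using klein_deriv_0[OF t] by (simp add: has_field_derivative_iff klein_def)
  have flim: "((\<lambda>z. f z / z) \<longlongrightarrow> 2 * of_real pi * \<i> / t) (at 0)"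
  proof -
    have "((\<lambda>w. klein w t') has_field_derivative 2 * of_real pi * \<i>) (at (0 / t))"
      using klein_deriv_0[OF t'] by simp
    hence "((\<lambda>z. klein (z / t) t') has_field_derivative 2 * of_real pi * \<i> * (1 / t)) (at 0)"
      by (rule DERIV_chain2) (use t0 in \<open>auto intro!: derivative_eq_intros\<close>)
    moreover have "(\<lambda>z. cis1 (- (z ^ 2) / (2 * t))) holomorphic_on UNIV"
      using t0 by (intro holomorphic_intros) auto
    hence "((\<lambda>z. cis1 (- (z ^ 2) / (2 * t))) has_field_derivative deriv (\<lambda>z. cis1 (- (z ^ 2) / (2 * t))) 0) (at 0)"
      by (auto intro: holomorphic_derivI)
    ultimately have "(f has_field_derivative 2 * of_real pi * \<i> * (1 / t) * cis1 (- (0 ^ 2) / (2 * t))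
        + deriv (\<lambda>z. cis1 (- (z ^ 2) / (2 * t))) 0 * klein (0 / t) t') (at 0)"
      unfolding f_def by (rule DERIV_mult)
    thus ?thesis
      by (simp add: has_field_derivative_iff klein_def f_def)
  qed
  have nz0: "eventually (\<lambda>z. klein z t \<noteq> 0) (at 0)"
  proof -
    have "eventually (\<lambda>z. klein z t / z \<noteq> 0) (at 0)"
      using klim by (rule tendsto_imp_eventually_ne) simp
    thus ?thesis
      by eventually_elim auto
  qed
  have diff_0: "R field_differentiable at 0"
  proof -
    obtain e where e: "e > 0" "\<And>z. z \<noteq> 0 \<Longrightarrow> dist z 0 < e \<Longrightarrow> klein z t \<noteq> 0"
      using nz0 unfolding eventually_at by auto
    have "R holomorphic_on ball 0 e"
    proof (rule no_isolated_singularity'[where K = "{0}"])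
      show "R holomorphic_on ball 0 e - {0}"
      proof (rule holomorphic_onI)
        fix w :: complex assume "w \<in> ball 0 e - {0}"
        thus "R field_differentiable at w within ball 0 e - {0}"
          using e(2)[of w] diff_off[of w] by (auto intro: field_differentiable_at_within)
      qed
      fix z :: complex assume z: "z \<in> {0}"
      have "((\<lambda>z. (f z / z) / (klein z t / z)) \<longlongrightarrow> (2 * of_real pi * \<i> / t) / (2 * of_real pi * \<i>)) (at 0)"
        by (intro tendsto_divide flim klim) simp
      hence "((\<lambda>z. (f z / z) / (klein z t / z)) \<longlongrightarrow> R 0) (at 0)"
        using t0 by (simp add: R_def klein_def)
      moreover have "eventually (\<lambda>z. z \<noteq> 0) (at (0 :: complex))"
        by (simp add: eventually_at_filter)
      with nz0 have "eventually (\<lambda>z. (f z / z) / (klein z t / z) = R z) (at 0)"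
        by eventually_elim (simp add: R_def)
      ultimately have "(R \<longlongrightarrow> R 0) (at 0)"
        using tendsto_cong by fastforce
      thus "(R \<longlongrightarrow> R z) (at z within ball 0 e)"
        using z by (auto intro: tendsto_within_subset)
    qed auto
    thus ?thesis
      using e(1) by (auto intro: holomorphic_on_imp_differentiable_at)
  qed
  have "R field_differentiable at w" for w
  proof (cases "klein w t = 0")
    case True
    then obtain m n :: int where w: "w = of_int m + of_int n * t"
      using klein_eq_0_iff[OF t] by blast
    have "R = (\<lambda>z. R (z - w))"
      using R_lat[of "z - w" m n for z] by (simp add: w fun_eq_iff)
    moreover have "(R \<circ> (\<lambda>z. z - w)) field_differentiable at w"
      using diff_0 by (intro field_differentiable_compose) (auto intro!: derivative_intros)
    ultimately show ?thesis
      by (simp add: o_def)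
  qed (rule diff_off)
  hence holR: "R holomorphic_on UNIV"
    by (simp add: holomorphic_on_def)
  have "bounded (range R)"
  proof -
    have "compact ((\<lambda>(a, b). of_real a + of_real b * t) ` ({0..1} \<times> {0..1 :: real}))"
      by (intro compact_continuous_image compact_Times compact_Icc) (auto intro!: continuous_intros simp: case_prod_unfold)
    hence "compact (R ` ((\<lambda>(a, b). of_real a + of_real b * t) ` ({0..1} \<times> {0..1 :: real})))"
      using holomorphic_on_imp_continuous_on[OF holR]
      by (rule_tac compact_continuous_image) (auto intro: continuous_on_subset)
    moreover have "range R \<subseteq> R ` ((\<lambda>(a, b). of_real a + of_real b * t) ` ({0..1} \<times> {0..1 :: real}))"
    proof safe
      fix z
      obtain m n :: int and a b :: real
        where z: "z = of_int m + of_int n * t + (of_real a + of_real b * t)" and ab: "a \<in> {0..1}" "b \<in> {0..1}"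
        using lattice_reduce[OF t, of z] by metis
      have "R z = R (of_real a + of_real b * t)"
        using R_lat[of "of_real a + of_real b * t" m n] by (simp add: z add_ac)
      thus "R z \<in> R ` ((\<lambda>(a, b). of_real a + of_real b * t) ` ({0..1} \<times> {0..1 :: real}))"
        using ab by (auto intro!: imageI image_eqI[of _ _ "(a, b)"])
    qed
    ultimately show ?thesis
      by (meson bounded_subset compact_imp_bounded)
  qed
  with holR have "R constant_on UNIV"
    by (rule Liouville_theorem)
  hence "R z = R 0"
    by (auto simp: constant_on_def)
  hence Rz: "R z = 1 / t"
    by (simp add: R_def klein_def)
  have cis: "cis1 (z ^ 2 / (2 * t)) * cis1 (- (z ^ 2) / (2 * t)) = 1"
    by (simp flip: cis1_add)
  have "f z = 1 / t * klein z t"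
  proof (cases "klein z t = 0")
    case True
    then obtain m n :: int where z: "z = of_int m + of_int n * t"
      using klein_eq_0_iff[OF t] by blast
    hence "z / t = of_int n + of_int (- m) * t'"
      using t0 by (simp add: t'_def field_simps)
    hence "klein (z / t) t' = 0"
      using klein_eq_0_iff[OF t'] by blast
    with True show ?thesis
      by (simp add: f_def)
  next
    case False
    thus ?thesis
      using Rz t0 by (simp add: R_def field_simps)
  qed
  hence fz: "f z * cis1 (z ^ 2 / (2 * t)) = 1 / t * klein z t * cis1 (z ^ 2 / (2 * t))"
    by (rule arg_cong)
  have "klein (z / t) t' = klein (z / t) t' * (cis1 (z ^ 2 / (2 * t)) * cis1 (- (z ^ 2) / (2 * t)))"
    unfolding cis by simp
  also have "\<dots> = f z * cis1 (z ^ 2 / (2 * t))"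
    unfolding f_def by (simp only: mult_ac)
  finally show ?thesis
    unfolding fz t'_def by (simp only: mult_ac)
qed

text \<open>The exponential factor makes \<open>SL\<^sub>2(\<int>)\<close> act on these forms of weight \<open>-1\<close> purely through the row
  vector \<open>(a, b)\<close>.\<close>

definition kform :: "complex \<Rightarrow> complex \<Rightarrow> complex \<Rightarrow> complex \<Rightarrow> complex" where
  "kform a b z t = cis1 (a ^ 2 * t / 2 + a * z + a * b / 2) * klein (z + a * t + b) t"

section \<open>Translation, inversion and lattice shifts of the forms\<close>

lemma kform_translate: "kform a b z (t + 1) = kform a (a + b) z t"
proof -
  have "z + a * (t + 1) + b = z + a * t + (a + b)"
    "a ^ 2 * (t + 1) / 2 + a * z + a * b / 2 = a ^ 2 * t / 2 + a * z + a * (a + b) / 2"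
    by (simp_all add: field_simps power2_eq_square)
  thus ?thesis
    by (simp only: kform_def klein_tau_add_1)
qed

text \<open>The square supplied by \<open>klein_inversion\<close> completes the exponent of
  \<open>kform a b\<close> to that of \<open>kform b (- a)\<close>; at \<open>z = 0\<close> only the
  weight factor \<open>1 / t\<close> is left.\<close>

lemma kform_invert:
  assumes "Im t > 0"
  shows "kform a b (z / t) (- 1 / t) = 1 / t * cis1 (z ^ 2 / (2 * t)) * kform b (- a) z t"
proof -
  have t0: "t \<noteq> 0"
    using assms by auto
  define w where "w = z + b * t + - a"
  have 1: "z / t + a * (- 1 / t) + b = w / t"
    using t0 by (simp add: w_def field_simps)
  have 2: "a ^ 2 * (- 1 / t) / 2 + a * (z / t) + a * b / 2 + w ^ 2 / (2 * t)
      = z ^ 2 / (2 * t) + (b ^ 2 * t / 2 + b * z + b * (- a) / 2)"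
    using t0 by (simp add: w_def field_simps power2_eq_square)
  have "kform a b (z / t) (- 1 / t)
      = 1 / t * (cis1 (a ^ 2 * (- 1 / t) / 2 + a * (z / t) + a * b / 2) * cis1 (w ^ 2 / (2 * t))) * klein w t"
    unfolding kform_def 1 klein_inversion[OF assms] by (simp only: mult_ac)
  also have "\<dots> = 1 / t * (cis1 (z ^ 2 / (2 * t)) * cis1 (b ^ 2 * t / 2 + b * z + b * (- a) / 2)) * klein w t"
    by (simp only: cis1_add[symmetric] 2)
  finally show ?thesis
    unfolding kform_def w_def by (simp only: mult_ac)
qed

lemma kform_add_1_left:
  assumes "Im t > 0"
  shows "kform (a + 1) b z t = - cis1 (- b / 2) * kform a b z t"
proof -
  have 1: "z + (a + 1) * t + b = (z + a * t + b) + t"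
    by (simp add: algebra_simps)
  have 2: "((a + 1) ^ 2 * t / 2 + (a + 1) * z + (a + 1) * b / 2) + (- t / 2 - (z + a * t + b))
      = - b / 2 + (a ^ 2 * t / 2 + a * z + a * b / 2)"
    by (simp add: field_simps power2_eq_square)
  have "kform (a + 1) b z t
      = - (cis1 ((a + 1) ^ 2 * t / 2 + (a + 1) * z + (a + 1) * b / 2) * cis1 (- t / 2 - (z + a * t + b)))
         * klein (z + a * t + b) t"
    unfolding kform_def 1 klein_add_tau[OF assms] by (simp only: mult_ac mult_minus_left mult_minus_right)
  thus ?thesis
    unfolding kform_def cis1_add[symmetric] 2 by (simp only: cis1_add mult_ac mult_minus_left mult_minus_right)
qed

lemma kform_add_1_right: "kform a (b + 1) z t = - cis1 (a / 2) * kform a b z t"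
proof -
  have 1: "z + a * t + (b + 1) = (z + a * t + b) + 1"
    by simp
  have 2: "a ^ 2 * t / 2 + a * z + a * (b + 1) / 2 = a / 2 + (a ^ 2 * t / 2 + a * z + a * b / 2)"
    by (simp add: field_simps)
  show ?thesis
    unfolding kform_def 1 2 klein_add_1 by (simp only: cis1_add mult_ac mult_minus_left mult_minus_right)
qed

lemma kform_uminus: "kform (- a) (- b) 0 t = - kform a b 0 t"
proof -
  have "0 + - a * t + - b = - (0 + a * t + b)"
    by simp
  thus ?thesis
    unfolding kform_def by (simp only: klein_uminus) simp
qed

lemma kform_add_2_left:
  assumes "Im t > 0"
  shows "kform (a + 2) b z t = cis1 (- b) * kform a b z t"
proof -
  have "kform (a + 2) b z t = kform ((a + 1) + 1) b z t"
    by (simp add: add.assoc)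
  also have "\<dots> = (cis1 (- b / 2) * cis1 (- b / 2)) * kform a b z t"
    by (simp only: kform_add_1_left[OF assms] mult_ac mult_minus_left mult_minus_right minus_minus)
  also have "cis1 (- b / 2) * cis1 (- b / 2) = cis1 (- b)"
    by (simp only: cis1_add[symmetric]) simp
  finally show ?thesis .
qed

lemma kform_add_2_right: "kform a (b + 2) z t = cis1 a * kform a b z t"
proof -
  have "kform a (b + 2) z t = kform a ((b + 1) + 1) z t"
    by (simp add: add.assoc)
  also have "\<dots> = (cis1 (a / 2) * cis1 (a / 2)) * kform a b z t"
    by (simp only: kform_add_1_right mult_ac mult_minus_left mult_minus_right minus_minus)
  also have "cis1 (a / 2) * cis1 (a / 2) = cis1 a"
    by (simp only: cis1_add[symmetric]) simp
  finally show ?thesis .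
qed

lemma multiplicative_shift_int:
  fixes f :: "complex \<Rightarrow> complex"
  assumes "\<And>x. f (x + 2) = cis1 c * f x"
  shows "f (x + 2 * of_int m) = cis1 (of_int m * c) * f x"
proof (induction m rule: int_induct[where k = 0])
  case (step1 i)
  have "f (x + 2 * of_int (i + 1)) = f ((x + 2 * of_int i) + 2)"
    by (simp add: algebra_simps)
  also have "\<dots> = cis1 (of_int i * c) * cis1 c * f x"
    by (subst assms, subst step1(2)) (simp only: mult_ac)
  also have "cis1 (of_int i * c) * cis1 c = cis1 (of_int (i + 1) * c)"
    by (simp only: cis1_add[symmetric]) (simp add: algebra_simps)
  finally show ?case .
next
  case (step2 i)
  have "cis1 c * f (x + 2 * of_int (i - 1)) = f ((x + 2 * of_int (i - 1)) + 2)"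
    by (simp only: assms)
  also have "(x + 2 * of_int (i - 1)) + 2 = x + 2 * of_int i"
    by (simp add: algebra_simps)
  also have "f \<dots> = cis1 (c + of_int (i - 1) * c) * f x"
    using step2 by (simp add: algebra_simps)
  finally show ?case
    by (simp add: cis1_add mult.assoc)
qed simp

text \<open>Even shifts only: single ones bring a sign and a halved exponent, whereas here nothing
  but a character is left.\<close>

lemma kform_shift:
  assumes "Im t > 0"
  shows "kform (a + 2 * of_int m) (b + 2 * of_int n) z t = cis1 (of_int n * a - of_int m * b) * kform a b z t"
proof -
  have "kform (a + 2 * of_int m) (b + 2 * of_int n) z t
      = cis1 (of_int m * - (b + 2 * of_int n)) * kform a (b + 2 * of_int n) z t"
    by (rule multiplicative_shift_int) (rule kform_add_2_left[OF assms])
  also have "kform a (b + 2 * of_int n) z t = cis1 (of_int n * a) * kform a b z t"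
    by (rule multiplicative_shift_int) (rule kform_add_2_right)
  also have "cis1 (of_int m * - (b + 2 * of_int n)) * (cis1 (of_int n * a) * kform a b z t)
      = cis1 (of_int m * - (b + 2 * of_int n) + of_int n * a) * kform a b z t"
    by (simp only: cis1_add mult.assoc)
  also have "cis1 (of_int m * - (b + 2 * of_int n) + of_int n * a) = cis1 (of_int n * a - of_int m * b)"
    by (rule cis1_cong[of _ _ "- 2 * m * n"]) (simp add: algebra_simps)
  finally show ?thesis .
qed

lemma kform_eq_0_iff:
  "kform a b z t = 0 \<longleftrightarrow> klein (z + a * t + b) t = 0"
  by (simp add: kform_def)

subsection \<open>The discriminant\<close>

text \<open>The discriminant, of weight 12; it will cancel the weight of
  \<open>eprod a b t ^ 2\<close>.\<close>

definition Delta :: "complex \<Rightarrow> complex" where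
  "Delta t = cis1 t * qpoch_inf (cis1 t) (cis1 t) ^ 24"

lemma Delta_add_1: "Delta (t + 1) = Delta t"
  by (simp add: Delta_def cis1_add)

lemma Delta_nonzero: "Im t > 0 \<Longrightarrow> Delta t \<noteq> 0"
  by (simp add: Delta_def qpoch_inf_nonzero norm_cis1_less_1)

text \<open>The product over the nonzero 2-torsion points, of weight -3. It makes
  \<open>Delta\<close> accessible through Klein forms.\<close>

definition two_torsion_prod :: "complex \<Rightarrow> complex" where
  "two_torsion_prod t = kform (1/2) 0 0 t * kform 0 (1/2) 0 t * kform (1/2) (1/2) 0 t"

text \<open>The three products cancel by Euler's identity (-q;q) (q;q^2) = 1, because
  \<open>u ^ 2 = q\<close> gives (u;q) (-u;q) = (q;q^2).\<close>

lemma two_torsion_prod_pow4: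
  assumes "Im t > 0"
  shows "two_torsion_prod t ^ 4 * Delta t = - 16"
proof -
  define r where "r = cis1 (t / 8)"
  define q u where "q = cis1 t" and "u = cis1 (t / 2)"
  have r [simp]: "r \<noteq> 0"
    by (simp add: r_def)
  have r2: "cis1 (t / 4) = r ^ 2" and u: "u = r ^ 4" and q: "q = r ^ 8" and u2: "q = u ^ 2"
    by (simp_all add: r_def u_def q_def cis1_power)
  have q0: "q \<noteq> 0"
    by (simp add: q_def)
  have nq: "norm q < 1"
    using norm_cis1_less_1[OF assms] by (simp add: q_def)
  have nq2: "norm (q ^ 2) < 1"
    using nq by (simp add: norm_power power_less_one_iff)
  have nu: "norm u < 1" "u \<noteq> 0"
    using assms norm_cis1_less_1[of "t / 2"] by (simp_all add: u_def)
  define A where "A = qpoch_inf q q"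
  have A: "A \<noteq> 0" "qpoch_inf (q ^ 2) (q ^ 2) \<noteq> 0"
    unfolding A_def using nq nq2 by (simp_all add: qpoch_inf_nonzero)
  have k1: "kform 0 (1/2) 0 t = 2 * \<i> * qpoch_inf (- q) q ^ 2 / A ^ 2"
  proof -
    have "cis1 (1 / 2 / 2) = \<i>" "cis1 (- (1 / 2) / 2) = - \<i>"
      using cis1_quarter cis1_minus[of "1/4"] by simp_all
    moreover have "cis1 (t + 1 / 2) = - q" "cis1 (t - 1 / 2) = - q"
      unfolding cis1_add cis1_diff cis1_half by (simp_all add: q_def)
    ultimately show ?thesis
      unfolding kform_def klein_def by (simp add: A_def q_def[symmetric] power2_eq_square)
  qed
  have k2: "kform (1/2) 0 0 t = - (1 / r) * qpoch_inf u q ^ 2 / A ^ 2"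
  proof -
    have c: "cis1 (t / 2 / 2) = r ^ 2" "cis1 (- (t / 2) / 2) = 1 / r ^ 2"
      using r2 by (simp_all add: cis1_minus inverse_eq_divide)
    have d: "cis1 (t + t / 2) = u * q" "cis1 (t - t / 2) = u"
      by (simp_all only: cis1_add u_def q_def mult.commute) simp
    have e: "qpoch_inf u q = (1 - r ^ 4) * qpoch_inf (u * q) q"
      using qpoch_inf_rec[OF nq, of u] by (simp add: u)
    have "(1 / 2) ^ 2 * t / 2 + 1 / 2 * 0 + 1 / 2 * 0 / 2 = t / 8" "0 + 1 / 2 * t + 0 = t / 2"
      by (simp_all add: power2_eq_square)
    hence "kform (1/2) 0 0 t = r * ((r ^ 2 - 1 / r ^ 2) * qpoch_inf (u * q) q * qpoch_inf u q / A ^ 2)"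
      unfolding kform_def klein_def by (simp only: c d A_def q_def[symmetric] r_def[symmetric])
    also have "\<dots> = - (1 / r) * (((1 - r ^ 4) * qpoch_inf (u * q) q) * qpoch_inf u q) / A ^ 2"
      using A by (simp add: field_simps power2_eq_square power4_eq_xxxx)
    finally show ?thesis
      unfolding e[symmetric] by (simp only: power2_eq_square)
  qed
  have k3: "kform (1/2) (1/2) 0 t = \<i> * cis1 (1/8) * (1 / r) * qpoch_inf (- u) q ^ 2 / A ^ 2"
  proof -
    have "cis1 (t / 4 + 1 / 4) = r ^ 2 * \<i>"
      unfolding cis1_add cis1_quarter r2 ..
    moreover have "(t / 2 + 1 / 2) / 2 = t / 4 + 1 / 4" "- (t / 2 + 1 / 2) / 2 = - (t / 4 + 1 / 4)"
      by (simp_all add: field_simps)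
    ultimately have c: "cis1 ((t / 2 + 1 / 2) / 2) = r ^ 2 * \<i>" "cis1 (- (t / 2 + 1 / 2) / 2) = - \<i> / r ^ 2"
      by (simp_all only: cis1_minus) (simp add: field_simps)
    have "t + (t / 2 + 1 / 2) = t / 2 + t + 1 / 2" "t - (t / 2 + 1 / 2) = t / 2 - 1 / 2"
      by (simp_all add: field_simps)
    hence d: "cis1 (t + (t / 2 + 1 / 2)) = - u * q" "cis1 (t - (t / 2 + 1 / 2)) = - u"
      by (simp_all only: cis1_add cis1_diff cis1_half u_def q_def) simp_all
    have e: "qpoch_inf (- u) q = (1 + r ^ 4) * qpoch_inf (- u * q) q"
      using qpoch_inf_rec[OF nq, of "- u"] by (simp add: u)
    have "(1 / 2) ^ 2 * t / 2 + 1 / 2 * 0 + 1 / 2 * (1 / 2) / 2 = t / 8 + 1 / 8" "0 + 1 / 2 * t + 1 / 2 = t / 2 + 1 / 2"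
      by (simp_all add: power2_eq_square)
    hence "kform (1/2) (1/2) 0 t = r * cis1 (1 / 8) * ((r ^ 2 * \<i> - - \<i> / r ^ 2) * qpoch_inf (- u * q) q * qpoch_inf (- u) q / A ^ 2)"
      unfolding kform_def klein_def by (simp only: c d A_def q_def[symmetric] r_def[symmetric] cis1_add[of "t / 8"])
    also have "\<dots> = \<i> * cis1 (1 / 8) * (1 / r) * (((1 + r ^ 4) * qpoch_inf (- u * q) q) * qpoch_inf (- u) q) / A ^ 2"
      using A by (simp add: field_simps power2_eq_square power4_eq_xxxx)
    finally show ?thesis
      unfolding e[symmetric] by (simp only: power2_eq_square)
  qed
  have "qpoch_inf (- q) q * (qpoch_inf u q * qpoch_inf (- u) q) = 1"
  proof -
    have "qpoch_inf u q * qpoch_inf (- u) q = qpoch_inf q (q ^ 2)"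
      using qpoch_inf_roots_of_unity[OF nq, of 2 u] by (simp add: prod_lessThan_2 u2)
    moreover have "A * qpoch_inf (- q) q = qpoch_inf (q ^ 2) (q ^ 2)"
      using qpoch_inf_roots_of_unity[OF nq, of 2 q] by (simp add: prod_lessThan_2 A_def)
    moreover have "A = qpoch_inf q (q ^ 2) * qpoch_inf (q ^ 2) (q ^ 2)"
      using qpoch_inf_multisection[OF nq, of 2 q] by (simp add: prod_lessThan_2 A_def power2_eq_square)
    ultimately have "A * (qpoch_inf (- q) q * (qpoch_inf u q * qpoch_inf (- u) q)) = A"
      by (simp add: mult_ac)
    thus ?thesis
      using A by simp
  qed
  moreover have "two_torsion_prod t = 2 * cis1 (1/8) * (1 / r ^ 2)
      * (qpoch_inf (- q) q * (qpoch_inf u q * qpoch_inf (- u) q)) ^ 2 / A ^ 6"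
    unfolding two_torsion_prod_def k1 k2 k3 using A
    by (simp add: field_simps eval_nat_numeral)
  ultimately have "two_torsion_prod t = 2 * cis1 (1/8) * (1 / r ^ 2) / A ^ 6"
    by simp
  hence "two_torsion_prod t ^ 4 = 16 * cis1 (1/8) ^ 4 / (q * A ^ 24)"
    unfolding q by (simp add: power_divide power_mult_distrib flip: power_mult)
  moreover have "cis1 (1/8) ^ 4 = - 1"
    by (simp add: cis1_power)
  ultimately show ?thesis
    using A q0 by (simp add: Delta_def q_def[symmetric] A_def[symmetric])
qed

text \<open>Inversion permutes the 2-torsion points and, apart from the weight, produces only
  \<open>- \<i>\<close>, which the fourth power removes.\<close>

lemma Delta_invert:
  assumes "Im t > 0"
  shows "Delta (- 1 / t) = t ^ 12 * Delta t"
proof -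
  have t0: "t \<noteq> 0"
    using assms by auto
  have t': "Im (- 1 / t) > 0"
    by (rule Im_invert_pos[OF assms])
  have inv: "kform a b 0 (- 1 / t) = 1 / t * kform b (- a) 0 t" for a b
    using kform_invert[OF assms, of a b 0] by simp
  have "kform 0 (- (1/2)) 0 t = - kform 0 (1/2) 0 t"
    using kform_uminus[of 0 "1/2" t] by simp
  moreover have "kform (1/2) (1/2) 0 t = - \<i> * kform (1/2) (- (1/2)) 0 t"
    using kform_add_1_right[of "1/2" "- (1/2)" 0 t] cis1_quarter by simp
  hence "kform (1/2) (- (1/2)) 0 t = \<i> * kform (1/2) (1/2) 0 t"
    by simp
  ultimately have "two_torsion_prod (- 1 / t) = - \<i> / t ^ 3 * two_torsion_prod t"
    unfolding two_torsion_prod_def inv by (simp add: eval_nat_numeral field_simps)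
  hence "two_torsion_prod (- 1 / t) ^ 4 = two_torsion_prod t ^ 4 / t ^ 12"
    by (simp add: power_mult_distrib power_divide flip: power_mult)
  moreover have "two_torsion_prod t ^ 4 * Delta t = - 16" "two_torsion_prod (- 1 / t) ^ 4 * Delta (- 1 / t) = - 16"
    using two_torsion_prod_pow4[OF assms] two_torsion_prod_pow4[OF t'] .
  moreover have "two_torsion_prod t ^ 4 \<noteq> 0"
    using two_torsion_prod_pow4[OF assms] by auto
  ultimately have "two_torsion_prod t ^ 4 * (Delta (- 1 / t) / t ^ 12) = two_torsion_prod t ^ 4 * Delta t"
    by simp
  hence "Delta (- 1 / t) / t ^ 12 = Delta t"
    using \<open>two_torsion_prod t ^ 4 \<noteq> 0\<close> mult_left_cancel by blast
  thus ?thesis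
    using t0 by (simp add: field_simps)
qed

section \<open>Modular families of level 13\<close>

text \<open>The factor 2 is a unit modulo 13, so the subgroup is unchanged, while index shifts by 13
  become the even shifts of \<open>kform_shift\<close>.\<close>

definition tors :: "int \<Rightarrow> int \<Rightarrow> int \<Rightarrow> complex \<Rightarrow> complex \<Rightarrow> complex" where
  "tors a b k z t = kform (2 * of_int (k * a) / 13) (2 * of_int (k * b) / 13) z t"

lemma tors_translate: "tors a b k z (t + 1) = tors a (a + b) k z t"
proof -
  have "2 * of_int (k * a) / 13 + 2 * of_int (k * b) / 13 = (2 * of_int (k * (a + b)) / 13 :: complex)"
    by (simp add: field_simps)
  thus ?thesis
    by (simp only: tors_def kform_translate)
qed

lemma tors_invert:
  assumes "Im t > 0"
  shows "tors a b k (z / t) (- 1 / t) = 1 / t * cis1 (z ^ 2 / (2 * t)) * tors b (- a) k z t"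
  by (simp add: tors_def kform_invert[OF assms, simplified])

lemma tors_scale: "tors (c * a) (c * b) k z t = tors a b (c * k) z t"
  by (simp add: tors_def mult_ac)

text \<open>The 13th root of unity is quadratic in \<open>k\<close>; it vanishes in 13th powers and
  in the products over \<open>{-6..6}\<close> and \<open>{1..6}\<close>.\<close>

lemma tors_shift:
  assumes "Im t > 0"
  shows "tors (a + 13 * m) (b + 13 * n) k z t = cis1 (of_int (2 * k ^ 2 * (n * a - m * b)) / 13) * tors a b k z t"
proof -
  have "2 * of_int (k * (a + 13 * m)) / 13 = 2 * of_int (k * a) / 13 + (2 * of_int (k * m) :: complex)"
    "2 * of_int (k * (b + 13 * n)) / 13 = 2 * of_int (k * b) / 13 + (2 * of_int (k * n) :: complex)"
    by (simp_all add: field_simps)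
  moreover have "of_int (k * n) * (2 * of_int (k * a) / 13) - of_int (k * m) * (2 * of_int (k * b) / 13)
      = (of_int (2 * k ^ 2 * (n * a - m * b)) / 13 :: complex)"
    by (simp add: field_simps power2_eq_square)
  ultimately show ?thesis
    by (simp only: tors_def kform_shift[OF assms])
qed

text \<open>The added lattice vector is parallel to \<open>(a, b)\<close>, so the character in
  \<open>kform_shift\<close> is trivial.\<close>

lemma tors_period:
  assumes "Im t > 0"
  shows "tors a b (k + 13 * m) z t = tors a b k z t"
proof -
  have "2 * of_int ((k + 13 * m) * a) / 13 = 2 * of_int (k * a) / 13 + (2 * of_int (m * a) :: complex)"
    "2 * of_int ((k + 13 * m) * b) / 13 = 2 * of_int (k * b) / 13 + (2 * of_int (m * b) :: complex)"
    by (simp_all add: field_simps)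
  moreover have "of_int (m * b) * (2 * of_int (k * a) / 13) - of_int (m * a) * (2 * of_int (k * b) / 13) = (0 :: complex)"
    by (simp add: field_simps)
  ultimately show ?thesis
    by (simp only: tors_def kform_shift[OF assms] cis1_0 mult_1)
qed

lemma tors_uminus: "tors a b (- k) 0 t = - tors a b k 0 t"
  using kform_uminus[of "2 * of_int (k * a) / 13" "2 * of_int (k * b) / 13" t] by (simp add: tors_def)

lemma tors_0: "tors a b 0 0 t = 0"
  by (simp add: tors_def kform_def klein_def)

lemma tors_nonzero:
  assumes "Im t > 0" "klein (13 * z) t \<noteq> 0"
  shows "tors a b k z t \<noteq> 0"
proof
  assume "tors a b k z t = 0"
  hence "klein (z + 2 * of_int (k * a) / 13 * t + 2 * of_int (k * b) / 13) t = 0"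
    by (simp add: tors_def kform_eq_0_iff)
  then obtain m n :: int where mn: "z + 2 * of_int (k * a) / 13 * t + 2 * of_int (k * b) / 13 = of_int m + of_int n * t"
    using klein_eq_0_iff[OF assms(1)] by blast
  hence "z = of_int m + of_int n * t - 2 * of_int (k * a) / 13 * t - 2 * of_int (k * b) / 13"
    by (simp add: algebra_simps)
  hence "13 * z = 13 * (of_int m + of_int n * t - 2 * of_int (k * a) / 13 * t - 2 * of_int (k * b) / 13)"
    by (rule arg_cong)
  also have "\<dots> = of_int (13 * m - 2 * (k * b)) + of_int (13 * n - 2 * (k * a)) * t"
    by (simp add: field_simps)
  finally have "13 * z = of_int (13 * m - 2 * (k * b)) + of_int (13 * n - 2 * (k * a)) * t" .
  hence "klein (13 * z) t = 0"
    using klein_eq_0_iff[OF assms(1)] by blast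
  thus False
    using assms(2) by simp
qed

lemma prime_13_dvd_mult_iff: "(13 :: int) dvd m * n \<longleftrightarrow> 13 dvd m \<or> 13 dvd n"
proof -
  have "prime (13 :: int)"
    by simp
  thus ?thesis
    by (rule prime_dvd_mult_iff)
qed

lemma tors_0_nonzero:
  assumes "Im t > 0" "\<not> (13 dvd a \<and> 13 dvd b)" "\<not> 13 dvd k"
  shows "tors a b k 0 t \<noteq> 0"
proof
  assume "tors a b k 0 t = 0"
  hence "klein (0 + 2 * of_int (k * a) / 13 * t + 2 * of_int (k * b) / 13) t = 0"
    by (simp add: tors_def kform_eq_0_iff)
  then obtain m n :: int where mn: "0 + 2 * of_int (k * a) / 13 * t + 2 * of_int (k * b) / 13 = of_int m + of_int n * t"
    using klein_eq_0_iff[OF assms(1)] by blast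
  hence "of_int (2 * (k * b) - 13 * m) = of_int (13 * n - 2 * (k * a)) * t"
    by (simp add: field_simps)
  hence eq: "complex_of_real (of_int (2 * (k * b) - 13 * m)) = complex_of_real (of_int (13 * n - 2 * (k * a))) * t"
    by simp
  have "Im (complex_of_real (of_int (13 * n - 2 * (k * a))) * t) = 0"
    unfolding eq[symmetric] by simp
  hence 1: "13 * n - 2 * (k * a) = 0"
    using assms(1) by (simp del: of_int_diff of_int_mult)
  hence "complex_of_real (of_int (2 * (k * b) - 13 * m)) = 0"
    using eq by simp
  hence 2: "2 * (k * b) - 13 * m = 0"
    by (simp only: of_real_eq_0_iff of_int_eq_0_iff)
  have "13 dvd 2 * (k * a)" "13 dvd 2 * (k * b)"
    using 1 2 by (auto intro: dvdI[of _ _ n] dvdI[of _ _ m])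
  thus False
    using assms(2,3) by (simp add: prime_13_dvd_mult_iff)
qed

subsection \<open>Residue systems\<close>

lemma bij_betw_scale_residues:
  assumes "\<not> (13 :: int) dvd c"
  shows "bij_betw (\<lambda>k. (c * k + 6) mod 13 - 6) {-6..6 :: int} {-6..6}"
proof -
  have "inj_on (\<lambda>k. (c * k + 6) mod 13 - 6) {-6..6 :: int}"
  proof (rule inj_onI)
    fix k l :: int assume kl: "k \<in> {-6..6}" "l \<in> {-6..6}" "(c * k + 6) mod 13 - 6 = (c * l + 6) mod 13 - 6"
    hence "13 dvd (c * k + 6) - (c * l + 6)"
      by (simp add: mod_eq_dvd_iff)
    hence "13 dvd c * (k - l)"
      by (simp add: algebra_simps)
    hence "13 dvd k - l"
      using assms by (simp add: prime_13_dvd_mult_iff)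
    thus "k = l"
      using kl(1,2) by auto presburger
  qed
  moreover have "(\<lambda>k. (c * k + 6) mod 13 - 6) ` {-6..6 :: int} \<subseteq> {-6..6}"
    by (auto simp: image_subset_iff)
  ultimately show ?thesis
    by (simp add: bij_betw_def endo_inj_surj)
qed

lemma bij_betw_nat_residues: "bij_betw (\<lambda>r. (int r + 6) mod 13 - 6) {..<13} {-6..6}"
proof (rule bij_betw_byWitness[where f' = "\<lambda>k. nat (k mod 13)"])
  show "\<forall>r\<in>{..<13}. nat (((int r + 6) mod 13 - 6) mod 13) = r"
    by (auto simp: mod_diff_left_eq)
  show "\<forall>k\<in>{-6..6}. (int (nat (k mod 13)) + 6) mod 13 - 6 = k"
    by (auto simp: mod_add_left_eq)
  show "(\<lambda>r. (int r + 6) mod 13 - 6) ` {..<13} \<subseteq> {-6..6}"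
    by (auto simp: image_subset_iff)
  show "(\<lambda>k. nat (k mod 13)) ` {-6..6} \<subseteq> {..<13}"
    by (auto simp: nat_less_iff)
qed

lemma periodic_symmetric_residue:
  fixes F :: "int \<Rightarrow> 'a"
  assumes "\<And>k m. F (k + 13 * m) = F k"
  shows "F ((k + 6) mod 13 - 6) = F k"
proof -
  have "(k + 6) mod 13 - 6 = k + 13 * (- ((k + 6) div 13))"
    by (simp add: minus_mult_div_eq_mod[symmetric])
  thus ?thesis
    by (simp only: assms)
qed

lemma
  fixes F :: "int \<Rightarrow> complex"
  assumes per: "\<And>k m. F (k + 13 * m) = F k"
  shows sum_scale_residues: "\<not> 13 dvd c \<Longrightarrow> (\<Sum>k\<in>{-6..6}. F (c * k)) = (\<Sum>k\<in>{-6..6}. F k)"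
    and prod_scale_residues: "\<not> 13 dvd c \<Longrightarrow> (\<Prod>k\<in>{-6..6}. F (c * k)) = (\<Prod>k\<in>{-6..6}. F k)"
    and sum_nat_residues: "(\<Sum>r<13. F (int r)) = (\<Sum>k\<in>{-6..6}. F k)"
    and prod_nat_residues: "(\<Prod>r<13. F (int r)) = (\<Prod>k\<in>{-6..6}. F k)"
proof -
  have "F (c * k) = F ((c * k + 6) mod 13 - 6)" for k
    by (rule periodic_symmetric_residue[OF per, symmetric])
  thus "(\<Sum>k\<in>{-6..6}. F (c * k)) = (\<Sum>k\<in>{-6..6}. F k)" "(\<Prod>k\<in>{-6..6}. F (c * k)) = (\<Prod>k\<in>{-6..6}. F k)"
    if "\<not> 13 dvd c"
    using sum.reindex_bij_betw[OF bij_betw_scale_residues[OF that], of F]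
      prod.reindex_bij_betw[OF bij_betw_scale_residues[OF that], of F] by simp_all
  have "F (int r) = F ((int r + 6) mod 13 - 6)" for r
    by (rule periodic_symmetric_residue[OF per, symmetric])
  thus "(\<Sum>r<13. F (int r)) = (\<Sum>k\<in>{-6..6}. F k)" "(\<Prod>r<13. F (int r)) = (\<Prod>k\<in>{-6..6}. F k)"
    using sum.reindex_bij_betw[OF bij_betw_nat_residues, of F]
      prod.reindex_bij_betw[OF bij_betw_nat_residues, of F] by simp_all
qed

lemma symmetric_residues: "{-6..6 :: int} = {-6,-5,-4,-3,-2,-1,0,1,2,3,4,5,6}"
  by (rule set_eqI) (simp only: atLeastAtMost_iff insert_iff empty_iff, presburger)

lemma cis1_sum: "cis1 (\<Sum>x\<in>A. f x) = (\<Prod>x\<in>A. cis1 (f x))"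
  by (induction A rule: infinite_finite_induct) (simp_all add: cis1_add)

lemma cis1_of_int_mult_13: "cis1 (of_int n / 13) ^ 13 = 1"
  by (simp add: cis1_power)

subsection \<open>The theta quotient\<close>

text \<open>The value does not depend on \<open>z\<close>: averaging the 13th power of the theta function over the subgroup
  retains the charges divisible by 13, and their coefficients are multiples of the constant term.\<close>

definition theta_quot :: "int \<Rightarrow> int \<Rightarrow> complex \<Rightarrow> complex \<Rightarrow> complex" where
  "theta_quot a b z t = (\<Sum>k\<in>{-6..6}. tors a b k z t ^ 13) / (\<Prod>k\<in>{-6..6}. tors a b k z t) / 13"

lemma theta_quot_translate: "theta_quot a b z (t + 1) = theta_quot a (a + b) z t"
  by (simp add: theta_quot_def tors_translate)

lemma theta_quot_invert:
  assumes "Im t > 0"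
  shows "theta_quot a b (z / t) (- 1 / t) = theta_quot b (- a) z t"
proof -
  define C where "C = 1 / t * cis1 (z ^ 2 / (2 * t))"
  have C: "C \<noteq> 0"
    using assms by (auto simp: C_def)
  have "theta_quot a b (z / t) (- 1 / t)
      = (C ^ 13 * (\<Sum>k\<in>{-6..6}. tors b (- a) k z t ^ 13)) / (C ^ 13 * (\<Prod>k\<in>{-6..6}. tors b (- a) k z t)) / 13"
    unfolding theta_quot_def tors_invert[OF assms] C_def[symmetric]
    by (simp only: power_mult_distrib sum_distrib_left prod.distrib prod_constant) simp
  thus ?thesis
    using C by (simp add: theta_quot_def)
qed

lemma theta_quot_shift:
  assumes "Im t > 0"
  shows "theta_quot (a + 13 * m) (b + 13 * n) z t = theta_quot a b z t"
proof -
  define N where "N = n * a - m * b"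
  have "(\<Prod>k\<in>{-6..6}. cis1 (of_int (2 * k ^ 2 * N) / 13)) = cis1 (\<Sum>k\<in>{-6..6}. of_int (2 * k ^ 2 * N) / 13)"
    by (rule cis1_sum[symmetric])
  \<comment> \<open>The squares over \<open>{-6..6}\<close> add up to 182, and
    \<open>2 * 182 / 13 = 28\<close>.\<close>
  also have "(\<Sum>k\<in>{-6..6}. of_int (2 * k ^ 2 * N) / 13) = (of_int (28 * N) :: complex)"
    unfolding symmetric_residues by simp
  finally have P: "(\<Prod>k\<in>{-6..6}. cis1 (of_int (2 * k ^ 2 * N) / 13)) = 1"
    by (simp only: cis1_of_int)
  show ?thesis
    unfolding theta_quot_def tors_shift[OF assms] N_def[symmetric]
    by (simp only: power_mult_distrib cis1_of_int_mult_13 prod.distrib P mult_1)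
qed

lemma theta_quot_scale:
  assumes "Im t > 0" "\<not> 13 dvd c"
  shows "theta_quot (c * a) (c * b) z t = theta_quot a b z t"
proof -
  have "(\<Sum>k\<in>{-6..6}. tors a b (c * k) z t ^ 13) = (\<Sum>k\<in>{-6..6}. tors a b k z t ^ 13)"
    using assms by (intro sum_scale_residues[where F = "\<lambda>k. tors a b k z t ^ 13"]) (simp_all add: tors_period)
  moreover have "(\<Prod>k\<in>{-6..6}. tors a b (c * k) z t) = (\<Prod>k\<in>{-6..6}. tors a b k z t)"
    using assms by (intro prod_scale_residues[where F = "\<lambda>k. tors a b k z t"]) (simp_all add: tors_period)
  ultimately show ?thesis
    by (simp only: theta_quot_def tors_scale)
qed

text \<open>The minus sign before \<open>cis1 z\<close> turns the factors \<open>1 + ...\<close> of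
  the generating function into the factors \<open>1 - ...\<close> of the Klein form.\<close>

lemma theta_prod_klein:
  assumes "Im t > 0"
  shows "theta_prod (cis1 t) (- cis1 z) = cis1 (- z / 2) * qpoch_inf (cis1 t) (cis1 t) ^ 2 * klein z t"
proof -
  have q: "norm (cis1 t) < 1"
    by (rule norm_cis1_less_1[OF assms])
  have A: "qpoch_inf (cis1 t) (cis1 t) \<noteq> 0"
    using q by (simp add: qpoch_inf_nonzero)
  have 1: "qpoch_inf (cis1 (- z)) (cis1 t) = (1 - cis1 (- z)) * qpoch_inf (cis1 (t - z)) (cis1 t)"
    by (subst qpoch_inf_rec[OF q]) (simp add: cis1_minus cis1_diff field_simps)
  have 2: "cis1 (- z / 2) * (cis1 (z / 2) - cis1 (- z / 2)) = 1 - cis1 (- z)"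
    unfolding right_diff_distrib cis1_add[symmetric] by (simp add: field_simps)
  have "theta_prod (cis1 t) (- cis1 z) = qpoch_inf (cis1 (t + z)) (cis1 t) * qpoch_inf (cis1 (- z)) (cis1 t)"
    by (simp add: theta_prod_def cis1_add cis1_minus inverse_eq_divide mult.commute)
  also have "\<dots> = (cis1 (- z / 2) * (cis1 (z / 2) - cis1 (- z / 2))) * qpoch_inf (cis1 (t + z)) (cis1 t)
      * qpoch_inf (cis1 (t - z)) (cis1 t)"
    unfolding 1 2 by (simp only: mult_ac)
  finally show ?thesis
    unfolding klein_def using A by simp
qed

text \<open>Symmetric residues are used because their sum is 0. The freedom in \<open>d\<close>
  allows the roots of unity to be met in the order of the points \<open>2 * k / 13\<close>, with
  either sign.\<close>

lemma qpoch_inf_13: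
  assumes q: "norm q < 1" and d: "\<not> 13 dvd d"
  shows "qpoch_inf (c ^ 13) (q ^ 13) = (\<Prod>k\<in>{-6..6}. qpoch_inf (c * cis1 (of_int (d * k) / 13)) q)"
proof -
  define H where "H = (\<lambda>k :: int. qpoch_inf (c * cis1 (of_int k / 13)) q)"
  have Hper: "H (k + 13 * m) = H k" for k m
  proof -
    have "cis1 (of_int (k + 13 * m) / 13) = cis1 (of_int k / 13)"
      by (rule cis1_cong[of _ _ m]) (simp add: field_simps)
    thus ?thesis
      by (simp only: H_def)
  qed
  have "qpoch_inf (c ^ 13) (q ^ 13) = (\<Prod>r<13. H (int r))"
    using qpoch_inf_roots_of_unity[OF q, of 13 c] by (simp add: H_def)
  also have "\<dots> = (\<Prod>k\<in>{-6..6}. H k)"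
    by (rule prod_nat_residues) (rule Hper)
  also have "\<dots> = (\<Prod>k\<in>{-6..6}. H (d * k))"
    by (rule prod_scale_residues[symmetric]) (use Hper d in auto)
  finally show ?thesis
    by (simp add: H_def)
qed

text \<open>On the line \<open>(0, 1)\<close> the points are \<open>z + 2 * k / 13\<close>, so
  numerator and denominator are the two theta expressions in \<open>CPhi_theta_average\<close> for
  13. Their prefactors \<open>cis1 (- 13 * z / 2) * A ^ 26\<close> agree and cancel.\<close>

lemma theta_quot_0_1:
  assumes "Im t > 0" "klein (13 * z) t \<noteq> 0"
  shows "theta_quot 0 1 z t = CPhi 13 (cis1 t) * qpoch_inf (cis1 t ^ 13) (cis1 t ^ 13)"
proof -
  define q where "q = cis1 t"
  define A where "A = qpoch_inf q q"
  have q: "norm q < 1" "q \<noteq> 0" "norm (q ^ 13) < 1"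
    using norm_cis1_less_1[OF assms(1)] by (simp_all add: q_def norm_power power_less_one_iff)
  have A: "A \<noteq> 0"
    using q by (simp add: A_def qpoch_inf_nonzero)
  define Y where "Y = (\<lambda>k. z + 2 * of_int k / 13)"
  have tors: "tors 0 1 k z t = klein (Y k) t" for k
    by (simp add: tors_def kform_def Y_def)
  have T: "theta_prod q (- cis1 (Y k)) = cis1 (- Y k / 2) * A ^ 2 * klein (Y k) t" for k
    unfolding q_def A_def by (rule theta_prod_klein[OF assms(1)])
  define F where "F = (\<lambda>k :: int. theta_prod q (- cis1 (z + of_int k / 13)))"
  have per: "cis1 (z + of_int (k + 13 * m) / 13) = cis1 (z + of_int k / 13)" for k m
    by (rule cis1_cong[of _ _ m]) (simp add: field_simps)
  have F_2: "F (2 * k) = cis1 (- Y k / 2) * A ^ 2 * klein (Y k) t" for k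
    using T[of k] by (simp add: F_def Y_def)
  have Fper: "F (k + 13 * m) = F k" for k m
    by (simp only: F_def per)
  have sum: "(\<Sum>r<13. theta_prod q (- cis1 z * cis1 (of_nat r / of_nat 13)) ^ 13)
      = cis1 (- 13 * z / 2) * A ^ 26 * (\<Sum>k\<in>{-6..6}. tors 0 1 k z t ^ 13)"
  proof -
    have "(\<Sum>r<13. theta_prod q (- cis1 z * cis1 (of_nat r / of_nat 13)) ^ 13) = (\<Sum>r<13. F (int r) ^ 13)"
      by (simp add: F_def cis1_add)
    also have "\<dots> = (\<Sum>k\<in>{-6..6}. F k ^ 13)"
      by (rule sum_nat_residues[where F = "\<lambda>k. F k ^ 13"]) (simp only: Fper)
    also have "\<dots> = (\<Sum>k\<in>{-6..6}. F (2 * k) ^ 13)"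
      by (rule sum_scale_residues[where F = "\<lambda>k. F k ^ 13", symmetric]) (simp_all only: Fper, simp)
    also have "\<dots> = (\<Sum>k\<in>{-6..6}. cis1 (- 13 * z / 2) * A ^ 26 * tors 0 1 k z t ^ 13)"
    proof (rule sum.cong[OF refl])
      fix k
      \<comment> \<open>By the factor 2 in \<open>Y\<close> the exponent differs from
        \<open>- 13 * z / 2\<close> by the integer \<open>- k\<close>.\<close>
      have "cis1 (- Y k / 2) ^ 13 = cis1 (- 13 * z / 2)"
        unfolding cis1_power by (rule cis1_cong[of _ _ "- k"]) (simp add: Y_def field_simps)
      thus "F (2 * k) ^ 13 = cis1 (- 13 * z / 2) * A ^ 26 * tors 0 1 k z t ^ 13"
        by (simp add: F_2 tors power_mult_distrib flip: power_mult)
    qed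
    finally show ?thesis
      by (simp only: sum_distrib_left)
  qed
  have prod: "theta_prod (q ^ 13) ((- cis1 z) ^ 13) = cis1 (- 13 * z / 2) * A ^ 26 * (\<Prod>k\<in>{-6..6}. tors 0 1 k z t)"
  proof -
    define H where "H = (\<lambda>c (k :: int). qpoch_inf (c * cis1 (of_int k / 13)) q)"
    have H: "qpoch_inf (c ^ 13) (q ^ 13) = (\<Prod>k\<in>{-6..6}. H c (d * k))" if "\<not> 13 dvd d" for c d
      using qpoch_inf_13[OF q(1) that, of c] by (simp add: H_def)
    have e1: "- ((- cis1 z) ^ 13) * q ^ 13 = (cis1 z * q) ^ 13" "- 1 / (- cis1 z) ^ 13 = (1 / cis1 z) ^ 13"
      by (simp_all add: power_mult_distrib power_divide)
    \<comment> \<open>The multipliers \<open>2\<close> and \<open>- 2\<close> match the factors of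
      the two products that belong to the same point \<open>Y k\<close>.\<close>
    have "theta_prod (q ^ 13) ((- cis1 z) ^ 13) = (\<Prod>k\<in>{-6..6}. H (cis1 z * q) (2 * k)) * (\<Prod>k\<in>{-6..6}. H (1 / cis1 z) (- 2 * k))"
      unfolding theta_prod_def e1 by (subst H[of 2], simp, subst H[of "- 2"]) simp_all
    also have "\<dots> = (\<Prod>k\<in>{-6..6}. theta_prod q (- cis1 (Y k)))"
      unfolding prod.distrib[symmetric]
      by (intro prod.cong refl) (simp add: H_def theta_prod_def Y_def cis1_add cis1_minus inverse_eq_divide mult_ac)
    also have "\<dots> = (\<Prod>k\<in>{-6..6}. cis1 (- Y k / 2)) * (\<Prod>k\<in>{-6..6 :: int}. A ^ 2) * (\<Prod>k\<in>{-6..6}. klein (Y k) t)"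
      unfolding T prod.distrib by simp
    also have "(\<Prod>k\<in>{-6..6}. cis1 (- Y k / 2)) = cis1 (\<Sum>k\<in>{-6..6}. - Y k / 2)"
      by (rule cis1_sum[symmetric])
    also have "(\<Sum>k\<in>{-6..6}. - Y k / 2) = - 13 * z / 2"
      unfolding symmetric_residues by (simp add: Y_def field_simps)
    finally show ?thesis
      by (simp add: tors flip: power_mult)
  qed
  have nz: "(\<Prod>k\<in>{-6..6}. tors 0 1 k z t) \<noteq> 0"
    using tors_nonzero[OF assms, of 0 1] by simp
  have B: "qpoch_inf (q ^ 13) (q ^ 13) \<noteq> 0"
    using q by (simp add: qpoch_inf_nonzero)
  define c where "c = cis1 (- 13 * z / 2) * A ^ 26"
  have C: "c \<noteq> 0"
    using A by (simp add: c_def)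
  have "CPhi 13 q * (c * (\<Prod>k\<in>{-6..6}. tors 0 1 k z t))
      = 1 / qpoch_inf (q ^ 13) (q ^ 13) * ((c * (\<Sum>k\<in>{-6..6}. tors 0 1 k z t ^ 13)) / of_nat 13)"
    unfolding c_def prod[symmetric] sum[symmetric] CPhi_1_eq[OF q(3), symmetric]
    using q by (intro CPhi_theta_average) auto
  hence "c * (CPhi 13 q * (\<Prod>k\<in>{-6..6}. tors 0 1 k z t))
      = c * (1 / qpoch_inf (q ^ 13) (q ^ 13) * ((\<Sum>k\<in>{-6..6}. tors 0 1 k z t ^ 13) / 13))"
    by (simp add: mult_ac)
  hence "CPhi 13 q * (\<Prod>k\<in>{-6..6}. tors 0 1 k z t)
      = 1 / qpoch_inf (q ^ 13) (q ^ 13) * ((\<Sum>k\<in>{-6..6}. tors 0 1 k z t ^ 13) / 13)"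
    using C mult_left_cancel by blast
  hence "CPhi 13 q * qpoch_inf (q ^ 13) (q ^ 13)
      = (\<Sum>k\<in>{-6..6}. tors 0 1 k z t ^ 13) / 13 / (\<Prod>k\<in>{-6..6}. tors 0 1 k z t)"
    using nz B by (simp add: field_simps)
  thus ?thesis
    by (simp add: theta_quot_def q_def)
qed

text \<open>The index \<open>(a, b)\<close> stands for a line in \<open>(\<int>/13)\<^sup>2\<close>, that is, for a coset of \<open>\<Gamma>\<^sub>0(13)\<close> in \<open>SL\<^sub>2(\<int>)\<close>;
  \<open>(0, 1)\<close> gives the expansion at the cusp infinity and \<open>(1, 0)\<close> the one at the cusp 0.\<close>

definition translation_family :: "(int \<Rightarrow> int \<Rightarrow> complex \<Rightarrow> complex) \<Rightarrow> bool" where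
  "translation_family H \<longleftrightarrow> (\<forall>a b t. Im t > 0 \<longrightarrow> H a b (t + 1) = H a (a + b) t \<and>
     (\<forall>c. \<not> 13 dvd c \<longrightarrow> H (c * a) (c * b) t = H a b t) \<and>
     (\<forall>m n. H (a + 13 * m) (b + 13 * n) t = H a b t))"

text \<open>Inversion is kept apart from \<open>translation_family\<close>: for
  \<open>theta_quot\<close> the translation laws hold at every fixed \<open>z\<close>, but inversion
  moves \<open>z\<close>, and the independence of \<open>z\<close> that repairs this already relies
  on the translation laws.\<close>

definition modular_family :: "(int \<Rightarrow> int \<Rightarrow> complex \<Rightarrow> complex) \<Rightarrow> bool" where
  "modular_family H \<longleftrightarrow> translation_family H \<and>
     (\<forall>a b t. Im t > 0 \<longrightarrow> \<not> (13 dvd a \<and> 13 dvd b) \<longrightarrow> H a b (- 1 / t) = H b (- a) t)"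

lemma translation_familyD:
  assumes "translation_family H" "Im t > 0"
  shows "H a b (t + 1) = H a (a + b) t" "\<not> 13 dvd c \<Longrightarrow> H (c * a) (c * b) t = H a b t"
    "H (a + 13 * m) (b + 13 * n) t = H a b t"
  using assms unfolding translation_family_def by blast+

lemma modular_familyD:
  assumes "modular_family H"
  shows "translation_family H"
    "Im t > 0 \<Longrightarrow> \<not> (13 dvd a \<and> 13 dvd b) \<Longrightarrow> H a b (- 1 / t) = H b (- a) t"
  using assms unfolding modular_family_def by blast+

lemma translation_family_nat:
  assumes "translation_family H" "Im t > 0"
  shows "H a b (t + of_nat n) = H a (b + int n * a) t"
proof (induction n arbitrary: b)
  case (Suc n)
  have "Im (t + of_nat n) > 0"
    using assms by simp
  hence "H a b ((t + of_nat n) + 1) = H a (a + b) (t + of_nat n)"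
    by (rule translation_familyD[OF assms(1)])
  thus ?case
    using Suc[of "a + b"] by (simp add: algebra_simps)
qed simp

lemma bezout_13:
  assumes "\<not> (13 :: int) dvd a"
  shows "\<exists>x y. a * x + 13 * y = 1"
proof -
  have "prime (13 :: int)"
    by simp
  hence "coprime 13 a"
    using assms by (rule prime_imp_coprime)
  hence "gcd a 13 = 1"
    by (simp add: coprime_iff_gcd_eq_1 gcd.commute)
  thus ?thesis
    using bezout_int[of a 13] by (metis mult.commute)
qed

lemma ex_residue_multiple:
  assumes "\<not> (13 :: int) dvd a"
  obtains j :: nat and n where "j < 13" "b = a * int j + 13 * n"
proof -
  obtain x y where xy: "a * x + 13 * y = 1"
    using bezout_13[OF assms] by blast
  define j where "j = nat (x * b mod 13)"
  have j: "int j = x * b mod 13" "j < 13"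
    by (simp_all add: j_def nat_less_iff)
  have "b = (a * x + 13 * y) * b"
    by (simp add: xy)
  also have "\<dots> = a * (x * b) + 13 * (y * b)"
    by (simp add: algebra_simps)
  also have "x * b = int j + 13 * (x * b div 13)"
    by (simp add: j)
  finally have "b = a * int j + 13 * (a * (x * b div 13) + y * b)"
    by (simp add: algebra_simps)
  thus ?thesis
    using that j(2) by blast
qed

text \<open>The 14 lines modulo 13 are \<open>(0, 1)\<close> and \<open>(1, j)\<close>, and the
  latter are translates of \<open>(1, 0)\<close>; so two members of the family control all of
  it.\<close>

lemma translation_family_cases:
  assumes H: "translation_family H" and ab: "\<not> (13 dvd a \<and> 13 dvd b)" and t: "Im t > 0"
  shows "H a b t = H 0 1 t \<or> (\<exists>j<13. H a b t = H 1 0 (t + of_nat j))"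
proof (cases "13 dvd a")
  case True
  then obtain m where m: "a = 13 * m" ..
  have b: "\<not> 13 dvd b"
    using ab True by blast
  have "H a b t = H 0 b t"
    using translation_familyD(3)[OF H t, of 0 m b 0] by (simp add: m)
  also have "\<dots> = H 0 1 t"
    using translation_familyD(2)[OF H t b, of 0 1] by simp
  finally show ?thesis ..
next
  case False
  obtain j n where j: "j < 13" and b: "b = a * int j + 13 * n"
    using ex_residue_multiple[OF False] by metis
  have "H a b t = H (a * 1) (a * int j) t"
    using translation_familyD(3)[OF H t, of a 0 "a * int j" n] b by simp
  also have "\<dots> = H 1 (int j) t"
    by (rule translation_familyD(2)[OF H t False])
  also have "\<dots> = H 1 0 (t + of_nat j)"
    using translation_family_nat[OF H t, of 1 0 j] by simp
  finally show ?thesis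
    using j by blast
qed

lemma modular_family_const: "modular_family (\<lambda>a b t. c)"
  by (simp add: modular_family_def translation_family_def)

lemma modular_family_add:
  "modular_family F \<Longrightarrow> modular_family G \<Longrightarrow> modular_family (\<lambda>a b t. F a b t + G a b t)"
  unfolding modular_family_def translation_family_def by simp

lemma modular_family_diff:
  "modular_family F \<Longrightarrow> modular_family G \<Longrightarrow> modular_family (\<lambda>a b t. F a b t - G a b t)"
  unfolding modular_family_def translation_family_def by simp

lemma modular_family_mult:
  "modular_family F \<Longrightarrow> modular_family G \<Longrightarrow> modular_family (\<lambda>a b t. F a b t * G a b t)"
  unfolding modular_family_def translation_family_def by simp

lemma modular_family_divide:
  "modular_family F \<Longrightarrow> modular_family G \<Longrightarrow> modular_family (\<lambda>a b t. F a b t / G a b t)"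
  unfolding modular_family_def translation_family_def by simp

lemma modular_family_power:
  "modular_family F \<Longrightarrow> modular_family (\<lambda>a b t. F a b t ^ n)"
  unfolding modular_family_def translation_family_def by simp

lemmas modular_family_intros = modular_family_const modular_family_add modular_family_diff
  modular_family_mult modular_family_divide modular_family_power

subsection \<open>The maximum principle\<close>

text \<open>Iterating \<open>t \<mapsto> -1/t\<close> on the strip \<open>|Re t| \<le> 1/2\<close> doubles the imaginary part while it is below \<open>1/2\<close>.\<close>

lemma upper_half_plane_reduce:
  assumes base: "\<And>t. Im t \<ge> 1 / 2 \<Longrightarrow> P t"
    and up: "\<And>t. Im t > 0 \<Longrightarrow> P (t + 1) \<Longrightarrow> P t"
    and down: "\<And>t. Im t > 0 \<Longrightarrow> P (t - 1) \<Longrightarrow> P t"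
    and inv: "\<And>t. Im t > 0 \<Longrightarrow> P (- 1 / t) \<Longrightarrow> P t"
    and t: "Im t > 0"
  shows "P t"
proof -
  have shift: "P t" if "Im t > 0" "P (t + of_int n)" for t n
    using that(2)
  proof (induction n rule: int_induct[where k = 0])
    case (step1 i)
    have "P (t + of_int i)"
      by (rule up) (use that step1 in \<open>simp_all add: add_ac\<close>)
    thus ?case by (rule step1)
  next
    case (step2 i)
    have "P (t + of_int i)"
      by (rule down) (use that step2 in \<open>simp_all add: algebra_simps\<close>)
    thus ?case by (rule step2)
  qed simp
  have main: "Im t > 0 \<Longrightarrow> Im t \<ge> 1 / 2 / 2 ^ n \<Longrightarrow> P t" for n t
  proof (induction n arbitrary: t)
    case (Suc n)
    show ?case
    proof (cases "Im t \<ge> 1 / 2")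
      case False
      define s where "s = t + of_int (- round (Re t))"
      have Im: "Im s = Im t" "Im s > 0"
        using Suc.prems by (simp_all add: s_def)
      have "\<bar>Re s\<bar> \<le> 1 / 2"
        using of_int_round_abs_le[of "Re t"] by (simp add: s_def abs_minus_commute)
      hence "Re s ^ 2 \<le> (1 / 2) ^ 2"
        by (rule power2_le_iff_abs_le[THEN iffD2, rotated]) simp
      moreover have "Im s ^ 2 \<le> (1 / 2) ^ 2"
        using False Im by (intro power_mono) auto
      ultimately have le: "Re s ^ 2 + Im s ^ 2 \<le> 1 / 2"
        by (simp add: power2_eq_square)
      have pos: "Re s ^ 2 + Im s ^ 2 > 0"
        using Im by (simp add: add_nonneg_pos)
      have "Im (- 1 / s) = Im s / (Re s ^ 2 + Im s ^ 2)"
        by (simp add: Im_divide)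
      also have "\<dots> \<ge> Im s / (1 / 2)"
        using le pos Im by (intro divide_left_mono) auto
      finally have "Im (- 1 / s) \<ge> 2 * Im t"
        using Im by simp
      moreover have "2 * Im t \<ge> 1 / 2 / 2 ^ n"
        using Suc.prems by simp
      ultimately have "P (- 1 / s)"
        using Suc.IH[of "- 1 / s"] Suc.prems by simp
      hence "P s"
        by (rule inv[OF Im(2)])
      thus ?thesis
        unfolding s_def by (rule shift[OF Suc.prems(1)])
    qed (rule base)
  qed (auto intro: base)
  obtain n where "1 / 2 / Im t < 2 ^ n"
    using real_arch_pow[of 2 "1 / 2 / Im t"] by auto
  hence "1 / 2 / 2 ^ n \<le> Im t"
    using t by (simp add: field_simps)
  thus ?thesis
    using main t by blast
qed

abbreviation at_ioo :: "complex filter" where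
  "at_ioo \<equiv> filtercomap Im at_top"

lemma at_ioo_neq_bot: "at_ioo \<noteq> bot"
proof (rule filtercomap_neq_bot_surj)
  show "surj Im"
    by (rule surjI[of _ "\<lambda>y. Complex 0 y"]) simp
qed simp

lemma eventually_at_ioo_pos: "eventually (\<lambda>t. Im t > 0) at_ioo"
  unfolding eventually_filtercomap_at_top_linorder by (intro exI[of _ 1]) auto

text \<open>Decay at both cusps confines large values to a compact set, and the reduction carries
  the bound found there to the whole half-plane. The bound is attained, so \<open>H 0 1\<close> is
  constant, against its decay at infinity.\<close>

lemma modular_family_bounded_zero:
  assumes H: "modular_family H"
    and hol: "H 0 1 holomorphic_on {t. Im t > 0}"
    and lim0: "(H 0 1 \<longlongrightarrow> 0) at_ioo" and lim1: "(H 1 0 \<longlongrightarrow> 0) at_ioo"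
    and t0: "Im t0 > 0"
  shows "H 0 1 t0 = 0"
proof (rule ccontr)
  assume nz: "H 0 1 t0 \<noteq> 0"
  define e where "e = norm (H 0 1 t0)"
  have e: "e > 0"
    using nz by (simp add: e_def)
  note tr = modular_familyD(1)[OF H]
  have H10: "H 1 0 t = H 0 1 (- 1 / t)" if "Im t > 0" for t
    using modular_familyD(2)[OF H that, of 0 1] by simp
  have "\<forall>\<^sub>F t in at_ioo. norm (H 0 1 t) < e \<and> norm (H 1 0 t) < e"
    using tendstoD[OF lim0 e] tendstoD[OF lim1 e] by eventually_elim simp
  then obtain Y0 where Y0: "\<And>t. Im t \<ge> Y0 \<Longrightarrow> norm (H 0 1 t) < e \<and> norm (H 1 0 t) < e"
    unfolding eventually_filtercomap_at_top_linorder by blast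
  define Y where "Y = max Y0 1"
  \<comment> \<open>Width 13 covers a period of every member of the family, in particular of
    \<open>H 1 0\<close>.\<close>
  define K where "K = cbox (Complex 0 (1 / 2)) (Complex 13 Y)"
  have K_iff: "t \<in> K \<longleftrightarrow> Re t \<in> {0..13} \<and> Im t \<in> {1 / 2..Y}" for t
    by (auto simp: K_def in_cbox_complex_iff)
  have K: "compact K" "K \<noteq> {}" "K \<subseteq> {t. Im t > 0}"
  proof -
    show "compact K"
      by (simp add: K_def compact_cbox)
    have "Complex 0 1 \<in> K"
      by (simp add: K_iff Y_def)
    thus "K \<noteq> {}" by blast
    show "K \<subseteq> {t. Im t > 0}"
      by (auto simp: K_iff)
  qed
  have cont: "continuous_on {t. Im t > 0} (H 0 1)"
    by (rule holomorphic_on_imp_continuous_on[OF hol])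
  have cont1: "continuous_on {t. Im t > 0} (H 1 0)"
  proof -
    have "continuous_on {t. Im t > 0} (\<lambda>t. H 0 1 (- 1 / t))"
      by (rule continuous_on_compose2[OF cont])
         (use Im_invert_pos in \<open>auto intro!: continuous_intros\<close>)
    thus ?thesis
      by (subst continuous_on_cong[OF refl, of _ _ "\<lambda>t. H 0 1 (- 1 / t)"]) (auto simp: H10)
  qed
  obtain k0 where k0: "k0 \<in> K" "\<And>t. t \<in> K \<Longrightarrow> norm (H 0 1 t) \<le> norm (H 0 1 k0)"
    using continuous_attains_sup[OF K(1,2), of "\<lambda>t. norm (H 0 1 t)"] continuous_on_subset[OF cont K(3)]
    by (auto intro: continuous_on_norm)
  obtain k1 where k1: "k1 \<in> K" "\<And>t. t \<in> K \<Longrightarrow> norm (H 1 0 t) \<le> norm (H 1 0 k1)"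
    using continuous_attains_sup[OF K(1,2), of "\<lambda>t. norm (H 1 0 t)"] continuous_on_subset[OF cont1 K(3)]
    by (auto intro: continuous_on_norm)
  define M where "M = max e (max (norm (H 0 1 k0)) (norm (H 1 0 k1)))"
  have M: "e \<le> M" "norm (H 0 1 k0) \<le> M" "norm (H 1 0 k1) \<le> M"
    by (simp_all add: M_def)
  have per13: "H a b (t + 13) = H a b t" if "Im t > 0" for a b t
    using translation_family_nat[OF tr that, of a b 13] translation_familyD(3)[OF tr that, of a 0 b a]
    by simp
  have per: "H a b (t + 13 * of_int n) = H a b t" if "Im t > 0" for a b t n
  proof (induction n rule: int_induct[where k = 0])
    case (step1 i)
    thus ?case
      using per13[of "t + 13 * of_int i" a b] that by (simp add: algebra_simps)
  next
    case (step2 i)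
    thus ?case
      using per13[of "t + 13 * of_int (i - 1)" a b] that by (simp add: algebra_simps)
  qed simp
  have strip: "norm (H 0 1 t) \<le> M \<and> norm (H 1 0 t) \<le> M" if t: "Im t \<ge> 1 / 2" for t
  proof (cases "Im t \<le> Y")
    case True
    define n where "n = - \<lfloor>Re t / 13\<rfloor>"
    define s where "s = t + 13 * of_int n"
    have "of_int \<lfloor>Re t / 13\<rfloor> \<le> Re t / 13" "Re t / 13 < of_int \<lfloor>Re t / 13\<rfloor> + 1"
      by linarith+
    hence "0 \<le> Re s" "Re s \<le> 13"
      unfolding s_def n_def by (simp_all, linarith)
    hence "s \<in> K"
      using True t unfolding K_iff by (simp add: s_def)
    moreover have "H a b s = H a b t" for a b
      unfolding s_def by (rule per) (use t in simp)
    ultimately show ?thesis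
      using k0(2)[of s] k1(2)[of s] M by (metis order.trans)
  next
    case False
    hence "Im t \<ge> Y0"
      by (simp add: Y_def)
    from Y0[OF this] show ?thesis
      using M(1) by simp
  qed
  \<comment> \<open>All lines at once, because translation and inversion permute them.\<close>
  define P where "P = (\<lambda>t. \<forall>a b. \<not> (13 dvd a \<and> 13 dvd b) \<longrightarrow> norm (H a b t) \<le> M)"
  have all: "P t" if "Im t > 0" for t
  proof (rule upper_half_plane_reduce[where P = P])
    fix t :: complex assume t: "Im t \<ge> 1 / 2"
    hence t': "Im t > 0" by simp
    show "P t"
      unfolding P_def
    proof (intro allI impI)
      fix a b :: int assume ab: "\<not> (13 dvd a \<and> 13 dvd b)"
      from translation_family_cases[OF tr this t'] show "norm (H a b t) \<le> M"
        using strip[of t] strip[of "t + of_nat j" for j] t by auto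
    qed
  next
    fix t :: complex assume t: "Im t > 0" "P (t + 1)"
    show "P t"
      unfolding P_def
    proof (intro allI impI)
      fix a b :: int assume "\<not> (13 dvd a \<and> 13 dvd b)"
      hence "\<not> (13 dvd a \<and> 13 dvd b - a)"
        using dvd_add[of 13 "b - a" a] by auto
      hence "norm (H a (b - a) (t + 1)) \<le> M"
        using t(2) unfolding P_def by blast
      thus "norm (H a b t) \<le> M"
        using translation_familyD(1)[OF tr t(1), of a "b - a"] by simp
    qed
  next
    fix t :: complex assume t: "Im t > 0" "P (t - 1)"
    show "P t"
      unfolding P_def
    proof (intro allI impI)
      fix a b :: int assume "\<not> (13 dvd a \<and> 13 dvd b)"
      hence "\<not> (13 dvd a \<and> 13 dvd a + b)"
        by (auto simp: dvd_add_right_iff)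
      hence "norm (H a (a + b) (t - 1)) \<le> M"
        using t(2) unfolding P_def by blast
      thus "norm (H a b t) \<le> M"
        using t(1) translation_familyD(1)[OF tr, of "t - 1" a b] by simp
    qed
  next
    fix t :: complex assume t: "Im t > 0" "P (- 1 / t)"
    show "P t"
      unfolding P_def
    proof (intro allI impI)
      fix a b :: int assume "\<not> (13 dvd a \<and> 13 dvd b)"
      hence ab: "\<not> (13 dvd - b \<and> 13 dvd a)"
        by auto
      from modular_familyD(2)[OF H t(1) this] have "H a b t = H (- b) a (- 1 / t)"
        by simp
      thus "norm (H a b t) \<le> M"
        using t(2) ab unfolding P_def by metis
    qed
  qed (use that in simp)
  have bound: "norm (H 0 1 t) \<le> M" if "Im t > 0" for t
    using all[OF that] by (auto simp: P_def)
  \<comment> \<open>Each candidate for \<open>M\<close> is the norm of a value of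
    \<open>H 0 1\<close>: at \<open>t0\<close>, at \<open>k0\<close>, or at the inverted point
    \<open>- 1 / k1\<close>.\<close>
  obtain \<xi> where \<xi>: "Im \<xi> > 0" "norm (H 0 1 \<xi>) = M"
  proof -
    have "M = e \<or> M = norm (H 0 1 k0) \<or> M = norm (H 1 0 k1)"
      by (auto simp: M_def max_def)
    moreover have "Im k0 > 0" "Im k1 > 0"
      using k0(1) k1(1) K(3) by auto
    ultimately show ?thesis
      using that[of t0] that[of k0] that[of "- 1 / k1"] t0 Im_invert_pos[of k1] H10[of k1]
      by (auto simp: e_def)
  qed
  have "H 0 1 constant_on {t. Im t > 0}"
  proof (rule maximum_modulus_principle[OF hol])
    show "open {t. Im t > 0}"
      by (rule open_halfspace_Im_gt)
    show "connected {t. Im t > 0}"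
      by (intro convex_connected convex_halfspace_Im_gt)
    show "\<xi> \<in> {t. Im t > 0}"
      using \<xi> by simp
    show "norm (H 0 1 z) \<le> norm (H 0 1 \<xi>)" if "z \<in> {t. Im t > 0}" for z
      using bound[of z] that \<xi> by simp
  qed (use open_halfspace_Im_gt in auto)
  moreover have "Im (Complex 0 Y) > 0"
    by (simp add: Y_def)
  ultimately have "H 0 1 (Complex 0 Y) = H 0 1 t0"
    using t0 by (auto simp: constant_on_def)
  moreover have "norm (H 0 1 (Complex 0 Y)) < e"
    using Y0[of "Complex 0 Y"] by (simp add: Y_def)
  ultimately show False
    by (simp add: e_def)
qed

text \<open>If \<open>H\<close> only has a finite limit \<open>c\<close> at infinity, then \<open>H (H - c)\<close> vanishes at both cusps.\<close>

lemma modular_family_limit_zero: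
  assumes H: "modular_family H"
    and hol: "H 0 1 holomorphic_on {t. Im t > 0}"
    and lim0: "(H 0 1 \<longlongrightarrow> c) at_ioo" and lim1: "(H 1 0 \<longlongrightarrow> 0) at_ioo"
    and t0: "Im t0 > 0"
  shows "H 0 1 t0 = 0"
proof -
  have z: "H 0 1 t * (H 0 1 t - c) = 0" if "Im t > 0" for t
  proof (rule modular_family_bounded_zero[where H = "\<lambda>a b t. H a b t * (H a b t - c)"])
    show "modular_family (\<lambda>a b t. H a b t * (H a b t - c))"
      by (intro modular_family_intros H)
    show "(\<lambda>t. H 0 1 t * (H 0 1 t - c)) holomorphic_on {t. Im t > 0}"
      by (intro holomorphic_intros hol)
    have "((\<lambda>t. H 0 1 t * (H 0 1 t - c)) \<longlongrightarrow> c * (c - c)) at_ioo"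
      by (intro tendsto_intros lim0)
    thus "((\<lambda>t. H 0 1 t * (H 0 1 t - c)) \<longlongrightarrow> 0) at_ioo"
      by simp
    have "((\<lambda>t. H 1 0 t * (H 1 0 t - c)) \<longlongrightarrow> 0 * (0 - c)) at_ioo"
      by (intro tendsto_intros lim1)
    thus "((\<lambda>t. H 1 0 t * (H 1 0 t - c)) \<longlongrightarrow> 0) at_ioo"
      by simp
  qed (fact that)
  have "H 0 1 ` {t. Im t > 0} \<subseteq> {0, c}"
    using z by auto
  hence "finite (H 0 1 ` {t. Im t > 0})"
    by (rule finite_subset) simp
  moreover have "connected {t. Im t > 0}"
    by (intro convex_connected convex_halfspace_Im_gt)
  ultimately have "H 0 1 constant_on {t. Im t > 0}"
    using continuous_finite_range_constant holomorphic_on_imp_continuous_on[OF hol] by blast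
  then obtain d where d: "\<And>t. Im t > 0 \<Longrightarrow> H 0 1 t = d"
    by (auto simp: constant_on_def)
  \<comment> \<open>Inversion carries the constant to the cusp 0, where the limit is 0.\<close>
  have "H 1 0 t = d" if "Im t > 0" for t
    using modular_familyD(2)[OF H that, of 0 1] d[OF Im_invert_pos[OF that]] by simp
  hence "\<forall>\<^sub>F t in at_ioo. H 1 0 t = d"
    unfolding eventually_filtercomap_at_top_linorder by (intro exI[of _ 1]) auto
  hence "((\<lambda>_. d) \<longlongrightarrow> 0) at_ioo"
    using lim1 tendsto_cong by fastforce
  hence "d = 0"
    using at_ioo_neq_bot tendsto_const tendsto_unique by blast
  thus ?thesis
    using d t0 by simp
qed

subsection \<open>The families\<close>

lemma klein_add_nat: "klein z (t + of_nat n) = klein z t"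
proof (induction n)
  case (Suc n)
  thus ?case
    using klein_tau_add_1[of z "t + of_nat n"] by (simp add: add_ac)
qed simp

lemma theta_quot_1_0:
  assumes "Im t > 0" "klein (13 * z) t \<noteq> 0"
  shows "theta_quot 1 0 z t = CPhi 13 (cis1 (- 1 / t)) * qpoch_inf (cis1 (- 1 / t) ^ 13) (cis1 (- 1 / t) ^ 13)"
proof -
  have "klein (13 * (z / t)) (- 1 / t) \<noteq> 0"
    using klein_inversion[OF assms(1), of "13 * z"] assms by auto
  from theta_quot_0_1[OF Im_invert_pos[OF assms(1)] this] show ?thesis
    using theta_quot_invert[OF assms(1), of 0 1 z] by simp
qed

lemma translation_family_theta_quot: "translation_family (\<lambda>a b t. theta_quot a b z t)"
  unfolding translation_family_def
  by (auto simp: theta_quot_translate theta_quot_scale theta_quot_shift)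

text \<open>The closed forms for \<open>(0, 1)\<close> and \<open>(1, 0)\<close> do not contain
  \<open>z\<close>; every other line is brought to one of these by scaling, shifting and
  translating.\<close>

lemma theta_quot_indep:
  assumes t: "Im t > 0" and z: "klein (13 * z) t \<noteq> 0" "klein (13 * z') t \<noteq> 0"
    and ab: "\<not> (13 dvd a \<and> 13 dvd b)"
  shows "theta_quot a b z t = theta_quot a b z' t"
proof (cases "13 dvd a")
  case True
  then obtain m where m: "a = 13 * m" ..
  have b: "\<not> 13 dvd b"
    using ab True by blast
  have "theta_quot a b w t = theta_quot 0 1 w t" for w
    using theta_quot_shift[OF t, of 0 m b 0 w] theta_quot_scale[OF t b, of 0 1 w] by (simp add: m)
  thus ?thesis
    using theta_quot_0_1[OF t] z by simp
next
  case False
  obtain j n where b: "b = a * int j + 13 * n"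
    using ex_residue_multiple[OF False] by metis
  have "theta_quot a b w t = theta_quot 1 0 w (t + of_nat j)" for w
    using theta_quot_shift[OF t, of a 0 "a * int j" n w]
      theta_quot_scale[OF t False, of 1 "int j" w] b
      translation_family_nat[OF translation_family_theta_quot t, where a = 1 and b = 0 and n = j] by simp
  moreover have "theta_quot 1 0 z (t + of_nat j) = theta_quot 1 0 z' (t + of_nat j)"
    using theta_quot_1_0[of "t + of_nat j"] t z by (simp add: klein_add_nat)
  ultimately show ?thesis
    by simp
qed

text \<open>As 13 is odd, neither point is in the lattice. Both are needed because inversion turns
  the argument \<open>1 / 2\<close> into \<open>t / 2\<close>.\<close>

lemma klein_half_nonzero:
  assumes "Im t > 0"
  shows "klein (13 * (1 / 2)) t \<noteq> 0" "klein (13 * (t / 2)) t \<noteq> 0"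
proof -
  show "klein (13 * (1 / 2)) t \<noteq> 0"
  proof
    assume "klein (13 * (1 / 2)) t = 0"
    then obtain m n :: int where mn: "13 * (1 / 2) = of_int m + of_int n * t"
      using klein_eq_0_iff[OF assms] by blast
    have "Im (of_int m + of_int n * t) = 0"
      unfolding mn[symmetric] by simp
    hence "n = 0"
      using assms by simp
    with mn have "13 = (of_int (2 * m) :: complex)"
      by (simp add: mult.commute)
    hence "(13 :: int) = 2 * m"
      by (metis of_int_eq_iff of_int_numeral)
    thus False
      by presburger
  qed
  show "klein (13 * (t / 2)) t \<noteq> 0"
  proof
    assume "klein (13 * (t / 2)) t = 0"
    then obtain m n :: int where mn: "13 * (t / 2) = of_int m + of_int n * t"
      using klein_eq_0_iff[OF assms] by blast
    have "Im (13 * (t / 2)) = Im (of_int m + of_int n * t)"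
      using mn by simp
    hence "13 * Im t = 2 * of_int n * Im t"
      by (simp add: mult_ac)
    hence "(13 :: real) = of_int (2 * n)"
      using assms by simp
    hence "(13 :: int) = 2 * n"
      by (metis of_int_eq_iff of_int_numeral)
    thus False
      by presburger
  qed
qed

lemma modular_family_theta_quot: "modular_family (\<lambda>a b t. theta_quot a b (1 / 2) t)"
  unfolding modular_family_def
proof (intro conjI allI impI translation_family_theta_quot)
  fix a b :: int and t :: complex
  assume t: "Im t > 0" and ab: "\<not> (13 dvd a \<and> 13 dvd b)"
  have t0: "t \<noteq> 0"
    using t by auto
  have "theta_quot a b (1 / 2) (- 1 / t) = theta_quot a b (t / 2 / t) (- 1 / t)"
    using t0 by simp
  also have "\<dots> = theta_quot b (- a) (t / 2) t"
    by (rule theta_quot_invert[OF t])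
  also have "\<dots> = theta_quot b (- a) (1 / 2) t"
    using ab klein_half_nonzero[OF t] by (intro theta_quot_indep t) auto
  finally show "theta_quot a b (1 / 2) (- 1 / t) = theta_quot b (- a) (1 / 2) t" .
qed

text \<open>One point from each pair P, -P of nonzero points on a line, at \<open>z = 0\<close>:
  weight -6, with explicit product formulas at both cusps.\<close>

definition eprod :: "int \<Rightarrow> int \<Rightarrow> complex \<Rightarrow> complex" where
  "eprod a b t = (\<Prod>k\<in>{1..6}. tors a b k 0 t)"

lemma one_to_six: "{1..6 :: int} = {1,2,3,4,5,6}"
  by (rule set_eqI) (simp only: atLeastAtMost_iff insert_iff empty_iff, presburger)

lemma eprod_nonzero:
  assumes "Im t > 0" "\<not> (13 dvd a \<and> 13 dvd b)"
  shows "eprod a b t \<noteq> 0"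
  unfolding eprod_def one_to_six using tors_0_nonzero[OF assms] by simp

lemma eprod_translate: "eprod a b (t + 1) = eprod a (a + b) t"
  by (simp add: eprod_def tors_translate)

lemma eprod_invert:
  assumes "Im t > 0"
  shows "eprod a b (- 1 / t) = 1 / t ^ 6 * eprod b (- a) t"
proof -
  have "tors a b k 0 (- 1 / t) = 1 / t * tors b (- a) k 0 t" for k
    using tors_invert[OF assms, of a b k 0] by simp
  hence "eprod a b (- 1 / t) = (\<Prod>k\<in>{1..6 :: int}. 1 / t) * (\<Prod>k\<in>{1..6}. tors b (- a) k 0 t)"
    unfolding eprod_def by (simp only: prod.distrib)
  thus ?thesis
    by (simp add: eprod_def power_one_over)
qed

lemma eprod_shift:
  assumes "Im t > 0"
  shows "eprod (a + 13 * m) (b + 13 * n) t = eprod a b t"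
proof -
  define N where "N = n * a - m * b"
  have "(\<Prod>k\<in>{1..6}. cis1 (of_int (2 * k ^ 2 * N) / 13)) = cis1 (\<Sum>k\<in>{1..6}. of_int (2 * k ^ 2 * N) / 13)"
    by (rule cis1_sum[symmetric])
  \<comment> \<open>The squares over \<open>{1..6}\<close> add up to 91, and
    \<open>2 * 91 / 13 = 14\<close>.\<close>
  also have "(\<Sum>k\<in>{1..6}. of_int (2 * k ^ 2 * N) / 13) = (of_int (14 * N) :: complex)"
    unfolding one_to_six by simp
  finally have "(\<Prod>k\<in>{1..6}. cis1 (of_int (2 * k ^ 2 * N) / 13)) = 1"
    by (simp only: cis1_of_int)
  thus ?thesis
    unfolding eprod_def tors_shift[OF assms] N_def[symmetric] by (simp only: prod.distrib mult_1)
qed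

text \<open>The Legendre symbol modulo 13; it enters through Gauss's lemma.\<close>

definition chi :: "int \<Rightarrow> complex" where
  "chi c = (if c mod 13 \<in> {1,3,4,9,10,12} then 1 else if c mod 13 = 0 then 0 else - 1)"

text \<open>For \<open>c\<close> prime to 13, multiplication permutes the half system
  \<open>{1..6}\<close> up to signs, and each sign comes out of \<open>tors\<close> because it is
  odd in \<open>k\<close>. The residues of \<open>c\<close> are checked one by one; residue 0 gives
  0 on both sides by \<open>tors_0\<close>.\<close>

lemma eprod_scale:
  assumes "Im t > 0"
  shows "eprod (c * a) (c * b) t = chi c * eprod a b t"
proof -
  define T where "T = (\<lambda>k. tors a b k 0 t)"
  define d where "d = c mod 13"
  define sg :: "int \<Rightarrow> complex" where "sg = (\<lambda>r. if r mod 13 \<le> 6 then 1 else - 1)"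
  define rep :: "int \<Rightarrow> int" where "rep = (\<lambda>r. if r mod 13 \<le> 6 then r mod 13 else 13 - r mod 13)"
  have per: "T (r + 13 * m) = T r" for r m
    unfolding T_def by (rule tors_period[OF assms])
  have neg: "T (- r) = - T r" for r
    unfolding T_def by (rule tors_uminus)
  have red: "T r = sg r * T (rep r)" for r
  proof -
    have "T (r mod 13 + 13 * (r div 13)) = T (r mod 13)"
      by (rule per)
    hence 1: "T r = T (r mod 13)"
      by simp
    show ?thesis
    proof (cases "r mod 13 \<le> 6")
      case False
      have "T (- (13 - r mod 13) + 13 * 1) = - T (13 - r mod 13)"
        by (simp only: per neg)
      thus ?thesis
        using False 1 by (simp add: sg_def rep_def)
    qed (use 1 in \<open>simp add: sg_def rep_def\<close>)
  qed
  have "eprod (c * a) (c * b) t = (\<Prod>k\<in>{1..6}. T (c * k))"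
    by (simp add: eprod_def tors_scale T_def)
  also have "\<dots> = (\<Prod>k\<in>{1..6}. T (d * k))"
  proof (rule prod.cong[OF refl])
    fix k
    have "c * k = d * k + 13 * (c div 13 * k)"
      by (metis d_def distrib_right mod_mult_div_eq mult.assoc)
    thus "T (c * k) = T (d * k)"
      by (simp only: per)
  qed
  also have "\<dots> = (\<Prod>k\<in>{1..6}. sg (d * k) * T (rep (d * k)))"
    by (rule prod.cong[OF refl]) (rule red)
  also have "\<dots> = chi c * (T 1 * T 2 * T 3 * T 4 * T 5 * T 6)"
  proof -
    have "0 \<le> d" "d < 13"
      by (simp_all add: d_def)
    hence "d \<in> {0,1,2,3,4,5,6,7,8,9,10,11,12}"
      by (simp only: insert_iff empty_iff) presburger
    moreover have "T 0 = 0"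
      by (simp add: T_def tors_0)
    ultimately show ?thesis
      unfolding one_to_six chi_def d_def[symmetric]
      by (elim insertE) (simp_all add: sg_def rep_def mult_ac)
  qed
  finally show ?thesis
    by (simp add: eprod_def one_to_six T_def mult_ac)
qed

text \<open>Scaling a nonzero value of \<open>eprod\<close> by \<open>n\<close> and then by
  \<open>m\<close> must agree with scaling by \<open>m * n\<close>.\<close>

lemma chi_mult: "chi (m * n) = chi m * chi n"
proof -
  have t: "Im \<i> > 0"
    by simp
  have "chi (m * n) * eprod 0 1 \<i> = eprod (m * (n * 0)) (m * (n * 1)) \<i>"
    using eprod_scale[OF t, of "m * n" 0 1] by (simp add: mult_ac)
  also have "\<dots> = chi m * chi n * eprod 0 1 \<i>"
    unfolding eprod_scale[OF t] by simp
  finally show ?thesis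
    using eprod_nonzero[OF t, of 0 1] by simp
qed

lemma chi_squared: "\<not> 13 dvd c \<Longrightarrow> chi c * chi c = 1"
  by (auto simp: chi_def dvd_eq_mod_eq_0)

lemma chi_shift: "chi (c + 13 * m) = chi c"
  by (simp add: chi_def)

text \<open>The weights -12 and 12 cancel, and squaring removes \<open>chi\<close>. The divisor 13
  is the square of the constant in \<open>eprod_0_1\<close> and makes the expansion at infinity
  begin with q.\<close>

definition hauptmodul :: "int \<Rightarrow> int \<Rightarrow> complex \<Rightarrow> complex" where
  "hauptmodul a b t = eprod a b t ^ 2 * Delta t / 13"

lemma modular_family_hauptmodul: "modular_family hauptmodul"
  unfolding modular_family_def translation_family_def
proof (intro conjI allI impI)
  fix a b c m n :: int and t :: complex
  assume t: "Im t > 0"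
  show "hauptmodul a b (t + 1) = hauptmodul a (a + b) t"
    by (simp add: hauptmodul_def eprod_translate Delta_add_1)
  show "hauptmodul (a + 13 * m) (b + 13 * n) t = hauptmodul a b t"
    by (simp add: hauptmodul_def eprod_shift[OF t])
  show "hauptmodul (c * a) (c * b) t = hauptmodul a b t" if "\<not> 13 dvd c"
    unfolding hauptmodul_def eprod_scale[OF t] power_mult_distrib
    by (simp add: power2_eq_square[of "chi c"] chi_squared[OF that])
  show "hauptmodul a b (- 1 / t) = hauptmodul b (- a) t"
  proof -
    have "t ^ 12 = t ^ 6 * t ^ 6"
      by (simp flip: power_add)
    thus ?thesis
      using t unfolding hauptmodul_def eprod_invert[OF t] Delta_invert[OF t]
      by (auto simp: power2_eq_square)
  qed
qed

lemma hauptmodul_nonzero: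
  "Im t > 0 \<Longrightarrow> \<not> (13 dvd a \<and> 13 dvd b) \<Longrightarrow> hauptmodul a b t \<noteq> 0"
  by (simp add: hauptmodul_def eprod_nonzero Delta_nonzero)

text \<open>For \<open>(a, b) = (0, 1)\<close> this is the trace that extracts the exponents \<open>n \<equiv> 6 (mod 13)\<close> from the partition
  series; the terms with \<open>x = y = 0\<close> are \<open>0\<close> because \<open>eprod 0 0 t = 0\<close>.\<close>

definition eprod_trace :: "int \<Rightarrow> int \<Rightarrow> complex \<Rightarrow> complex" where
  "eprod_trace a b t = (\<Sum>x\<in>{0..12}. \<Sum>y\<in>{0..12}. chi (a * y - b * x) * (eprod a b t / eprod x y t)) / 12"

text \<open>Used with \<open>d = 1\<close> for translation and \<open>d = - 1\<close> for
  inversion.\<close>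

lemma sum_shift_residues:
  fixes F :: "int \<Rightarrow> complex"
  assumes per: "\<And>k m. F (k + 13 * m) = F k" and d: "d \<in> {1, -1}"
  shows "(\<Sum>y\<in>{0..12}. F (d * y + c)) = (\<Sum>y\<in>{0..12}. F y)"
proof -
  have eq: "F k = F (k mod 13)" for k
    using per[of "k mod 13" "k div 13"] by simp
  have "bij_betw (\<lambda>y. (d * y + c) mod 13) {0..12} {0..12 :: int}"
  proof -
    have "inj_on (\<lambda>y. (d * y + c) mod 13) {0..12 :: int}"
    proof (rule inj_onI)
      fix k l assume kl: "k \<in> {0..12}" "l \<in> {0..12}" "(d * k + c) mod 13 = (d * l + c) mod 13"
      hence "13 dvd (d * k + c) - (d * l + c)"
        by (simp add: mod_eq_dvd_iff)
      hence "13 dvd k - l"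
        using d by (auto simp: dvd_diff_commute)
      thus "k = l"
        using kl(1,2) by auto presburger
    qed
    moreover have "(\<lambda>y. (d * y + c) mod 13) ` {0..12} \<subseteq> {0..12}"
      by (auto simp: image_subset_iff)
    ultimately show ?thesis
      by (simp add: bij_betw_def endo_inj_surj)
  qed
  from sum.reindex_bij_betw[OF this, of F] show ?thesis
    using eq[of "d * y + c" for y] by simp
qed

text \<open>The determinant \<open>a * y - b * x\<close> is unchanged when a generator acts on
  \<open>(a, b)\<close> and \<open>(x, y)\<close> together, so the generator only rearranges the
  double sum. Under scaling by \<open>c\<close> the factor \<open>chi c\<close> from the determinant
  meets the one from \<open>eprod\<close>, and their product is 1.\<close>

lemma modular_family_eprod_trace: "modular_family eprod_trace"
  unfolding modular_family_def translation_family_def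
proof (intro conjI allI impI)
  fix a b c m n :: int and t :: complex
  assume t: "Im t > 0"
  have shift_y: "eprod x (y + 13 * m) t = eprod x y t" for x y m
    using eprod_shift[OF t, of x 0 y m] by simp
  have shift_x: "eprod (x + 13 * m) y t = eprod x y t" for x y m
    using eprod_shift[OF t, of x m y 0] by simp
  show "eprod_trace a b (t + 1) = eprod_trace a (a + b) t"
  proof -
    have "(\<Sum>y\<in>{0..12}. chi (a * y - b * x) * (eprod a b (t + 1) / eprod x y (t + 1)))
        = (\<Sum>y\<in>{0..12}. chi (a * y - (a + b) * x) * (eprod a (a + b) t / eprod x y t))" for x
    proof -
      define F where "F = (\<lambda>y. chi (a * y - (a + b) * x) * (eprod a (a + b) t / eprod x y t))"
      have "chi (a * (k + 13 * m) - (a + b) * x) = chi (a * k - (a + b) * x)" for k m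
        using chi_shift[of "a * k - (a + b) * x" "a * m"] by (simp add: algebra_simps)
      hence "F (k + 13 * m) = F k" for k m
        by (simp only: F_def shift_y)
      from sum_shift_residues[OF this, of 1 x] have "(\<Sum>y\<in>{0..12}. F (1 * y + x)) = (\<Sum>y\<in>{0..12}. F y)"
        by simp
      moreover have "F (1 * y + x) = chi (a * y - b * x) * (eprod a b (t + 1) / eprod x y (t + 1))" for y
      proof -
        have "a * (1 * y + x) - (a + b) * x = a * y - b * x"
          by (simp add: algebra_simps)
        thus ?thesis
          by (simp only: F_def eprod_translate mult_1 add.commute[of y x])
      qed
      ultimately show ?thesis
        by (simp add: F_def)
    qed
    thus ?thesis
      by (simp add: eprod_trace_def)
  qed
  show "eprod_trace (a + 13 * m) (b + 13 * n) t = eprod_trace a b t"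
  proof -
    have "chi ((a + 13 * m) * y - (b + 13 * n) * x) = chi (a * y - b * x)" for x y
      using chi_shift[of "a * y - b * x" "m * y - n * x"] by (simp add: algebra_simps)
    thus ?thesis
      by (simp add: eprod_trace_def eprod_shift[OF t])
  qed
  show "eprod_trace (c * a) (c * b) t = eprod_trace a b t" if "\<not> 13 dvd c"
  proof -
    have "chi (c * a * y - c * b * x) * (chi c * eprod a b t / eprod x y t)
        = chi (a * y - b * x) * (eprod a b t / eprod x y t)" for x y
    proof -
      have "c * a * y - c * b * x = c * (a * y - b * x)"
        by (simp add: algebra_simps)
      hence "chi (c * a * y - c * b * x) * (chi c * eprod a b t / eprod x y t)
          = (chi c * chi c) * (chi (a * y - b * x) * (eprod a b t / eprod x y t))"
        by (simp add: chi_mult)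
      thus ?thesis
        unfolding chi_squared[OF that] by simp
    qed
    thus ?thesis
      by (simp only: eprod_trace_def eprod_scale[OF t])
  qed
  show "eprod_trace a b (- 1 / t) = eprod_trace b (- a) t"
  proof -
    define F where "F = (\<lambda>x y. chi (b * y + a * x) * (eprod b (- a) t / eprod x y t))"
    have "chi (a * y - b * x) * (eprod a b (- 1 / t) / eprod x y (- 1 / t)) = F y (- x)" for x y
      using t unfolding F_def eprod_invert[OF t] by auto
    hence "eprod_trace a b (- 1 / t) = (\<Sum>x\<in>{0..12}. \<Sum>y\<in>{0..12}. F y (- x)) / 12"
      by (simp only: eprod_trace_def)
    also have "(\<Sum>x\<in>{0..12}. \<Sum>y\<in>{0..12}. F y (- x)) = (\<Sum>y\<in>{0..12}. \<Sum>x\<in>{0..12}. F y (- x))"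
      by (rule sum.swap)
    also have "\<dots> = (\<Sum>y\<in>{0..12}. \<Sum>x\<in>{0..12}. F y x)"
    proof (rule sum.cong[OF refl])
      fix y
      have "chi (b * (k + 13 * m) + a * y) = chi (b * k + a * y)" for k m
        using chi_shift[of "b * k + a * y" "b * m"] by (simp add: algebra_simps)
      hence "F y (k + 13 * m) = F y k" for k m
        by (simp only: F_def shift_y)
      from sum_shift_residues[of "F y", OF this, of "- 1" 0] show "(\<Sum>x\<in>{0..12}. F y (- x)) = (\<Sum>x\<in>{0..12}. F y x)"
        by simp
    qed
    finally show ?thesis
      by (simp add: eprod_trace_def F_def)
  qed
qed

subsection \<open>Values at the two cusps\<close>

lemma filterlim_cis1_at_ioo:
  assumes "r > 0"
  shows "filterlim (\<lambda>t. cis1 (t / of_real r)) (at 0) at_ioo"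
proof (rule filterlim_atI)
  have "filterlim (\<lambda>y. - 2 * pi / r * y) at_bot at_top"
    using assms by (intro filterlim_tendsto_neg_mult_at_bot[OF tendsto_const _ filterlim_ident])
                   (simp add: divide_neg_pos)
  hence "((\<lambda>y. exp (- 2 * pi / r * y)) \<longlongrightarrow> 0) at_top"
    by (rule filterlim_compose[OF exp_at_bot])
  hence "((\<lambda>t. exp (- 2 * pi / r * Im t)) \<longlongrightarrow> 0) at_ioo"
    by (rule filterlim_compose[OF _ filterlim_filtercomap])
  moreover have "norm (cis1 (t / of_real r)) = exp (- 2 * pi / r * Im t)" for t
    by (simp add: norm_cis1)
  ultimately have "((\<lambda>t. norm (cis1 (t / of_real r))) \<longlongrightarrow> 0) at_ioo"
    by (simp only:)
  thus "((\<lambda>t. cis1 (t / of_real r)) \<longlongrightarrow> 0) at_ioo"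
    by (rule tendsto_norm_zero_cancel)
qed auto

section \<open>Product formulas at the cusps\<close>

lemma prod_symmetric_residues:
  fixes f :: "int \<Rightarrow> complex"
  shows "(\<Prod>k\<in>{-6..6}. f k) = f 0 * (\<Prod>k\<in>{1..6}. f k * f (- k))"
  unfolding symmetric_residues one_to_six by (simp add: mult_ac)

text \<open>The square of the product is the value 13 of (1 - a^13)/(1 - a) at a = 1, reached by
  continuity of \<open>g\<close>; the sign follows from the positivity of the six sines.\<close>

lemma prod_sines:
  "(\<Prod>k\<in>{1..6 :: int}. cis1 (of_int k / 13) - cis1 (- of_int k / 13)) = - of_real (sqrt 13)"
proof -
  define s where "s = (\<lambda>k :: int. cis1 (of_int k / 13) - cis1 (- of_int k / 13))"
  define g where "g = (\<lambda>a. \<Prod>k\<in>{1..6 :: int}. (1 - a * cis1 (of_int (2 * k) / 13)) * (1 - a * cis1 (of_int (2 * (- k)) / 13)))"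
  have g_eq: "(1 - a) * g a = 1 - a ^ 13" for a
  proof -
    have "qpoch_inf (a ^ 13) (0 ^ 13) = (\<Prod>k\<in>{-6..6}. qpoch_inf (a * cis1 (of_int (2 * k) / 13)) 0)"
      by (rule qpoch_inf_13) simp_all
    hence "1 - a ^ 13 = (\<Prod>k\<in>{-6..6}. 1 - a * cis1 (of_int (2 * k) / 13))"
      by (simp add: qpoch_inf_zero_right)
    also have "\<dots> = (1 - a) * g a"
      unfolding prod_symmetric_residues g_def by simp
    finally show ?thesis ..
  qed
  have "isCont g 1"
    unfolding g_def by (intro continuous_intros)
  hence 1: "(g \<longlongrightarrow> g 1) (at 1)"
    by (simp add: isCont_def)
  have "isCont (\<lambda>a :: complex. \<Sum>r<13. a ^ r) 1"
    by (intro continuous_intros)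
  hence 2: "((\<lambda>a :: complex. \<Sum>r<13. a ^ r) \<longlongrightarrow> (\<Sum>r<13. 1 ^ r)) (at 1)"
    by (simp only: isCont_def)
  have "eventually (\<lambda>a :: complex. a \<noteq> 1) (at 1)"
    by (simp add: eventually_at_filter)
  hence "eventually (\<lambda>a. g a = (\<Sum>r<13. a ^ r)) (at 1)"
  proof eventually_elim
    case (elim a)
    have "(1 - a) * g a = (1 - a) * (\<Sum>r<13. a ^ r)"
      unfolding g_eq by (rule one_diff_power_eq)
    thus ?case
      using elim by simp
  qed
  hence "((\<lambda>a. \<Sum>r<13. a ^ r) \<longlongrightarrow> g 1) (at 1)"
    using 1 by (simp only: tendsto_cong)
  hence "g 1 = (\<Sum>r<13. 1 ^ r)"
    by (rule tendsto_unique[OF _ _ 2, rotated]) simp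
  hence g1: "g 1 = 13"
    by simp
  have sq: "(1 - 1 * cis1 (of_int (2 * k) / 13)) * (1 - 1 * cis1 (of_int (2 * (- k)) / 13)) = - (s k * s k)" for k
  proof -
    define c where "c = cis1 (of_int k / 13)"
    have "c \<noteq> 0"
      by (simp add: c_def)
    moreover have "cis1 (of_int (2 * k) / 13) = c * c"
      unfolding c_def cis1_add[symmetric] by (rule arg_cong[of _ _ cis1]) (simp add: field_simps)
    moreover have "cis1 (of_int (2 * (- k)) / 13) = 1 / c * (1 / c)"
      unfolding c_def inverse_eq_divide[symmetric] cis1_minus[symmetric] cis1_add[symmetric]
      by (rule arg_cong[of _ _ cis1]) (simp add: field_simps)
    moreover have "s k = c - 1 / c"
      unfolding s_def c_def inverse_eq_divide[symmetric] cis1_minus[symmetric] by simp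
    moreover have "(1 - 1 * (c * c)) * (1 - 1 * (1 / c * (1 / c))) = - ((c - 1 / c) * (c - 1 / c))"
      using \<open>c \<noteq> 0\<close> by (simp add: field_simps)
    ultimately show ?thesis
      by (simp only:)
  qed
  define S where "S = (\<Prod>k\<in>{1..6}. s k)"
  have "g 1 = S * S"
    unfolding g_def sq S_def one_to_six by (simp add: mult_ac)
  hence S2: "S * S = 13"
    using g1 by simp
  have s_sin: "s k = 2 * \<i> * of_real (sin (2 * pi * of_int k / 13))" for k
    by (simp add: s_def cis1_def complex_eq_iff Re_exp Im_exp)
  define Q where "Q = (\<Prod>k\<in>{1..6 :: int}. sin (2 * pi * of_int k / 13))"
  have "Q > 0"
    unfolding Q_def
  proof (rule prod_pos, rule sin_gt_zero)
    fix k :: int assume k: "k \<in> {1..6}"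
    thus "2 * pi * of_int k / 13 > 0"
      by simp
    have "pi * (2 * of_int k) < pi * 13"
      using k by (intro mult_strict_left_mono) auto
    thus "2 * pi * of_int k / 13 < pi"
      by simp
  qed
  \<comment> \<open>The minus sign is that of \<open>(2 * \<i>) ^ 6 = - 64\<close>.\<close>
  have S: "S = - of_real (64 * Q)"
    unfolding S_def s_sin prod.distrib Q_def by (simp add: of_real_prod power_mult_distrib eval_nat_numeral)
  have "complex_of_real ((64 * Q) ^ 2) = S * S"
    unfolding S by (simp add: power2_eq_square)
  also have "\<dots> = complex_of_real 13"
    using S2 by simp
  finally have "(64 * Q) ^ 2 = 13"
    by (simp only: of_real_eq_iff)
  hence "64 * Q = sqrt 13"
    using \<open>Q > 0\<close> by (metis less_imp_le mult_nonneg_nonneg real_sqrt_unique zero_le_numeral)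
  thus ?thesis
    using S by (simp add: S_def s_def)
qed

lemma eprod_0_1:
  assumes "Im t > 0"
  shows "eprod 0 1 t = - of_real (sqrt 13) * qpoch_inf (cis1 t ^ 13) (cis1 t ^ 13) / qpoch_inf (cis1 t) (cis1 t) ^ 13"
proof -
  define q where "q = cis1 t"
  have q: "norm q < 1"
    using norm_cis1_less_1[OF assms] by (simp add: q_def)
  define A where "A = qpoch_inf q q"
  have A: "A \<noteq> 0"
    using q by (simp add: A_def qpoch_inf_nonzero)
  define f where "f = (\<lambda>k. qpoch_inf (q * cis1 (of_int (2 * k) / 13)) q)"
  have T: "tors 0 1 k 0 t = (cis1 (of_int k / 13) - cis1 (- of_int k / 13)) * ((f k * f (- k)) * (1 / A ^ 2))" for k
  proof -
    have "cis1 (t + 2 * of_int k / 13) = q * cis1 (of_int (2 * k) / 13)"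
      "cis1 (t - 2 * of_int k / 13) = q * cis1 (of_int (2 * (- k)) / 13)"
      unfolding q_def cis1_add[symmetric] by simp_all
    thus ?thesis
      by (simp add: tors_def kform_def klein_def f_def A_def q_def[symmetric])
  qed
  have "qpoch_inf (q ^ 13) (q ^ 13) = A * (\<Prod>k\<in>{1..6}. f k * f (- k))"
    using qpoch_inf_13[OF q, of 2 q] unfolding prod_symmetric_residues by (simp add: f_def A_def)
  hence P: "(\<Prod>k\<in>{1..6}. f k * f (- k)) = qpoch_inf (q ^ 13) (q ^ 13) / A"
    using A by simp
  have "eprod 0 1 t = (\<Prod>k\<in>{1..6 :: int}. cis1 (of_int k / 13) - cis1 (- of_int k / 13))
      * ((\<Prod>k\<in>{1..6}. f k * f (- k)) * (\<Prod>k\<in>{1..6 :: int}. 1 / A ^ 2))"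
    unfolding eprod_def T by (simp only: prod.distrib)
  also have "(\<Prod>k\<in>{1..6 :: int}. 1 / A ^ 2) = 1 / A ^ 12"
    by (simp add: power_one_over flip: power_mult)
  finally have "eprod 0 1 t = - of_real (sqrt 13) * qpoch_inf (q ^ 13) (q ^ 13) / (A * A ^ 12)"
    unfolding prod_sines P
    by (simp only: times_divide_eq_left times_divide_eq_right mult_1_right divide_divide_eq_left)
  also have "A * A ^ 12 = A ^ 13"
    by (simp flip: power_Suc)
  finally show ?thesis
    by (simp only: q_def A_def)
qed

lemma cancel_common_factors:
  fixes a b c d e n :: complex
  assumes "a \<noteq> 0" "b \<noteq> 0"
  shows "n / ((a * c) * (b * d)) * (a * b) / e = n / (e * c * d)"
  using assms by (cases "c = 0"; cases "d = 0"; cases "e = 0") (simp_all add: field_simps)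

lemma hauptmodul_0_1:
  assumes "Im t > 0"
  shows "hauptmodul 0 1 t = cis1 t * qpoch_inf (cis1 t ^ 13) (cis1 t ^ 13) ^ 2 / qpoch_inf (cis1 t) (cis1 t) ^ 2"
proof -
  define A B where "A = qpoch_inf (cis1 t) (cis1 t)" and "B = qpoch_inf (cis1 t ^ 13) (cis1 t ^ 13)"
  have A: "A \<noteq> 0"
    using norm_cis1_less_1[OF assms] by (simp add: A_def qpoch_inf_nonzero)
  have "(- of_real (sqrt 13)) ^ 2 = (13 :: complex)"
    by (simp flip: of_real_power)
  hence "eprod 0 1 t ^ 2 = 13 * (B ^ 2 / A ^ 26)"
    unfolding eprod_0_1[OF assms] A_def[symmetric] B_def[symmetric] power_divide power_mult_distrib
    by (simp flip: power_mult)
  moreover have "A ^ 26 = A ^ 24 * A ^ 2"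
    by (simp flip: power_add)
  moreover have "13 * (n / (b * d)) * (c * b) / 13 = c * n / d" if "b \<noteq> 0" for b c d n :: complex
    using that by (cases "d = 0") (simp_all add: field_simps)
  ultimately show ?thesis
    unfolding hauptmodul_def Delta_def A_def[symmetric] B_def[symmetric]
    using A by (simp only: power_not_zero not_False_eq_True)
qed

lemma prod_lessThan_13:
  "(\<Prod>r<13. f r) = f 0 * f 1 * f 2 * f 3 * f 4 * f 5 * f 6 * f 7 * f 8 * f 9 * f 10 * f 11 * f (12 :: nat)"
  by (simp add: eval_nat_numeral)

text \<open>For \<open>n\<close> in 1..6 the exponents \<open>2 * n\<close> and
  \<open>13 - 2 * n\<close> run through 1..12, so the products multiply to
  \<open>qpoch_inf x x\<close> without the class of 13. The six signs cancel, and \<open>x\<close>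
  has the exponent 14 - 21 = -7.\<close>

lemma eprod_1_0:
  assumes "Im t > 0"
  defines "x \<equiv> cis1 (t / 13)"
  shows "eprod 1 0 t = qpoch_inf x x / (x ^ 7 * qpoch_inf (x ^ 13) (x ^ 13) ^ 13)"
proof -
  define A where "A = qpoch_inf (x ^ 13) (x ^ 13)"
  have x: "norm x < 1" "norm (x ^ 13) < 1" "x \<noteq> 0"
    using norm_cis1_less_1[of "t / 13"] assms(1) by (simp_all add: x_def norm_power power_less_one_iff)
  have A: "A \<noteq> 0"
    using x by (simp add: A_def qpoch_inf_nonzero)
  have cx: "cis1 (of_nat n * t / 13) = x ^ n" for n
    by (simp add: x_def cis1_power)
  have q: "cis1 t = x ^ 13"
    using cx[of 13] by simp
  define f where "f = (\<lambda>n. qpoch_inf (x ^ n) (x ^ 13))"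
  have T: "tors 1 0 (int n) 0 t = cis1 (of_nat (2 * n ^ 2) * t / 169) * (- (1 / x ^ n) * (f (2 * n) * f (13 - 2 * n)) / A ^ 2)"
    if n: "n \<le> 6" for n
  proof -
    define y where "y = (2 * of_nat n / 13 :: complex)"
    have e1: "cis1 (y * t / 2) = x ^ n"
      using cx[of n] by (simp add: y_def mult.commute)
    have e2: "cis1 (- (y * t) / 2) = 1 / x ^ n"
      unfolding minus_divide_left[symmetric] cis1_minus inverse_eq_divide e1 ..
    have yt: "y * t = of_nat (2 * n) * t / 13"
      by (simp add: y_def)
    have e3: "cis1 (t + y * t) = x ^ (2 * n) * x ^ 13"
      unfolding cis1_add q yt cx by (rule mult.commute)
    have "x ^ 13 = x ^ (13 - 2 * n) * x ^ (2 * n)"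
      using n by (simp flip: power_add)
    hence e4: "cis1 (t - y * t) = x ^ (13 - 2 * n)"
      unfolding cis1_diff q yt cx using x by simp
    have e5: "f (2 * n) = (1 - x ^ (2 * n)) * qpoch_inf (x ^ (2 * n) * x ^ 13) (x ^ 13)"
      unfolding f_def by (rule qpoch_inf_rec[OF x(2)])
    have e6: "x ^ n - 1 / x ^ n = - (1 / x ^ n) * (1 - x ^ (2 * n))"
      using x unfolding mult_2 power_add by (simp add: field_simps)
    have e7: "y ^ 2 * t / 2 = of_nat (2 * n ^ 2) * t / 169"
      by (simp add: y_def power_divide power_mult_distrib)
    have "tors 1 0 (int n) 0 t = cis1 (y ^ 2 * t / 2) * klein (y * t) t"
      by (simp add: tors_def kform_def y_def)
    thus ?thesis
      unfolding klein_def e1 e2 e3 e4 e5 e6 e7 q A_def[symmetric] by (simp only: f_def mult_ac)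
  qed
  have "qpoch_inf x x = (\<Prod>r<13. qpoch_inf (x * x ^ r) (x ^ 13))"
    using x by (intro qpoch_inf_multisection) auto
  hence "qpoch_inf x x = (\<Prod>r<13. f (Suc r))"
    by (simp only: f_def power_Suc)
  moreover have "f 13 = A"
    by (simp add: f_def A_def)
  ultimately have M: "qpoch_inf x x = f 1 * f 2 * f 3 * f 4 * f 5 * f 6 * f 7 * f 8 * f 9 * f 10 * f 11 * f 12 * A"
    unfolding prod_lessThan_13 by (simp add: numeral_2_eq_2[symmetric])
  \<comment> \<open>\<open>2 * 91 / 169 = 14 / 13\<close>.\<close>
  have ph: "cis1 (of_nat (2 * 1 ^ 2) * t / 169) * cis1 (of_nat (2 * 2 ^ 2) * t / 169) * cis1 (of_nat (2 * 3 ^ 2) * t / 169)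
      * cis1 (of_nat (2 * 4 ^ 2) * t / 169) * cis1 (of_nat (2 * 5 ^ 2) * t / 169) * cis1 (of_nat (2 * 6 ^ 2) * t / 169) = x ^ 14"
    unfolding cis1_add[symmetric] cx[of 14, symmetric] by (rule arg_cong[of _ _ cis1]) (simp add: field_simps)
  have "eprod 1 0 t = (cis1 (of_nat (2 * 1 ^ 2) * t / 169) * cis1 (of_nat (2 * 2 ^ 2) * t / 169) * cis1 (of_nat (2 * 3 ^ 2) * t / 169)
      * cis1 (of_nat (2 * 4 ^ 2) * t / 169) * cis1 (of_nat (2 * 5 ^ 2) * t / 169) * cis1 (of_nat (2 * 6 ^ 2) * t / 169))
      * (f 1 * f 2 * f 3 * f 4 * f 5 * f 6 * f 7 * f 8 * f 9 * f 10 * f 11 * f 12)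
      / (x ^ 1 * x ^ 2 * x ^ 3 * x ^ 4 * x ^ 5 * x ^ 6 * (A ^ 2 * A ^ 2 * A ^ 2 * A ^ 2 * A ^ 2 * A ^ 2))"
    unfolding eprod_def one_to_six using T[of 1] T[of 2] T[of 3] T[of 4] T[of 5] T[of 6]
    by (simp add: mult_ac)
  also have "\<dots> = x ^ 14 * (f 1 * f 2 * f 3 * f 4 * f 5 * f 6 * f 7 * f 8 * f 9 * f 10 * f 11 * f 12) / (x ^ 21 * A ^ 12)"
    unfolding ph by (simp only: power_add[symmetric]) simp
  also have "x ^ 21 = x ^ 14 * x ^ 7"
    by (simp flip: power_add)
  also have "x ^ 14 * (f 1 * f 2 * f 3 * f 4 * f 5 * f 6 * f 7 * f 8 * f 9 * f 10 * f 11 * f 12) / (x ^ 14 * x ^ 7 * A ^ 12)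
      = (f 1 * f 2 * f 3 * f 4 * f 5 * f 6 * f 7 * f 8 * f 9 * f 10 * f 11 * f 12) * A / (x ^ 7 * A ^ 13)"
  proof -
    have A13: "A ^ 13 = A * A ^ 12"
      by (simp flip: power_Suc)
    have gen: "a * n / (a * c * d) = n * e / (c * (e * d))" if "a \<noteq> 0" "e \<noteq> 0" for a c d e n :: complex
      using that by (cases "c = 0"; cases "d = 0") (simp_all add: field_simps)
    show ?thesis
      unfolding A13 by (rule gen) (use x A in simp_all)
  qed
  finally show ?thesis
    unfolding M A_def[symmetric] .
qed

lemma hauptmodul_1_0:
  assumes "Im t > 0"
  defines "x \<equiv> cis1 (t / 13)"
  shows "hauptmodul 1 0 t = qpoch_inf x x ^ 2 / (13 * x * qpoch_inf (x ^ 13) (x ^ 13) ^ 2)"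
proof -
  define A where "A = qpoch_inf (x ^ 13) (x ^ 13)"
  have x: "norm x < 1" "norm (x ^ 13) < 1" "x \<noteq> 0"
    using norm_cis1_less_1[of "t / 13"] assms(1) by (simp_all add: x_def norm_power power_less_one_iff)
  have A: "A \<noteq> 0"
    using x by (simp add: A_def qpoch_inf_nonzero)
  have q: "cis1 t = x ^ 13"
    by (simp add: x_def cis1_power)
  have "eprod 1 0 t ^ 2 = qpoch_inf x x ^ 2 / (x ^ 14 * A ^ 26)"
    unfolding eprod_1_0[OF assms(1)] x_def[symmetric] A_def[symmetric] power_divide power_mult_distrib
    by (simp flip: power_mult)
  moreover have "A ^ 26 = A ^ 24 * A ^ 2" "x ^ 14 = x ^ 13 * x"
    by (simp_all flip: power_add power_Suc2)
  ultimately show ?thesis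
    unfolding hauptmodul_def Delta_def q A_def[symmetric]
    using A x by (simp only: cancel_common_factors power_not_zero not_False_eq_True)
qed

lemma cis1_quarter_shift: "cis1 ((1 / 2 + w) / 2) = \<i> * cis1 (w / 2)" "cis1 (- (1 / 2 + w) / 2) = - \<i> * (1 / cis1 (w / 2))"
proof -
  have "(1 / 2 + w) / 2 = 1 / 4 + w / 2" "- (1 / 2 + w) / 2 = - (1 / 4) + - (w / 2)"
    by (simp_all add: field_simps)
  thus "cis1 ((1 / 2 + w) / 2) = \<i> * cis1 (w / 2)" "cis1 (- (1 / 2 + w) / 2) = - \<i> * (1 / cis1 (w / 2))"
    by (simp_all only: cis1_add cis1_minus cis1_quarter inverse_eq_divide) simp_all
qed

text \<open>The points \<open>k\<close> and \<open>- k\<close> contribute equally to the sum of 13th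
  powers, and the resulting 2 cancels the 2 of the point 0 in the denominator; that point itself
  leaves half of \<open>2 ^ 13\<close>. All terms are multiplied up to the common pole
  \<open>x ^ 7\<close>.\<close>

lemma theta_quot_1_0_expansion:
  assumes "Im t > 0"
  defines "x \<equiv> cis1 (t / 13)"
  defines "V \<equiv> \<lambda>n :: nat. qpoch_inf (- (x ^ (2 * n))) (x ^ 13) * qpoch_inf (- (x ^ (13 - 2 * n))) (x ^ 13)"
  shows "13 * x ^ 7 * theta_quot 1 0 (1 / 2) t * qpoch_inf (- x) x ^ 2
    = 4096 * x ^ 21 * qpoch_inf (- (x ^ 13)) (x ^ 13) ^ 26 + x ^ 10 * V 1 ^ 13 + x ^ 3 * V 2 ^ 13 + V 3 ^ 13
      + x * V 4 ^ 13 + x ^ 6 * V 5 ^ 13 + x ^ 15 * V 6 ^ 13"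
proof -
  define A where "A = qpoch_inf (x ^ 13) (x ^ 13)"
  define Q where "Q = qpoch_inf (- (x ^ 13)) (x ^ 13)"
  define D where "D = qpoch_inf (- x) x ^ 2"
  have x: "norm x < 1" "norm (x ^ 13) < 1" "x \<noteq> 0"
    using norm_cis1_less_1[of "t / 13"] assms(1) by (simp_all add: x_def norm_power power_less_one_iff)
  have nz: "A \<noteq> 0" "D \<noteq> 0"
    using x by (simp_all add: A_def D_def qpoch_inf_nonzero)
  have cx: "cis1 (of_nat n * t / 13) = x ^ n" for n
    by (simp add: x_def cis1_power)
  have q: "cis1 t = x ^ 13"
    using cx[of 13] by simp
  \<comment> \<open>Invariance of \<open>R\<close> under inverting \<open>g\<close> is what makes
    the contributions of \<open>k\<close> and \<open>- k\<close> equal.\<close>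
  define R where "R = (\<lambda>g. \<i> * (g + 1 / g) * (qpoch_inf (- (x ^ 13 * g ^ 2)) (x ^ 13) * qpoch_inf (- (x ^ 13 / g ^ 2)) (x ^ 13)) / A ^ 2)"
  have R_inv: "R (1 / g) = R g" if "g \<noteq> 0" for g
    using that by (simp add: R_def power_divide mult.commute add.commute)
  define ph where "ph = (\<lambda>k :: int. of_int (2 * k ^ 2) * t / 169 + of_int k / 13)"
  have T: "tors 1 0 k (1 / 2) t = cis1 (ph k) * R (cis1 (of_int k * t / 13))" for k
  proof -
    define y where "y = (2 * of_int k / 13 :: complex)"
    define g where "g = cis1 (of_int k * t / 13)"
    have g: "cis1 (y * t / 2) = g" "cis1 (y * t) = g ^ 2"
      by (simp_all add: g_def y_def cis1_power mult_ac)
    have e1: "cis1 (t + (1 / 2 + y * t)) = - (x ^ 13 * g ^ 2)" "cis1 (t - (1 / 2 + y * t)) = - (x ^ 13 / g ^ 2)"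
      unfolding cis1_add cis1_diff q g cis1_half by simp_all
    have e2: "y ^ 2 * t / 2 + y * (1 / 2) + y * 0 / 2 = ph k"
      by (simp add: y_def ph_def power_divide power_mult_distrib)
    have "tors 1 0 k (1 / 2) t = cis1 (y ^ 2 * t / 2 + y * (1 / 2) + y * 0 / 2) * klein (1 / 2 + y * t) t"
      by (simp add: tors_def kform_def y_def)
    also have "klein (1 / 2 + y * t) t = (\<i> * g - - \<i> * (1 / g)) * qpoch_inf (- (x ^ 13 * g ^ 2)) (x ^ 13)
        * qpoch_inf (- (x ^ 13 / g ^ 2)) (x ^ 13) / A ^ 2"
      unfolding klein_def cis1_quarter_shift e1 g q A_def ..
    also have "\<i> * g - - \<i> * (1 / g) = \<i> * (g + 1 / g)"
      by (simp add: algebra_simps)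
    finally show ?thesis
      unfolding e2 R_def g_def by (simp only: mult.assoc)
  qed
  define w where "w = (\<lambda>n :: nat. R (x ^ n))"
  have Tpos: "tors 1 0 (int n) (1 / 2) t = cis1 (ph (int n)) * w n" for n
    using T[of "int n"] cx[of n] by (simp add: w_def)
  have Tneg: "tors 1 0 (- int n) (1 / 2) t = cis1 (ph (- int n)) * w n" for n
  proof -
    have "cis1 (of_int (- int n) * t / 13) = 1 / x ^ n"
      using cx[of n] cis1_minus[of "of_nat n * t / 13"] by (simp add: inverse_eq_divide)
    thus ?thesis
      using T[of "- int n"] R_inv[of "x ^ n"] x by (simp add: w_def)
  qed
  have ph13: "cis1 (ph k) ^ 13 = x ^ (2 * nat \<bar>k\<bar> ^ 2)" for k
  proof -
    have "of_nat (2 * nat \<bar>k\<bar> ^ 2) = (of_int (2 * k ^ 2) :: complex)"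
      by (cases "k \<ge> 0") simp_all
    hence "cis1 (ph k) ^ 13 = cis1 (of_nat (2 * nat \<bar>k\<bar> ^ 2) * t / 13)"
      unfolding cis1_power by (intro cis1_cong[of _ _ k]) (simp add: ph_def field_simps)
    thus ?thesis
      by (simp only: cx)
  qed
  have T13: "tors 1 0 (int n) (1 / 2) t ^ 13 = x ^ (2 * n ^ 2) * w n ^ 13"
    "tors 1 0 (- int n) (1 / 2) t ^ 13 = x ^ (2 * n ^ 2) * w n ^ 13" for n
    unfolding Tpos Tneg power_mult_distrib ph13 by simp_all
  have sum: "(\<Sum>k\<in>{-6..6}. tors 1 0 k (1 / 2) t ^ 13) = w 0 ^ 13
      + 2 * (x ^ 2 * w 1 ^ 13 + x ^ 8 * w 2 ^ 13 + x ^ 18 * w 3 ^ 13 + x ^ 32 * w 4 ^ 13 + x ^ 50 * w 5 ^ 13 + x ^ 72 * w 6 ^ 13)"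
    unfolding symmetric_residues
    using T13[of 0] T13[of 1] T13[of 2] T13[of 3] T13[of 4] T13[of 5] T13[of 6] by simp
  have prod: "(\<Prod>k\<in>{-6..6}. tors 1 0 k (1 / 2) t) = x ^ 28 * (w 0 * (w 1 * w 2 * w 3 * w 4 * w 5 * w 6) ^ 2)"
  proof -
    define w' where "w' = (\<lambda>k. w (nat \<bar>k\<bar>))"
    have Tw: "tors 1 0 k (1 / 2) t = cis1 (ph k) * w' k" for k
      using Tpos[of "nat k"] Tneg[of "nat (- k)"] by (cases "k \<ge> 0") (simp_all add: w'_def)
    have "(\<Prod>k\<in>{-6..6}. tors 1 0 k (1 / 2) t) = cis1 (\<Sum>k\<in>{-6..6}. ph k) * (\<Prod>k\<in>{-6..6}. w' k)"
      unfolding Tw prod.distrib cis1_sum ..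
    also have "(\<Sum>k\<in>{-6..6}. ph k) = of_nat 28 * t / 13"
      unfolding symmetric_residues by (simp add: ph_def field_simps)
    also have "cis1 \<dots> = x ^ 28"
      by (rule cx)
    also have "(\<Prod>k\<in>{-6..6}. w' k) = w 0 * (w 1 * w 2 * w 3 * w 4 * w 5 * w 6) ^ 2"
      unfolding symmetric_residues by (simp add: w'_def power2_eq_square mult_ac)
    finally show ?thesis .
  qed
  have w0: "w 0 = 2 * \<i> * Q ^ 2 / A ^ 2"
    by (simp add: w_def R_def Q_def power2_eq_square)
  have wn: "w n = \<i> * V n / (x ^ n * A ^ 2)" if n: "n \<le> 6" for n
  proof -
    have 1: "(x ^ n) ^ 2 = x ^ (2 * n)"
      by (simp add: power_mult[symmetric] mult.commute)
    have "x ^ 13 = x ^ (13 - 2 * n) * x ^ (2 * n)"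
      using n by (simp flip: power_add)
    hence 2: "x ^ 13 / x ^ (2 * n) = x ^ (13 - 2 * n)"
      using x by simp
    have 3: "qpoch_inf (- (x ^ (2 * n))) (x ^ 13) = (1 + x ^ (2 * n)) * qpoch_inf (- (x ^ 13 * x ^ (2 * n))) (x ^ 13)"
      using qpoch_inf_rec[OF x(2), of "- (x ^ (2 * n))"] by (simp add: mult.commute)
    have 4: "x ^ n + 1 / x ^ n = (1 + x ^ (2 * n)) / x ^ n"
      using x unfolding mult_2 power_add by (simp add: field_simps)
    have "w n = \<i> * ((1 + x ^ (2 * n)) / x ^ n) * (qpoch_inf (- (x ^ 13 * x ^ (2 * n))) (x ^ 13)
        * qpoch_inf (- (x ^ (13 - 2 * n))) (x ^ 13)) / A ^ 2"
      unfolding w_def R_def 1 2 4 ..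
    thus ?thesis
      unfolding V_def 3 by (simp add: mult_ac)
  qed
  define VV where "VV = V 1 * V 2 * V 3 * V 4 * V 5 * V 6"
  have D: "Q ^ 2 * VV ^ 2 = D"
  proof -
    define f where "f = (\<lambda>n. qpoch_inf (- (x ^ n)) (x ^ 13))"
    have "qpoch_inf (- x) x = (\<Prod>r<13. qpoch_inf (- x * x ^ r) (x ^ 13))"
      using x by (intro qpoch_inf_multisection) auto
    hence "qpoch_inf (- x) x = (\<Prod>r<13. f (Suc r))"
      by (simp only: f_def power_Suc mult_minus_left)
    moreover have "f 13 = Q"
      by (simp add: f_def Q_def)
    ultimately have "qpoch_inf (- x) x = f 1 * f 2 * f 3 * f 4 * f 5 * f 6 * f 7 * f 8 * f 9 * f 10 * f 11 * f 12 * Q"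
      unfolding prod_lessThan_13 by (simp add: numeral_2_eq_2[symmetric])
    moreover have "V n = f (2 * n) * f (13 - 2 * n)" for n
      by (simp add: V_def f_def)
    ultimately have "qpoch_inf (- x) x = Q * VV"
      by (simp add: VV_def mult_ac)
    thus ?thesis
      by (simp add: D_def power_mult_distrib)
  qed
  have i12: "\<i> ^ 13 = \<i>" "\<i> ^ 12 = 1"
    using power_mult[of \<i> 4 3] by (simp_all add: power4_eq_xxxx eval_nat_numeral)
  have wn13: "w n ^ 13 = \<i> * (V n ^ 13 / x ^ (13 * n)) / A ^ 26" if "n \<le> 6" for n
    unfolding wn[OF that] power_divide power_mult_distrib i12 by (simp add: power_mult[symmetric] mult.commute)
  have w013: "w 0 ^ 13 = \<i> * (8192 * Q ^ 26) / A ^ 26"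
    unfolding w0 power_divide power_mult_distrib i12 by (simp add: power_mult[symmetric])
  define S where "S = 8192 * Q ^ 26 + 2 * (x ^ 2 * (V 1 ^ 13 / x ^ 13) + x ^ 8 * (V 2 ^ 13 / x ^ 26) + x ^ 18 * (V 3 ^ 13 / x ^ 39)
      + x ^ 32 * (V 4 ^ 13 / x ^ 52) + x ^ 50 * (V 5 ^ 13 / x ^ 65) + x ^ 72 * (V 6 ^ 13 / x ^ 78))"
  have sum': "(\<Sum>k\<in>{-6..6}. tors 1 0 k (1 / 2) t ^ 13) = \<i> * S / A ^ 26"
    unfolding sum w013 S_def using wn13[of 1] wn13[of 2] wn13[of 3] wn13[of 4] wn13[of 5] wn13[of 6]
    by (simp add: add_divide_distrib distrib_left mult_ac)
  have prod': "(\<Prod>k\<in>{-6..6}. tors 1 0 k (1 / 2) t) = 2 * \<i> * D / (x ^ 14 * A ^ 26)"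
  proof -
    have "w 1 * w 2 * w 3 * w 4 * w 5 * w 6 = \<i> ^ 6 * VV / (x ^ 21 * A ^ 12)"
    proof -
      have "x ^ 21 = x ^ 1 * x ^ 2 * x ^ 3 * x ^ 4 * x ^ 5 * x ^ 6"
        by (simp only: power_add[symmetric]) simp
      moreover have "A ^ 12 = A ^ 2 * A ^ 2 * A ^ 2 * A ^ 2 * A ^ 2 * A ^ 2"
        by (simp only: power_add[symmetric]) simp
      moreover have "\<i> ^ 6 = \<i> * \<i> * \<i> * \<i> * \<i> * \<i>"
        by (simp add: eval_nat_numeral)
      ultimately show ?thesis
        using wn[of 1] wn[of 2] wn[of 3] wn[of 4] wn[of 5] wn[of 6]
        by (simp only: VV_def times_divide_times_eq mult_ac)
    qed
    hence "(w 1 * w 2 * w 3 * w 4 * w 5 * w 6) ^ 2 = VV ^ 2 / (x ^ 42 * A ^ 24)"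
      by (simp only: power_divide power_mult_distrib power_mult[symmetric]) (simp add: i12)
    hence "(\<Prod>k\<in>{-6..6}. tors 1 0 k (1 / 2) t) = x ^ 28 * (2 * \<i> * Q ^ 2 / A ^ 2 * (VV ^ 2 / (x ^ 42 * A ^ 24)))"
      unfolding prod w0 by simp
    also have "\<dots> = x ^ 28 * (2 * \<i> * D) / (x ^ 42 * (A ^ 2 * A ^ 24))"
      unfolding D[symmetric] by (simp add: mult_ac)
    also have "x ^ 42 = x ^ 28 * x ^ 14"
      by (simp flip: power_add)
    also have "A ^ 2 * A ^ 24 = A ^ 26"
      by (simp flip: power_add)
    also have "x ^ 28 * (2 * \<i> * D) / (x ^ 28 * x ^ 14 * A ^ 26) = 2 * \<i> * D / (x ^ 14 * A ^ 26)"
      unfolding mult.assoc[of "x ^ 28"] by (rule mult_divide_mult_cancel_left) (use x in simp)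
    finally show ?thesis .
  qed
  have gen: "13 * c * ((\<i> * s / a) / (2 * \<i> * d / (b * a)) / 13) * d = (c * b) * (s / 2)"
    if "a \<noteq> 0" "d \<noteq> 0" for a b c d s :: complex
    using that by (cases "b = 0") (simp_all add: field_simps)
  have "13 * x ^ 7 * theta_quot 1 0 (1 / 2) t * D = (x ^ 7 * x ^ 14) * (S / 2)"
    unfolding theta_quot_def sum' prod' by (rule gen) (use nz in simp_all)
  moreover have "x ^ 7 * x ^ 14 = x ^ 21"
    by (simp flip: power_add)
  moreover have "x ^ 21 * (S / 2) = 4096 * x ^ 21 * Q ^ 26 + (x ^ 21 * x ^ 2 / x ^ 13) * V 1 ^ 13 + (x ^ 21 * x ^ 8 / x ^ 26) * V 2 ^ 13
      + (x ^ 21 * x ^ 18 / x ^ 39) * V 3 ^ 13 + (x ^ 21 * x ^ 32 / x ^ 52) * V 4 ^ 13 + (x ^ 21 * x ^ 50 / x ^ 65) * V 5 ^ 13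
      + (x ^ 21 * x ^ 72 / x ^ 78) * V 6 ^ 13"
    unfolding S_def by (simp add: distrib_left add_divide_distrib mult_ac)
  \<comment> \<open>The exponents are \<open>2 * n ^ 2 - 13 * n + 21\<close>; the minimum 0 is
    reached at \<open>n = 3\<close>.\<close>
  moreover have "x ^ 21 * x ^ 2 / x ^ 13 = x ^ 10" "x ^ 21 * x ^ 8 / x ^ 26 = x ^ 3" "x ^ 21 * x ^ 18 / x ^ 39 = 1"
    "x ^ 21 * x ^ 32 / x ^ 52 = x" "x ^ 21 * x ^ 50 / x ^ 65 = x ^ 6" "x ^ 21 * x ^ 72 / x ^ 78 = x ^ 15"
    using x by (simp_all add: divide_eq_eq flip: power_add power_Suc)
  ultimately show ?thesis
    unfolding D_def Q_def by (simp only: mult_1)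
qed

section \<open>The trace and the partition series\<close>

lemma eprod_translate_nat: "eprod a b (t + of_nat n) = eprod a (b + int n * a) t"
proof (induction n arbitrary: b)
  case (Suc n)
  have "eprod a b (t + of_nat (Suc n)) = eprod a b ((t + of_nat n) + 1)"
    by (simp add: add_ac)
  also have "\<dots> = eprod a (a + b + int n * a) t"
    by (simp only: eprod_translate Suc)
  finally show ?case
    by (simp add: algebra_simps)
qed simp

lemma residues_image: "{0..12 :: int} = int ` {..<13}"
proof -
  have "{0..12 :: int} = int ` {0..12}"
    using image_int_atLeastAtMost[of 0 12] by simp
  also have "{0..12} = {..<13 :: nat}"
    by auto
  finally show ?thesis .
qed

lemma sum_residues_nat: "(\<Sum>y\<in>{0..12}. F y) = (\<Sum>r<13. F (int r))"
  unfolding residues_image by (simp add: sum.reindex)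

lemma sum_residues_scale:
  fixes F :: "int \<Rightarrow> complex"
  assumes "\<And>k m. F (k + 13 * m) = F k" "\<not> 13 dvd c"
  shows "(\<Sum>y\<in>{0..12}. F y) = (\<Sum>y\<in>{0..12}. F (c * y))"
proof -
  have "F (c * (k + 13 * m)) = F (c * k)" for k m
    using assms(1)[of "c * k" "c * m"] by (simp add: algebra_simps)
  hence "(\<Sum>y\<in>{0..12}. F (c * y)) = (\<Sum>k\<in>{-6..6}. F (c * k))"
    unfolding sum_residues_nat by (rule sum_nat_residues[where F = "\<lambda>k. F (c * k)"])
  also have "\<dots> = (\<Sum>k\<in>{-6..6}. F k)"
    by (rule sum_scale_residues) (use assms in auto)
  also have "\<dots> = (\<Sum>y\<in>{0..12}. F y)"
    unfolding sum_residues_nat by (rule sum_nat_residues[symmetric]) (use assms in auto)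
  finally show ?thesis ..
qed

lemma chi_0: "chi 0 = 0"
  by (simp add: chi_def)

lemma chi_uminus: "chi (- c) = chi c"
  using chi_mult[of "- 1" c] by (simp add: chi_def)

text \<open>For nonzero \<open>x\<close> the value of \<open>chi\<close> at the determinant cancels
  the \<open>chi x\<close> from \<open>eprod_scale\<close>, so each of the 12 rows gives the same
  sum over the lines \<open>(1, y)\<close>; this explains the division by 12.\<close>

lemma eprod_trace_0_1:
  assumes "Im t > 0"
  shows "eprod_trace 0 1 t = (\<Sum>r<13. eprod 0 1 t / eprod 1 0 (t + of_nat r))"
proof -
  define W where "W = (\<Sum>y\<in>{0..12}. eprod 0 1 t / eprod 1 y t)"
  have row: "(\<Sum>y\<in>{0..12}. chi (0 * y - 1 * x) * (eprod 0 1 t / eprod x y t)) = (if x = 0 then 0 else W)"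
    if x: "x \<in> {0..12}" for x
  proof (cases "x = 0")
    case False
    have nd: "\<not> 13 dvd x"
      using x False by (auto dest!: zdvd_imp_le)
    have "(\<Sum>y\<in>{0..12}. chi x * (eprod 0 1 t / eprod x y t)) = (\<Sum>y\<in>{0..12}. chi x * (eprod 0 1 t / eprod x (x * y) t))"
    proof (rule sum_residues_scale[OF _ nd])
      fix k m
      show "chi x * (eprod 0 1 t / eprod x (k + 13 * m) t) = chi x * (eprod 0 1 t / eprod x k t)"
        using eprod_shift[OF assms, of x 0 k m] by simp
    qed
    also have "\<dots> = W"
      unfolding W_def
    proof (rule sum.cong[OF refl])
      fix y
      have "eprod x (x * y) t = chi x * eprod 1 y t"
        using eprod_scale[OF assms, of x 1 y] by simp
      moreover have "chi x \<noteq> 0"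
        using chi_squared[OF nd] by auto
      ultimately show "chi x * (eprod 0 1 t / eprod x (x * y) t) = eprod 0 1 t / eprod 1 y t"
        by simp
    qed
    finally show ?thesis
      using False by (simp add: chi_uminus)
  qed (simp add: chi_0)
  have "eprod_trace 0 1 t = (\<Sum>x\<in>{0..12 :: int}. if x = 0 then 0 else W) / 12"
    unfolding eprod_trace_def using row by (intro arg_cong[of _ _ "\<lambda>s. s / 12"] sum.cong) auto
  also have "(\<Sum>x\<in>{0..12 :: int}. if x = 0 then 0 else W) = (\<Sum>x\<in>{1..12 :: int}. W)"
    by (intro sum.mono_neutral_cong_right) auto
  also have "\<dots> / 12 = W"
    by simp
  also have "W = (\<Sum>r<13. eprod 0 1 t / eprod 1 0 (t + of_nat r))"
    unfolding W_def sum_residues_nat using eprod_translate_nat[of 1 0 t] by simp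
  finally show ?thesis .
qed

text \<open>The factor \<open>X r ^ 7\<close> shifts the exponent, so that averaging over
  \<open>r\<close> selects those \<open>n\<close> with \<open>n + 7\<close> divisible by 13, namely
  \<open>n = 13 * Suc j - 7\<close>.\<close>

lemma partition_residue_sums:
  assumes "Im t > 0"
  defines "X \<equiv> \<lambda>r :: nat. cis1 ((t + of_nat r) / 13)"
  shows "(\<lambda>j. of_nat (num_partitions (13 * Suc j - 7)) * cis1 t ^ Suc j) sums
           ((\<Sum>r<13. X r ^ 7 / qpoch_inf (X r) (X r)) / 13)"
proof -
  define x where "x = cis1 (t / 13)"
  have X: "X r = x * cis1 (of_nat r / 13)" for r
    unfolding X_def x_def cis1_add[symmetric] by (simp add: add_divide_distrib)
  have nX: "norm (X r) < 1" for r
    unfolding X_def using assms(1) by (intro norm_cis1_less_1) simp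
  have q: "cis1 t = x ^ 13"
    by (simp add: x_def cis1_power)
  define f where "f = (\<lambda>n. if 13 dvd n + 7 then of_nat (num_partitions n) * x ^ (n + 7) else 0)"
  have "(\<lambda>n. of_nat (num_partitions n) * X r ^ n) sums (1 / qpoch_inf (X r) (X r))" for r
    by (rule num_partitions_sums[OF nX])
  hence "(\<lambda>n. (X r ^ 7) * (of_nat (num_partitions n) * X r ^ n)) sums (X r ^ 7 * (1 / qpoch_inf (X r) (X r)))" for r
    by (rule sums_mult)
  hence "(\<lambda>n. \<Sum>r<13. (X r ^ 7) * (of_nat (num_partitions n) * X r ^ n)) sums
      (\<Sum>r<13. X r ^ 7 * (1 / qpoch_inf (X r) (X r)))"
    by (intro sums_sum)
  moreover have "(\<Sum>r<13. (X r ^ 7) * (of_nat (num_partitions n) * X r ^ n)) = 13 * f n" for n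
  proof -
    have "(X r ^ 7) * (of_nat (num_partitions n) * X r ^ n)
        = of_nat (num_partitions n) * x ^ (n + 7) * cis1 (of_nat r * of_int (int (n + 7)) / of_nat 13)" for r
    proof -
      have "(X r ^ 7) * (of_nat (num_partitions n) * X r ^ n) = of_nat (num_partitions n) * X r ^ (n + 7)"
        by (simp add: power_add mult_ac)
      also have "X r ^ (n + 7) = x ^ (n + 7) * cis1 (of_nat (n + 7) * (of_nat r / 13))"
        unfolding X power_mult_distrib cis1_power ..
      finally show ?thesis
        by (simp add: mult_ac)
    qed
    hence "(\<Sum>r<13. (X r ^ 7) * (of_nat (num_partitions n) * X r ^ n))
        = of_nat (num_partitions n) * x ^ (n + 7) * (\<Sum>r<13. cis1 (of_nat r * of_int (int (n + 7)) / of_nat 13))"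
      by (simp only: sum_distrib_left)
    also have "(\<Sum>r<13. cis1 (of_nat r * of_int (int (n + 7)) / of_nat 13)) = (if int 13 dvd int (n + 7) then of_nat 13 else 0)"
      by (rule sum_roots_of_unity) simp
    finally show ?thesis
      by (simp add: f_def flip: int_dvd_int_iff)
  qed
  ultimately have "(\<lambda>n. 13 * f n) sums (\<Sum>r<13. X r ^ 7 / qpoch_inf (X r) (X r))"
    by simp
  hence "(\<lambda>n. 13 * f n / 13) sums ((\<Sum>r<13. X r ^ 7 / qpoch_inf (X r) (X r)) / 13)"
    by (rule sums_divide)
  hence "f sums ((\<Sum>r<13. X r ^ 7 / qpoch_inf (X r) (X r)) / 13)"
    by simp
  moreover have "(\<lambda>j. f (13 * j + 6)) sums c \<longleftrightarrow> f sums c" for c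
  proof (rule sums_mono_reindex)
    show "strict_mono (\<lambda>j :: nat. 13 * j + 6)"
      by (auto intro!: strict_monoI)
    fix n :: nat assume n: "n \<notin> range (\<lambda>j. 13 * j + 6)"
    have "\<not> 13 dvd n + 7"
    proof
      assume "13 dvd n + 7"
      then obtain k where "n + 7 = 13 * k" ..
      hence "n = 13 * (k - 1) + 6"
        by (cases k) auto
      thus False
        using n by blast
    qed
    thus "f n = 0"
      by (simp add: f_def)
  qed
  ultimately have "(\<lambda>j. f (13 * j + 6)) sums ((\<Sum>r<13. X r ^ 7 / qpoch_inf (X r) (X r)) / 13)"
    by blast
  moreover have "f (13 * j + 6) = of_nat (num_partitions (13 * Suc j - 7)) * cis1 t ^ Suc j" for j
  proof -
    have 1: "13 * Suc j - 7 = 13 * j + 6" and 2: "13 * j + 6 + 7 = 13 * Suc j"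
      by simp_all
    have "13 dvd 13 * Suc j"
      by (rule dvd_triv_left)
    thus ?thesis
      unfolding f_def q power_mult[symmetric] 1 2 by (simp only: if_True)
  qed
  ultimately show ?thesis
    by simp
qed

text \<open>All \<open>X r\<close> have the same 13th power \<open>cis1 t\<close>, so the terms of
  the trace differ only in \<open>X r ^ 7 / qpoch_inf (X r) (X r)\<close>, and the powers of
  \<open>A\<close> cancel.\<close>

lemma eprod_trace_partitions:
  assumes "Im t > 0"
  shows "eprod_trace 0 1 t = - 13 * of_real (sqrt 13) * qpoch_inf (cis1 t ^ 13) (cis1 t ^ 13)
           * (\<Sum>j. of_nat (num_partitions (13 * Suc j - 7)) * cis1 t ^ Suc j)"
proof -
  define X where "X = (\<lambda>r :: nat. cis1 ((t + of_nat r) / 13))"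
  define A B where "A = qpoch_inf (cis1 t) (cis1 t)" and "B = qpoch_inf (cis1 t ^ 13) (cis1 t ^ 13)"
  have A: "A \<noteq> 0"
    using norm_cis1_less_1[OF assms] by (simp add: A_def qpoch_inf_nonzero)
  have X13: "X r ^ 13 = cis1 t" for r
    unfolding X_def cis1_power by (rule cis1_cong[of _ _ "int r"]) (simp add: field_simps)
  have "eprod 0 1 t / eprod 1 0 (t + of_nat r) = - of_real (sqrt 13) * B * (X r ^ 7 / qpoch_inf (X r) (X r))" for r
  proof -
    have nX: "norm (X r) < 1"
      unfolding X_def using assms(1) by (intro norm_cis1_less_1) simp
    have "eprod 1 0 (t + of_nat r) = qpoch_inf (X r) (X r) / (X r ^ 7 * A ^ 13)"
    proof -
      have "eprod 1 0 (t + of_nat r) = qpoch_inf (X r) (X r) / (X r ^ 7 * qpoch_inf (X r ^ 13) (X r ^ 13) ^ 13)"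
        unfolding X_def by (rule eprod_1_0) (use assms in simp)
      thus ?thesis
        by (simp only: X13 A_def)
    qed
    moreover have "(c / a) / (d / (b * a)) = c * (b / d)" if "a \<noteq> 0" for a b c d :: complex
      using that by (cases "d = 0"; cases "b = 0") (simp_all add: field_simps)
    ultimately show ?thesis
      unfolding eprod_0_1[OF assms] A_def[symmetric] B_def[symmetric] using A by simp
  qed
  hence "eprod_trace 0 1 t = - of_real (sqrt 13) * B * (\<Sum>r<13. X r ^ 7 / qpoch_inf (X r) (X r))"
    unfolding eprod_trace_0_1[OF assms] by (simp only: sum_distrib_left)
  also have "(\<Sum>r<13. X r ^ 7 / qpoch_inf (X r) (X r))
      = 13 * (\<Sum>j. of_nat (num_partitions (13 * Suc j - 7)) * cis1 t ^ Suc j)"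
    by (subst sums_unique[OF partition_residue_sums[OF assms], symmetric]) (simp add: X_def)
  finally show ?thesis
    by (simp add: B_def mult_ac)
qed

section \<open>Holomorphy in q and the vanishing criterion\<close>

lemma qpoch_inf_13_holomorphic: "(\<lambda>q. qpoch_inf (q ^ 13) (q ^ 13)) holomorphic_on ball 0 1"
proof -
  have sub13: "(\<lambda>q :: complex. q ^ 13) ` ball 0 1 \<subseteq> ball 0 1"
    by (auto simp: norm_power power_less_one_iff)
  show ?thesis
    using holomorphic_on_compose_gen[OF holomorphic_on_power[OF holomorphic_on_ident] qpoch_inf_self_holomorphic sub13]
    by (simp add: o_def)
qed

text \<open>The expansion of the Hauptmodul at infinity as a function on the full disc, so that the
  cusp becomes the ordinary point \<open>q = 0\<close>.\<close>

definition hauptmodul_q :: "complex \<Rightarrow> complex" where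
  "hauptmodul_q q = q * qpoch_inf (q ^ 13) (q ^ 13) ^ 2 / qpoch_inf q q ^ 2"

lemma hauptmodul_q_holomorphic: "hauptmodul_q holomorphic_on ball 0 1"
  unfolding hauptmodul_q_def[abs_def]
  by (intro holomorphic_intros qpoch_inf_13_holomorphic qpoch_inf_self_holomorphic) (auto simp: qpoch_inf_nonzero)

lemma hauptmodul_q_cis1: "Im t > 0 \<Longrightarrow> hauptmodul 0 1 t = hauptmodul_q (cis1 t)"
  by (simp add: hauptmodul_0_1 hauptmodul_q_def)

text \<open>Dividing by the Hauptmodul moves the zero of \<open>F\<close> from infinity to the cusp 0, so the constant term
  at the cusp 0 is irrelevant.\<close>

lemma modular_family_vanish:
  assumes F: "modular_family F" and hol: "FF holomorphic_on ball 0 1" and FF0: "FF 0 = 0"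
    and FF: "\<And>t. Im t > 0 \<Longrightarrow> F 0 1 t = FF (cis1 t)"
    and bounded: "F 1 0 \<in> O[at_ioo](\<lambda>_. 1)" and t: "Im t > 0"
  shows "FF (cis1 t) = 0"
proof -
  define H where "H = (\<lambda>a b t. F a b t / hauptmodul a b t)"
  have lim_q: "filterlim cis1 (at 0) at_ioo"
    using filterlim_cis1_at_ioo[of 1] by simp
  note lim_x = filterlim_cis1_at_ioo[of 13, simplified]
  have pow13: "filterlim (\<lambda>x. x ^ 13) (at 0) (at (0 :: complex))"
  proof (rule filterlim_atI)
    show "((\<lambda>x :: complex. x ^ 13) \<longlongrightarrow> 0) (at 0)"
      by (rule tendsto_eq_intros refl | simp)+
    show "\<forall>\<^sub>F x :: complex in at 0. x ^ 13 \<noteq> 0"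
      by (simp add: eventually_at_filter)
  qed
  have A: "((\<lambda>q. qpoch_inf q q) \<longlongrightarrow> 1) (at 0)"
    by (rule tendsto_qpoch_inf_self)
  have B: "((\<lambda>q. qpoch_inf (q ^ 13) (q ^ 13)) \<longlongrightarrow> 1) (at 0)"
    by (rule filterlim_compose[OF A pow13])
  have "H 0 1 t = 0"
  proof (rule modular_family_limit_zero[OF _ _ _ _ t])
    show "modular_family H"
      unfolding H_def by (intro modular_family_intros F modular_family_hauptmodul)
    have cis1_ball: "cis1 ` {t. Im t > 0} \<subseteq> ball 0 1"
      using norm_cis1_less_1 by auto
    have "(\<lambda>q. FF q / hauptmodul_q q) holomorphic_on ball 0 1 - {0}"
    proof (rule holomorphic_on_divide)
      show "FF holomorphic_on ball 0 1 - {0}" "hauptmodul_q holomorphic_on ball 0 1 - {0}"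
        using hol hauptmodul_q_holomorphic by (auto intro: holomorphic_on_subset)
    qed (auto simp: hauptmodul_q_def qpoch_inf_nonzero norm_power power_less_one_iff)
    hence "(\<lambda>t. FF (cis1 t) / hauptmodul_q (cis1 t)) holomorphic_on {t. Im t > 0}"
      using holomorphic_on_compose_gen[of cis1 "{t. Im t > 0}" _ "ball 0 1 - {0}"] cis1_ball
        cis1_holomorphic[OF holomorphic_on_ident]
      by (force simp: o_def)
    thus "H 0 1 holomorphic_on {t. Im t > 0}"
      by (rule holomorphic_transform) (simp add: H_def FF hauptmodul_q_cis1)
    \<comment> \<open>The zero of \<open>FF\<close> at \<open>0\<close> offsets the simple zero of
      the Hauptmodul, which leaves a finite limit at infinity.\<close>
    have "(FF has_field_derivative deriv FF 0) (at 0)"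
      by (rule holomorphic_derivI[OF hol]) auto
    hence "((\<lambda>q. FF q / q) \<longlongrightarrow> deriv FF 0) (at 0)"
      by (simp add: has_field_derivative_iff FF0)
    hence "((\<lambda>q. FF q / q * (qpoch_inf q q ^ 2 / qpoch_inf (q ^ 13) (q ^ 13) ^ 2)) \<longlongrightarrow> deriv FF 0 * (1 ^ 2 / 1 ^ 2)) (at 0)"
      using A B by (intro tendsto_intros) auto
    hence "((\<lambda>t. FF (cis1 t) / cis1 t * (qpoch_inf (cis1 t) (cis1 t) ^ 2 / qpoch_inf (cis1 t ^ 13) (cis1 t ^ 13) ^ 2))
        \<longlongrightarrow> deriv FF 0 * (1 ^ 2 / 1 ^ 2)) at_ioo"
      by (rule filterlim_compose[OF _ lim_q])
    moreover have "eventually (\<lambda>t. FF (cis1 t) / cis1 t * (qpoch_inf (cis1 t) (cis1 t) ^ 2 / qpoch_inf (cis1 t ^ 13) (cis1 t ^ 13) ^ 2)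
        = H 0 1 t) at_ioo"
      using eventually_at_ioo_pos by eventually_elim (simp add: H_def FF hauptmodul_0_1)
    ultimately show "(H 0 1 \<longlongrightarrow> deriv FF 0 * (1 ^ 2 / 1 ^ 2)) at_ioo"
      by (rule Lim_transform_eventually)
    \<comment> \<open>At the cusp 0 the Hauptmodul has a pole, so its reciprocal tends to 0 and
      takes the bounded \<open>F 1 0\<close> along.\<close>
    have "((\<lambda>x. 13 * x * (qpoch_inf (x ^ 13) (x ^ 13) ^ 2 / qpoch_inf x x ^ 2)) \<longlongrightarrow> 13 * 0 * (1 ^ 2 / 1 ^ 2)) (at 0)"
      using A B by (intro tendsto_intros) auto
    hence "((\<lambda>t. 13 * cis1 (t / 13) * (qpoch_inf (cis1 (t / 13) ^ 13) (cis1 (t / 13) ^ 13) ^ 2 / qpoch_inf (cis1 (t / 13)) (cis1 (t / 13)) ^ 2))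
        \<longlongrightarrow> 0) at_ioo"
      using filterlim_compose[OF _ lim_x] by fastforce
    moreover have "eventually (\<lambda>t. 13 * cis1 (t / 13) * (qpoch_inf (cis1 (t / 13) ^ 13) (cis1 (t / 13) ^ 13) ^ 2 / qpoch_inf (cis1 (t / 13)) (cis1 (t / 13)) ^ 2)
        = 1 / hauptmodul 1 0 t) at_ioo"
      using eventually_at_ioo_pos by eventually_elim (simp add: hauptmodul_1_0)
    ultimately have "((\<lambda>t. 1 / hauptmodul 1 0 t) \<longlongrightarrow> 0) at_ioo"
      by (rule Lim_transform_eventually)
    hence "(\<lambda>t. 1 / hauptmodul 1 0 t) \<in> o[at_ioo](\<lambda>_. 1)"
      by (intro smalloI_tendsto) auto
    hence "(\<lambda>t. F 1 0 t * (1 / hauptmodul 1 0 t)) \<in> o[at_ioo](\<lambda>t. 1 * 1)"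
      by (rule landau_o.big_small_mult[OF bounded])
    hence "((\<lambda>t. F 1 0 t * (1 / hauptmodul 1 0 t)) \<longlongrightarrow> 0) at_ioo"
      by (auto dest: smalloD_tendsto)
    thus "(H 1 0 \<longlongrightarrow> 0) at_ioo"
      by (simp add: H_def)
  qed
  thus ?thesis
    using FF[OF t] hauptmodul_nonzero[OF t, of 0 1] by (simp add: H_def)
qed

subsection \<open>Truncated expansions\<close>

text \<open>Congruence modulo x^7 in analytic form, so that it applies to infinite products and
  their quotients directly.\<close>

definition trunc7 :: "(complex \<Rightarrow> complex) \<Rightarrow> complex poly \<Rightarrow> bool" where
  "trunc7 f p \<longleftrightarrow> (\<lambda>x. f x - poly p x) \<in> O[at 0](\<lambda>x. x ^ 7)"

lemma poly_bigo_1: "poly p \<in> O[at (0 :: complex)](\<lambda>_. 1)"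
proof (rule bigoI_tendsto)
  have "isCont (poly p) 0"
    by simp
  thus "((\<lambda>x. poly p x / 1) \<longlongrightarrow> poly p 0) (at 0)"
    by (simp add: isCont_def)
qed auto

lemma power_bigo_1: "(\<lambda>x. x ^ n) \<in> O[at (0 :: complex)](\<lambda>_. 1)"
proof -
  have "poly (monom 1 n) = (\<lambda>x :: complex. x ^ n)"
    by (simp add: fun_eq_iff poly_monom)
  thus ?thesis
    using poly_bigo_1[of "monom 1 n"] by simp
qed

lemma trunc7_bigo_1:
  assumes "trunc7 f p"
  shows "f \<in> O[at 0](\<lambda>_. 1)"
proof -
  have "(\<lambda>x. f x - poly p x) \<in> O[at 0](\<lambda>_. 1)"
    using assms power_bigo_1[of 7] unfolding trunc7_def by (rule landau_o.big_trans)
  from sum_in_bigo(1)[OF this poly_bigo_1[of p]] show ?thesis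
    by simp
qed

lemma trunc7_add: "trunc7 f p \<Longrightarrow> trunc7 g q \<Longrightarrow> trunc7 (\<lambda>x. f x + g x) (p + q)"
  unfolding trunc7_def by (drule (1) sum_in_bigo(1)) (simp add: algebra_simps)

lemma trunc7_mult:
  assumes "trunc7 f p" "trunc7 g q"
  shows "trunc7 (\<lambda>x. f x * g x) (p * q)"
proof -
  have "(\<lambda>x. (f x - poly p x) * g x) \<in> O[at 0](\<lambda>x. x ^ 7 * 1)"
    using assms(1) trunc7_bigo_1[OF assms(2)] unfolding trunc7_def by (rule landau_o.big.mult)
  moreover have "(\<lambda>x. poly p x * (g x - poly q x)) \<in> O[at 0](\<lambda>x. 1 * x ^ 7)"
    using poly_bigo_1 assms(2) unfolding trunc7_def by (rule landau_o.big.mult)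
  ultimately have "(\<lambda>x. (f x - poly p x) * g x + poly p x * (g x - poly q x)) \<in> O[at 0](\<lambda>x. x ^ 7)"
    by (intro sum_in_bigo) simp_all
  thus ?thesis
    by (simp add: trunc7_def algebra_simps)
qed

lemma trunc7_const: "trunc7 (\<lambda>x. c) [:c:]"
  by (simp add: trunc7_def)

lemma trunc7_monom: "trunc7 (\<lambda>x. x ^ n) (monom 1 n)"
  by (simp add: trunc7_def poly_monom)

lemma trunc7_cong:
  assumes "trunc7 f p" "eventually (\<lambda>x. f x = g x) (at 0)"
  shows "trunc7 g p"
proof -
  have "eventually (\<lambda>x. f x - poly p x = g x - poly p x) (at 0)"
    using assms(2) by eventually_elim simp
  thus ?thesis
    using assms(1) unfolding trunc7_def by (simp only: landau_o.big.in_cong)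
qed

lemma trunc7_reduce:
  assumes "trunc7 f p" "\<And>i. i < 7 \<Longrightarrow> coeff p i = coeff q i"
  shows "trunc7 f q"
proof -
  have "monom 1 7 dvd p - q"
    unfolding monom_1_dvd_iff' using assms(2) by simp
  then obtain r where r: "p - q = monom 1 7 * r" ..
  have "poly p x - poly q x = x ^ 7 * poly r x" for x
    using arg_cong[OF r, of "\<lambda>p. poly p x"] by (simp add: poly_monom)
  moreover have "(\<lambda>x. x ^ 7 * poly r x) \<in> O[at 0](\<lambda>x. x ^ 7 * 1)"
    using poly_bigo_1 by (intro landau_o.big.mult) auto
  ultimately have "(\<lambda>x. poly p x - poly q x) \<in> O[at 0](\<lambda>x. x ^ 7)"
    by simp
  from sum_in_bigo(1)[OF assms(1)[unfolded trunc7_def] this] show ?thesis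
    by (simp add: trunc7_def)
qed

lemma trunc7_high_monom: "n \<ge> 7 \<Longrightarrow> trunc7 f p \<Longrightarrow> trunc7 (\<lambda>x. x ^ n * f x) 0"
  by (rule trunc7_reduce[OF trunc7_mult[OF trunc7_monom]]) (auto simp: coeff_monom_mult)

lemma trunc7_power: "trunc7 f p \<Longrightarrow> trunc7 (\<lambda>x. f x ^ n) (p ^ n)"
proof (induction n)
  case (Suc n)
  from trunc7_mult[OF Suc.prems Suc.IH[OF Suc.prems]] show ?case
    by simp
qed (use trunc7_const[of 1] in \<open>simp add: one_pCons\<close>)

text \<open>Only the linear term of the binomial expansion survives, the next one having degree
  \<open>2 * m\<close>.\<close>

lemma trunc7_power_binomial:
  assumes "trunc7 f (1 + monom c m)" "2 * m \<ge> 7"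
  shows "trunc7 (\<lambda>x. f x ^ n) (1 + monom (of_nat n * c) m)"
proof (induction n)
  case 0
  show ?case
    using trunc7_const[of 1] by (simp add: one_pCons)
next
  case (Suc n)
  have "trunc7 (\<lambda>x. f x * f x ^ n) ((1 + monom c m) * (1 + monom (of_nat n * c) m))"
    by (rule trunc7_mult[OF assms(1) Suc])
  moreover have "(1 + monom c m) * (1 + monom (of_nat n * c) m)
      = 1 + monom (of_nat (Suc n) * c) m + monom (c * (of_nat n * c)) (2 * m)"
    unfolding mult_2 by (simp add: algebra_simps mult_monom flip: add_monom)
  ultimately show ?case
    using assms(2) by (auto elim!: trunc7_reduce)
qed

lemma trunc7_power_const_term:
  assumes "trunc7 f p" "coeff p 0 = 1"
  shows "trunc7 (\<lambda>x. x ^ 6 * f x ^ n) (monom 1 6)"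
  by (rule trunc7_reduce[OF trunc7_mult[OF trunc7_monom trunc7_power[OF assms(1)]]])
     (auto simp: coeff_monom_mult coeff_0_power assms(2) not_le)

section \<open>Truncations of the infinite products\<close>

lemma eventually_small: "eventually (\<lambda>x :: complex. x \<noteq> 0 \<and> norm x < 1 / 2) (at 0)"
  unfolding eventually_at by (rule exI[of _ "1 / 2"]) auto

text \<open>Near 0 the bound \<open>exp y - 1\<close> of \<open>qpoch_inf_minus_1_bound\<close> is
  at most \<open>y + y ^ 2\<close>, hence at most \<open>2 * y\<close>, and \<open>y\<close> is at
  most \<open>2 * norm (x ^ 7)\<close>.\<close>

lemma trunc7_qpoch:
  assumes "m \<ge> 7" "l \<ge> 1" "norm c \<le> 1"
  shows "trunc7 (\<lambda>x. qpoch_inf (c * x ^ m) (x ^ l)) 1"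
  unfolding trunc7_def
proof (rule bigoI[where c = 4])
  show "\<forall>\<^sub>F x in at 0. norm (qpoch_inf (c * x ^ m) (x ^ l) - poly 1 x) \<le> 4 * norm (x ^ 7)"
    using eventually_small
  proof eventually_elim
    case (elim x)
    have xl: "norm (x ^ l) \<le> 1 / 2"
    proof -
      have "norm x ^ l \<le> norm x ^ 1"
        using assms(2) elim by (intro power_decreasing) auto
      thus ?thesis
        using elim by (simp add: norm_power)
    qed
    have xm: "norm (c * x ^ m) \<le> norm (x ^ 7)"
    proof -
      have "norm c * norm x ^ m \<le> 1 * norm x ^ 7"
        using assms elim by (intro mult_mono power_decreasing) auto
      thus ?thesis
        by (simp add: norm_mult norm_power)
    qed
    have x7: "norm (x ^ 7) \<le> 1 / 2"
    proof -
      have "norm x ^ 7 \<le> norm x ^ 1"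
        using elim by (intro power_decreasing) auto
      thus ?thesis
        using elim by (simp add: norm_power)
    qed
    define y where "y = norm (c * x ^ m) / (1 - norm (x ^ l))"
    have y: "0 \<le> y" "y \<le> 2 * norm (x ^ 7)"
    proof -
      show "0 \<le> y"
        using xl by (simp add: y_def)
      have "y \<le> norm (x ^ 7) / (1 / 2)"
        unfolding y_def using xl xm by (intro frac_le) auto
      thus "y \<le> 2 * norm (x ^ 7)"
        by simp
    qed
    have y1: "y \<le> 1"
      using y x7 by linarith
    have "norm (qpoch_inf (c * x ^ m) (x ^ l) - 1) \<le> exp y - 1"
      unfolding y_def using xl by (intro qpoch_inf_minus_1_bound) linarith
    also have "\<dots> \<le> y + y ^ 2"
      using exp_bound[OF y(1) y1] by linarith
    also have "y ^ 2 \<le> y * 1"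
      unfolding power2_eq_square using y y1 by (intro mult_left_mono) auto
    finally show ?case
      using y(2) by simp
  qed
qed

lemma trunc7_qpoch_13:
  assumes "m \<ge> 1"
  shows "trunc7 (\<lambda>x. qpoch_inf (- (x ^ m)) (x ^ 13)) (1 + monom 1 m)"
proof (rule trunc7_cong)
  have "trunc7 (\<lambda>x. 1 + x ^ m) (1 + monom 1 m)"
    using trunc7_add[OF trunc7_const trunc7_monom, of 1 m] by (simp add: one_pCons)
  moreover have "trunc7 (\<lambda>x. qpoch_inf ((- 1) * x ^ (m + 13)) (x ^ 13)) 1"
    by (rule trunc7_qpoch) auto
  ultimately have "trunc7 (\<lambda>x. (1 + x ^ m) * qpoch_inf ((- 1) * x ^ (m + 13)) (x ^ 13)) ((1 + monom 1 m) * 1)"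
    by (rule trunc7_mult)
  thus "trunc7 (\<lambda>x. (1 + x ^ m) * qpoch_inf ((- 1) * x ^ (m + 13)) (x ^ 13)) (1 + monom 1 m)"
    by (simp only: mult_1_right)
  show "\<forall>\<^sub>F x in at 0. (1 + x ^ m) * qpoch_inf ((- 1) * x ^ (m + 13)) (x ^ 13) = qpoch_inf (- (x ^ m)) (x ^ 13)"
    using eventually_small
  proof eventually_elim
    case (elim x)
    have "norm (x ^ 13) < 1"
      using elim by (simp add: norm_power power_less_one_iff)
    from qpoch_inf_rec[OF this, of "- (x ^ m)"] show ?case
      by (simp add: power_add)
  qed
qed

text \<open>The six factors of exponent below 7 are kept exactly; the rest is 1 to the order
  considered.\<close>

lemma trunc7_qpoch_1:
  assumes "norm c \<le> 1"
  shows "trunc7 (\<lambda>x. qpoch_inf (c * x) x)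
    ([:1, -c:] * [:1, 0, -c:] * [:1, 0, 0, -c:] * [:1, 0, 0, 0, -c:] * [:1, 0, 0, 0, 0, -c:] * [:1, 0, 0, 0, 0, 0, -c:])"
    (is "trunc7 _ ?p")
proof (rule trunc7_cong)
  have "trunc7 (\<lambda>x. qpoch_inf (c * x ^ 7) (x ^ 1)) 1"
    using assms by (intro trunc7_qpoch) auto
  moreover have "trunc7 (poly ?p) ?p"
    by (simp only: trunc7_def diff_self) simp
  ultimately have "trunc7 (\<lambda>x. poly ?p x * qpoch_inf (c * x ^ 7) (x ^ 1)) (?p * 1)"
    by (intro trunc7_mult)
  thus "trunc7 (\<lambda>x. poly ?p x * qpoch_inf (c * x ^ 7) (x ^ 1)) ?p"
    by (simp only: mult_1_right)
  show "\<forall>\<^sub>F x in at 0. poly ?p x * qpoch_inf (c * x ^ 7) (x ^ 1) = qpoch_inf (c * x) x"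
    using eventually_small
  proof eventually_elim
    case (elim x)
    have "norm x < 1"
      using elim by simp
    from qpoch_inf_split[OF this, of "c * x" 6]
    have "qpoch_inf (c * x) x = (\<Prod>j<6. 1 - c * x * x ^ j) * qpoch_inf (c * x * x ^ 6) x" .
    moreover have "c * x * x ^ 6 = c * x ^ 7"
      by (simp add: eval_nat_numeral)
    moreover have "(\<Prod>j<6. 1 - c * x * x ^ j) = poly ?p x"
    proof -
      have "(\<Prod>j<6. f j) = f 0 * f 1 * f 2 * f 3 * f 4 * f (5 :: nat)" for f :: "nat \<Rightarrow> complex"
        by (simp add: eval_nat_numeral)
      moreover have "poly [:1, -c:] x = 1 - c * x * x ^ 0" "poly [:1, 0, -c:] x = 1 - c * x * x ^ 1"
        "poly [:1, 0, 0, -c:] x = 1 - c * x * x ^ 2" "poly [:1, 0, 0, 0, -c:] x = 1 - c * x * x ^ 3"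
        "poly [:1, 0, 0, 0, 0, -c:] x = 1 - c * x * x ^ 4" "poly [:1, 0, 0, 0, 0, 0, -c:] x = 1 - c * x * x ^ 5"
        by (simp_all add: eval_nat_numeral)
      ultimately show ?thesis
        by (simp only: poly_mult)
    qed
    ultimately show ?case
      by simp
  qed
qed

lemma trunc7_reduceI:
  assumes "trunc7 f p" "coeff p 0 = coeff q 0" "coeff p 1 = coeff q 1" "coeff p 2 = coeff q 2" "coeff p 3 = coeff q 3"
    "coeff p 4 = coeff q 4" "coeff p 5 = coeff q 5" "coeff p 6 = coeff q 6"
  shows "trunc7 f q"
proof (rule trunc7_reduce[OF assms(1)])
  fix i :: nat assume "i < 7"
  hence "i \<in> {0,1,2,3,4,5,6}"
    by (simp only: insert_iff empty_iff) presburger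
  thus "coeff p i = coeff q i"
    using assms(2-) by (elim insertE) simp_all
qed

lemma trunc7_mult_power:
  assumes "trunc7 (\<lambda>x. f x ^ m) p" "trunc7 (\<lambda>x. f x ^ n) q" "k = m + n"
  shows "trunc7 (\<lambda>x. f x ^ k) (p * q)"
  using trunc7_mult[OF assms(1,2)] by (simp add: assms(3) power_add)

lemma trunc7_tendsto:
  assumes "trunc7 f p"
  shows "(f \<longlongrightarrow> poly p 0) (at 0)"
proof -
  have "((\<lambda>x :: complex. x ^ 7) \<longlongrightarrow> 0) (at 0)"
    by (rule tendsto_eq_intros refl | simp)+
  hence "(\<lambda>x :: complex. x ^ 7) \<in> o[at 0](\<lambda>_. 1)"
    by (intro smalloI_tendsto) auto
  with assms have "(\<lambda>x. f x - poly p x) \<in> o[at 0](\<lambda>_. 1)"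
    unfolding trunc7_def by (rule landau_o.big_small_trans)
  hence "((\<lambda>x. f x - poly p x) \<longlongrightarrow> 0) (at 0)"
    by (auto dest: smalloD_tendsto)
  moreover have "isCont (poly p) 0"
    by simp
  hence "(poly p \<longlongrightarrow> poly p 0) (at 0)"
    by (simp add: isCont_def)
  ultimately have "((\<lambda>x. f x - poly p x + poly p x) \<longlongrightarrow> 0 + poly p 0) (at 0)"
    by (rule tendsto_add)
  thus ?thesis
    by simp
qed

lemma trunc7_inverse:
  assumes "trunc7 f 1"
  shows "trunc7 (\<lambda>x. 1 / f x) 1"
proof -
  have lim: "(f \<longlongrightarrow> 1) (at 0)"
    using trunc7_tendsto[OF assms] by simp
  have "((\<lambda>x. - 1 / f x / 1) \<longlongrightarrow> - 1 / 1 / 1) (at 0)"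
    by (intro tendsto_intros lim) auto
  hence "(\<lambda>x. - 1 / f x) \<in> O[at 0](\<lambda>_. 1)"
    by (rule bigoI_tendsto) auto
  from landau_o.big.mult[OF this assms[unfolded trunc7_def]]
  have "(\<lambda>x. - 1 / f x * (f x - 1)) \<in> O[at 0](\<lambda>x. x ^ 7)"
    by simp
  moreover have "eventually (\<lambda>x. f x \<noteq> 0) (at 0)"
    using lim by (rule tendsto_imp_eventually_ne) simp
  hence "eventually (\<lambda>x. - 1 / f x * (f x - 1) = 1 / f x - 1) (at 0)"
    by eventually_elim (simp add: field_simps)
  ultimately show ?thesis
    unfolding trunc7_def by (simp only: landau_o.big.in_cong poly_1)
qed

text \<open>Euler's pentagonal exponents 0, 1, 2, 5.\<close>

lemma trunc7_qpoch_self: "trunc7 (\<lambda>x. qpoch_inf x x) [:1, -1, -1, 0, 0, 1:]"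
  by (rule trunc7_reduceI[OF trunc7_qpoch_1[of 1, simplified]]) (simp_all add: coeff_pCons')

text \<open>The coefficients count partitions into distinct parts.\<close>

lemma trunc7_qpoch_neg_self: "trunc7 (\<lambda>x. qpoch_inf (- x) x) [:1, 1, 1, 2, 2, 3, 4:]"
  by (rule trunc7_reduceI[OF trunc7_qpoch_1[of "- 1", simplified]]) (simp_all add: coeff_pCons')

definition theta_num :: "complex \<Rightarrow> complex" where
  "theta_num x = (let V = \<lambda>n :: nat. qpoch_inf (- (x ^ (2 * n))) (x ^ 13) * qpoch_inf (- (x ^ (13 - 2 * n))) (x ^ 13) in
     4096 * x ^ 21 * qpoch_inf (- (x ^ 13)) (x ^ 13) ^ 26 + x ^ 10 * V 1 ^ 13 + x ^ 3 * V 2 ^ 13 + V 3 ^ 13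
      + x * V 4 ^ 13 + x ^ 6 * V 5 ^ 13 + x ^ 15 * V 6 ^ 13)"

text \<open>The lowest terms 1, x, x^3, x^6 come from \<open>V 3\<close>, \<open>V 4\<close>,
  \<open>V 2\<close>, \<open>V 5\<close>. The coefficient 27 is 13 + 13 + 1, from the linear
  binomial terms of \<open>V 3\<close> and \<open>V 4\<close> and the leading term of
  \<open>V 5\<close>.\<close>

lemma trunc7_theta_num: "trunc7 theta_num [:1, 1, 0, 1, 0, 0, 27:]"
proof -
  define V where "V = (\<lambda>(n :: nat) x :: complex. qpoch_inf (- (x ^ (2 * n))) (x ^ 13) * qpoch_inf (- (x ^ (13 - 2 * n))) (x ^ 13))"
  define Q where "Q = (\<lambda>x :: complex. qpoch_inf (- (x ^ 13)) (x ^ 13))"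
  have V: "trunc7 (V n) ((1 + monom 1 (2 * n)) * (1 + monom 1 (13 - 2 * n)))" if "n \<ge> 1" "n \<le> 6" for n
    unfolding V_def by (rule trunc7_mult; rule trunc7_qpoch_13) (use that in auto)
  have V2: "trunc7 (V 2) (1 + monom 1 4)" and V3: "trunc7 (V 3) (1 + monom 1 6)" and V4: "trunc7 (V 4) (1 + monom 1 5)"
    by (rule trunc7_reduceI[OF V]; simp add: distrib_left distrib_right mult_monom)+
  have t0: "trunc7 (\<lambda>x. 4096 * (x ^ 21 * Q x ^ 26)) ([:4096:] * 0)"
    unfolding Q_def by (rule trunc7_mult[OF trunc7_const], rule trunc7_high_monom[OF _ trunc7_power[OF trunc7_qpoch_13]]) auto
  have t1: "trunc7 (\<lambda>x. x ^ 10 * V 1 x ^ 13) 0"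
    by (rule trunc7_high_monom[OF _ trunc7_power[OF V]]) auto
  have t6: "trunc7 (\<lambda>x. x ^ 15 * V 6 x ^ 13) 0"
    by (rule trunc7_high_monom[OF _ trunc7_power[OF V]]) auto
  have t5: "trunc7 (\<lambda>x. x ^ 6 * V 5 x ^ 13) (monom 1 6)"
    by (rule trunc7_power_const_term[OF V]) (auto simp: coeff_mult_0)
  have t2: "trunc7 (\<lambda>x. x ^ 3 * V 2 x ^ 13) (monom 1 3 * (1 + monom (of_nat 13 * 1) 4))"
    by (rule trunc7_mult[OF trunc7_monom trunc7_power_binomial[OF V2]]) simp
  have t3: "trunc7 (\<lambda>x. V 3 x ^ 13) (1 + monom (of_nat 13 * 1) 6)"
    by (rule trunc7_power_binomial[OF V3]) simp
  have t4: "trunc7 (\<lambda>x. x ^ 1 * V 4 x ^ 13) (monom 1 1 * (1 + monom (of_nat 13 * 1) 5))"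
    by (rule trunc7_mult[OF trunc7_monom trunc7_power_binomial[OF V4]]) simp
  have "theta_num = (\<lambda>x. 4096 * (x ^ 21 * Q x ^ 26) + x ^ 10 * V 1 x ^ 13 + x ^ 3 * V 2 x ^ 13 + V 3 x ^ 13
      + x ^ 1 * V 4 x ^ 13 + x ^ 6 * V 5 x ^ 13 + x ^ 15 * V 6 x ^ 13)"
    by (simp add: fun_eq_iff theta_num_def V_def Q_def Let_def mult.assoc)
  moreover have "trunc7 (\<lambda>x. 4096 * (x ^ 21 * Q x ^ 26) + x ^ 10 * V 1 x ^ 13 + x ^ 3 * V 2 x ^ 13 + V 3 x ^ 13
      + x ^ 1 * V 4 x ^ 13 + x ^ 6 * V 5 x ^ 13 + x ^ 15 * V 6 x ^ 13)
      ([:4096:] * 0 + 0 + monom 1 3 * (1 + monom (of_nat 13 * 1) 4) + (1 + monom (of_nat 13 * 1) 6)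
        + monom 1 1 * (1 + monom (of_nat 13 * 1) 5) + monom 1 6 + 0)"
    by (intro trunc7_add t0 t1 t2 t3 t4 t5 t6)
  ultimately have "trunc7 theta_num ([:4096:] * 0 + 0 + monom 1 3 * (1 + monom (of_nat 13 * 1) 4) + (1 + monom (of_nat 13 * 1) 6)
        + monom 1 1 * (1 + monom (of_nat 13 * 1) 5) + monom 1 6 + 0)"
    by simp
  thus ?thesis
    by (rule trunc7_reduceI) (simp_all add: distrib_left mult_monom coeff_pCons' numeral_poly)
qed

text \<open>Its square is \<open>13 * x\<close> times the Hauptmodul at the cusp 0.\<close>

definition eta_ratio :: "complex \<Rightarrow> complex" where
  "eta_ratio x = qpoch_inf x x * (1 / qpoch_inf (x ^ 13) (x ^ 13))"

lemma trunc7_eta_ratio: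
  "trunc7 eta_ratio [:1, -1, -1, 0, 0, 1:]"
  "trunc7 (\<lambda>x. eta_ratio x ^ 2) [:1, -2, -1, 2, 1, 2, -2:]"
  "trunc7 (\<lambda>x. eta_ratio x ^ 4) [:1, -4, 2, 8, -5, -4, -10:]"
  "trunc7 (\<lambda>x. eta_ratio x ^ 6) [:1, -6, 9, 10, -30, 0, 11:]"
  "trunc7 (\<lambda>x. eta_ratio x ^ 8) [:1, -8, 20, 0, -70, 64, 56:]"
  "trunc7 (\<lambda>x. eta_ratio x ^ 10) [:1, -10, 35, -30, -105, 238, 0:]"
  "trunc7 (\<lambda>x. eta_ratio x ^ 12) [:1, -12, 54, -88, -99, 540, -418:]"
  "trunc7 (\<lambda>x. eta_ratio x ^ 14) [:1, -14, 77, -182, 0, 924, -1547:]"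
proof -
  have "trunc7 (\<lambda>x. qpoch_inf (1 * x ^ 13) (x ^ 13)) 1"
    by (rule trunc7_qpoch) auto
  hence "trunc7 (\<lambda>x. 1 / qpoch_inf (x ^ 13) (x ^ 13)) 1"
    by (intro trunc7_inverse) simp
  from trunc7_mult[OF trunc7_qpoch_self this] show 1: "trunc7 eta_ratio [:1, -1, -1, 0, 0, 1:]"
    unfolding eta_ratio_def[abs_def] by simp
  hence one: "trunc7 (\<lambda>x. eta_ratio x ^ 1) [:1, -1, -1, 0, 0, 1:]"
    by simp
  show 2: "trunc7 (\<lambda>x. eta_ratio x ^ 2) [:1, -2, -1, 2, 1, 2, -2:]"
    by (rule trunc7_reduceI[OF trunc7_mult_power[OF one one]]) (simp_all add: coeff_pCons')
  show 4: "trunc7 (\<lambda>x. eta_ratio x ^ 4) [:1, -4, 2, 8, -5, -4, -10:]"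
    by (rule trunc7_reduceI[OF trunc7_mult_power[OF 2 2]]) (simp_all add: coeff_pCons')
  show 6: "trunc7 (\<lambda>x. eta_ratio x ^ 6) [:1, -6, 9, 10, -30, 0, 11:]"
    by (rule trunc7_reduceI[OF trunc7_mult_power[OF 4 2]]) (simp_all add: coeff_pCons')
  show 8: "trunc7 (\<lambda>x. eta_ratio x ^ 8) [:1, -8, 20, 0, -70, 64, 56:]"
    by (rule trunc7_reduceI[OF trunc7_mult_power[OF 4 4]]) (simp_all add: coeff_pCons')
  show "trunc7 (\<lambda>x. eta_ratio x ^ 10) [:1, -10, 35, -30, -105, 238, 0:]"
    by (rule trunc7_reduceI[OF trunc7_mult_power[OF 8 2]]) (simp_all add: coeff_pCons')
  show "trunc7 (\<lambda>x. eta_ratio x ^ 12) [:1, -12, 54, -88, -99, 540, -418:]"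
    by (rule trunc7_reduceI[OF trunc7_mult_power[OF 8 4]]) (simp_all add: coeff_pCons')
  show "trunc7 (\<lambda>x. eta_ratio x ^ 14) [:1, -14, 77, -182, 0, 924, -1547:]"
    by (rule trunc7_reduceI[OF trunc7_mult_power[OF 8 6]]) (simp_all add: coeff_pCons')
qed

text \<open>This is \<open>13 * x ^ 7\<close> times the nonconstant part of the polynomial of the
  first identity, at \<open>u = eta_ratio x ^ 2 / (13 * x)\<close>. A coefficient c of u^k inside
  the bracket becomes c * 13^(3-k); for instance 28561 = 13^4 becomes 13 for k = 6 and 1 for k =
  7.\<close>

definition poly_part :: "complex \<Rightarrow> complex" where
  "poly_part x = 169 * (x ^ 6 * eta_ratio x ^ 2) + 468 * (x ^ 5 * eta_ratio x ^ 4) + 494 * (x ^ 4 * eta_ratio x ^ 6)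
     + 260 * (x ^ 3 * eta_ratio x ^ 8) + 78 * (x ^ 2 * eta_ratio x ^ 10) + 13 * (x ^ 1 * eta_ratio x ^ 12) + eta_ratio x ^ 14"

lemma trunc7_poly_part: "trunc7 poly_part [:1, -1, -1, 0, 0, 1, 26:]"
  unfolding poly_part_def[abs_def]
  by (rule trunc7_reduceI, (rule trunc7_add trunc7_mult[OF trunc7_const trunc7_mult[OF trunc7_monom]] trunc7_eta_ratio)+)
     (simp_all add: coeff_monom_mult coeff_pCons')

lemma trunc7_neg_square: "trunc7 (\<lambda>x. qpoch_inf (- x) x ^ 2) [:1, 2, 3, 6, 9, 14, 22:]"
  unfolding power2_eq_square
  by (rule trunc7_reduceI[OF trunc7_mult[OF trunc7_qpoch_neg_self trunc7_qpoch_neg_self]]) (simp_all add: coeff_pCons')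

text \<open>The criterion shared by both identities: the seven listed coefficients are those of
  \<open>theta_num x / qpoch_inf (- x) x ^ 2\<close>, so any \<open>f\<close> with this truncation
  removes the pole of order 7.\<close>

lemma theta_num_cong:
  assumes "trunc7 f [:1, -1, -1, 0, 0, 1, 26:]"
  shows "(\<lambda>x. (theta_num x - qpoch_inf (- x) x ^ 2 * f x) / (13 * x ^ 7 * qpoch_inf (- x) x ^ 2)) \<in> O[at 0](\<lambda>_. 1)"
proof -
  have "trunc7 (\<lambda>x. qpoch_inf (- x) x ^ 2 * f x) [:1, 1, 0, 1, 0, 0, 27:]"
    by (rule trunc7_reduceI[OF trunc7_mult[OF trunc7_neg_square assms]]) (simp_all add: coeff_pCons')
  from sum_in_bigo(2)[OF trunc7_theta_num[unfolded trunc7_def] this[unfolded trunc7_def]]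
  have 1: "(\<lambda>x. theta_num x - qpoch_inf (- x) x ^ 2 * f x) \<in> O[at 0](\<lambda>x. x ^ 7)"
    by simp
  have "((\<lambda>x. qpoch_inf (- x) x) \<longlongrightarrow> 1) (at 0)"
    using trunc7_tendsto[OF trunc7_qpoch_neg_self] by simp
  hence "((\<lambda>x. 1 / (13 * qpoch_inf (- x) x ^ 2) / 1) \<longlongrightarrow> 1 / (13 * 1 ^ 2) / 1) (at 0)"
    by (intro tendsto_intros) auto
  hence 2: "(\<lambda>x. 1 / (13 * qpoch_inf (- x) x ^ 2)) \<in> O[at 0](\<lambda>_. 1)"
    by (rule bigoI_tendsto) auto
  have 3: "(\<lambda>x. 1 / x ^ 7) \<in> O[at 0](\<lambda>x. 1 / x ^ 7)"
    by simp
  have "(\<lambda>x. (theta_num x - qpoch_inf (- x) x ^ 2 * f x) * (1 / (13 * qpoch_inf (- x) x ^ 2)) * (1 / x ^ 7))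
      \<in> O[at 0](\<lambda>x. x ^ 7 * 1 * (1 / x ^ 7))"
    by (intro landau_o.big.mult 1 2 3)
  moreover have "eventually (\<lambda>x :: complex. x ^ 7 * 1 * (1 / x ^ 7) = 1) (at 0)"
    using eventually_small by eventually_elim simp
  ultimately have "(\<lambda>x. (theta_num x - qpoch_inf (- x) x ^ 2 * f x) * (1 / (13 * qpoch_inf (- x) x ^ 2)) * (1 / x ^ 7))
      \<in> O[at 0](\<lambda>_. 1)"
    by (simp only: landau_o.big.cong)
  thus ?thesis
    by (simp add: mult_ac)
qed

text \<open>Translation by \<open>j\<close> multiplies \<open>x\<close> by a 13th root of unity, so
  both terms have a pole of the same order 7 and the ratio has a finite limit.\<close>

lemma eprod_1_0_ratio_bounded: "(\<lambda>t. eprod 1 0 t / eprod 1 0 (t + of_nat j)) \<in> O[at_ioo](\<lambda>_. 1)"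
proof (rule bigoI_tendsto)
  define w where "w = cis1 (of_nat j / 13)"
  note lim_x = filterlim_cis1_at_ioo[of 13, simplified]
  have "filterlim (\<lambda>x. x * w) (at 0) (at 0)"
  proof (rule filterlim_atI)
    show "((\<lambda>x. x * w) \<longlongrightarrow> 0) (at 0)"
      by (rule tendsto_eq_intros refl | simp)+
    show "\<forall>\<^sub>F x in at 0. x * w \<noteq> 0"
      by (simp add: eventually_at_filter w_def)
  qed
  from filterlim_compose[OF tendsto_qpoch_inf_self this]
  have "((\<lambda>x. qpoch_inf (x * w) (x * w)) \<longlongrightarrow> 1) (at 0)" .
  hence "((\<lambda>x. w ^ 7 * (qpoch_inf x x / qpoch_inf (x * w) (x * w))) \<longlongrightarrow> w ^ 7 * (1 / 1)) (at 0)"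
    by (intro tendsto_intros tendsto_qpoch_inf_self) auto
  from filterlim_compose[OF this lim_x]
  have "((\<lambda>t. w ^ 7 * (qpoch_inf (cis1 (t / 13)) (cis1 (t / 13))
      / qpoch_inf (cis1 (t / 13) * w) (cis1 (t / 13) * w))) \<longlongrightarrow> w ^ 7 * (1 / 1)) at_ioo" .
  moreover have "\<forall>\<^sub>F t in at_ioo. w ^ 7 * (qpoch_inf (cis1 (t / 13)) (cis1 (t / 13))
      / qpoch_inf (cis1 (t / 13) * w) (cis1 (t / 13) * w)) = eprod 1 0 t / eprod 1 0 (t + of_nat j) / 1"
    using eventually_at_ioo_pos
  proof eventually_elim
    case (elim t)
    define x where "x = cis1 (t / 13)"
    have x: "norm x < 1" "norm (x ^ 13) < 1" "x \<noteq> 0"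
      using norm_cis1_less_1[of "t / 13"] elim by (simp_all add: x_def norm_power power_less_one_iff)
    define A where "A = qpoch_inf (x ^ 13) (x ^ 13)"
    have A: "A \<noteq> 0"
      using x by (simp add: A_def qpoch_inf_nonzero)
    have X: "cis1 ((t + of_nat j) / 13) = x * w"
      unfolding x_def w_def cis1_add[symmetric] by (simp add: add_divide_distrib)
    have w13: "w ^ 13 = 1"
      by (simp add: w_def cis1_power)
    have e1: "eprod 1 0 t = qpoch_inf x x / (x ^ 7 * A ^ 13)"
      unfolding A_def x_def by (rule eprod_1_0[OF elim])
    have "eprod 1 0 (t + of_nat j)
        = qpoch_inf (x * w) (x * w) / ((x * w) ^ 7 * qpoch_inf ((x * w) ^ 13) ((x * w) ^ 13) ^ 13)"
      unfolding X[symmetric] by (rule eprod_1_0) (use elim in simp)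
    hence e2: "eprod 1 0 (t + of_nat j) = qpoch_inf (x * w) (x * w) / (x ^ 7 * w ^ 7 * A ^ 13)"
      by (simp add: power_mult_distrib w13 A_def)
    have gen: "c * (n / d) = n / (a * b) / (d / (a * c * b)) / 1" if "a \<noteq> 0" "b \<noteq> 0" for a b c d n :: complex
      using that by (cases "c = 0"; cases "d = 0") (simp_all add: field_simps)
    show ?case
      unfolding e1 e2 x_def[symmetric] by (rule gen) (use A x in simp_all)
  qed
  ultimately show "((\<lambda>t. eprod 1 0 t / eprod 1 0 (t + of_nat j) / 1) \<longlongrightarrow> w ^ 7 * (1 / 1)) at_ioo"
    by (rule Lim_transform_eventually)
qed auto

text \<open>Among the 14 lines only \<open>(0, 1)\<close> can produce a pole at the cusp 0. Its 12
  multiples with \<open>x = 0\<close> each contribute the subtracted quotient, and all other terms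
  are bounded by \<open>eprod_1_0_ratio_bounded\<close>.\<close>

lemma eprod_trace_1_0: "(\<lambda>t. eprod_trace 1 0 t - eprod 1 0 t / eprod 0 1 t) \<in> O[at_ioo](\<lambda>_. 1)"
proof -
  have term_bound: "(\<lambda>t. chi y * (eprod 1 0 t / eprod x y t)) \<in> O[at_ioo](\<lambda>_. 1)" if x: "x \<in> {1..12}" for x y
  proof -
    have nd: "\<not> 13 dvd x"
      using x by (auto dest!: zdvd_imp_le)
    obtain j n where y: "y = x * int j + 13 * n"
      using ex_residue_multiple[OF nd] by metis
    have e: "eprod x y t = chi x * eprod 1 0 (t + of_nat j)" if t: "Im t > 0" for t
      using eprod_shift[OF t, of x 0 "x * int j" n]
        eprod_scale[OF t, of x 1 "int j"] y eprod_translate_nat[of 1 0 t j] by simp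
    have "(\<lambda>t. (chi y / chi x) * (eprod 1 0 t / eprod 1 0 (t + of_nat j))) \<in> O[at_ioo](\<lambda>_. 1)"
      using landau_o.big.mult[OF bigo_const[of "chi y / chi x"] eprod_1_0_ratio_bounded[of j]] by simp
    moreover have "eventually (\<lambda>t. (chi y / chi x) * (eprod 1 0 t / eprod 1 0 (t + of_nat j))
        = chi y * (eprod 1 0 t / eprod x y t)) at_ioo"
      using eventually_at_ioo_pos by eventually_elim (simp add: e)
    ultimately show ?thesis
      by (simp only: landau_o.big.in_cong)
  qed
  have "(\<lambda>t. (\<Sum>x\<in>{1..12}. \<Sum>y\<in>{0..12}. chi y * (eprod 1 0 t / eprod x y t)) * (1 / 12)) \<in> O[at_ioo](\<lambda>_. 1 * 1)"
    by (intro landau_o.big.mult big_sum_in_bigo term_bound) auto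
  moreover have "eventually (\<lambda>t. (\<Sum>x\<in>{1..12}. \<Sum>y\<in>{0..12}. chi y * (eprod 1 0 t / eprod x y t)) * (1 / 12)
      = eprod_trace 1 0 t - eprod 1 0 t / eprod 0 1 t) at_ioo"
    using eventually_at_ioo_pos
  proof eventually_elim
    case (elim t)
    have "{0..12 :: int} = insert 0 {1..12}"
      by auto
    hence "eprod_trace 1 0 t = ((\<Sum>y\<in>{0..12}. chi y * (eprod 1 0 t / eprod 0 y t))
        + (\<Sum>x\<in>{1..12}. \<Sum>y\<in>{0..12}. chi y * (eprod 1 0 t / eprod x y t))) / 12"
      unfolding eprod_trace_def by simp
    moreover have "(\<Sum>y\<in>{0..12}. chi y * (eprod 1 0 t / eprod 0 y t)) = 12 * (eprod 1 0 t / eprod 0 1 t)"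
    proof -
      have "(\<Sum>y\<in>{0..12}. chi y * (eprod 1 0 t / eprod 0 y t)) = (\<Sum>y\<in>{1..12 :: int}. eprod 1 0 t / eprod 0 1 t)"
      proof (rule sum.mono_neutral_cong_right)
        show "\<forall>i\<in>{0..12} - {1..12}. chi i * (eprod 1 0 t / eprod 0 i t) = 0"
        proof
          fix i :: int assume "i \<in> {0..12} - {1..12}"
          hence "i = 0"
            by auto
          thus "chi i * (eprod 1 0 t / eprod 0 i t) = 0"
            by (simp add: chi_0)
        qed
        fix y :: int assume y: "y \<in> {1..12}"
        hence "\<not> 13 dvd y"
          by (auto dest!: zdvd_imp_le)
        hence "chi y \<noteq> 0"
          using chi_squared by force
        moreover have "eprod 0 y t = chi y * eprod 0 1 t"
          using eprod_scale[OF elim, of y 0 1] by simp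
        ultimately show "chi y * (eprod 1 0 t / eprod 0 y t) = eprod 1 0 t / eprod 0 1 t"
          by simp
      qed auto
      thus ?thesis
        by simp
    qed
    ultimately show ?case
      by (simp add: add_divide_distrib)
  qed
  ultimately show ?thesis
    by (simp only: landau_o.big.in_cong mult_1)
qed

section \<open>The identities\<close>

lemma theta_quot_1_0_eq:
  assumes "Im t > 0"
  defines "x \<equiv> cis1 (t / 13)"
  shows "theta_quot 1 0 (1 / 2) t = theta_num x / (13 * x ^ 7 * qpoch_inf (- x) x ^ 2)"
proof -
  have x: "norm x < 1" "x \<noteq> 0"
    using norm_cis1_less_1[of "t / 13"] assms(1) by (simp_all add: x_def)
  have "13 * x ^ 7 * theta_quot 1 0 (1 / 2) t * qpoch_inf (- x) x ^ 2 = theta_num x"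
    using theta_quot_1_0_expansion[OF assms(1)] unfolding theta_num_def Let_def x_def .
  moreover have "qpoch_inf (- x) x \<noteq> 0"
    using x by (simp add: qpoch_inf_nonzero)
  ultimately show ?thesis
    using x by (simp add: field_simps)
qed

lemma hauptmodul_1_0_eq:
  assumes "Im t > 0"
  defines "x \<equiv> cis1 (t / 13)"
  shows "hauptmodul 1 0 t = eta_ratio x ^ 2 / (13 * x)"
  unfolding hauptmodul_1_0[OF assms(1)] x_def[symmetric] eta_ratio_def
  by (simp add: power_divide)

lemma at_ioo_bigoI:
  assumes "\<Phi> \<in> O[at 0](\<lambda>_. 1)" "\<And>t. Im t > 0 \<Longrightarrow> F t = \<Phi> (cis1 (t / 13))"
  shows "F \<in> O[at_ioo](\<lambda>_. 1)"
proof -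
  from landau_o.big.compose[OF assms(1) filterlim_cis1_at_ioo[of 13, simplified]] have "(\<lambda>t. \<Phi> (cis1 (t / 13))) \<in> O[at_ioo](\<lambda>_. 1)" .
  moreover have "eventually (\<lambda>t. \<Phi> (cis1 (t / 13)) = F t) at_ioo"
    using eventually_at_ioo_pos by eventually_elim (simp add: assms(2))
  ultimately show ?thesis
    by (simp only: landau_o.big.in_cong)
qed

text \<open>The polynomial has the polar part of the theta quotient at the cusp 0, and its constant
  term is \<open>CPhi 13 0 = 1\<close>; these are the conditions of
  \<open>modular_family_vanish\<close>.\<close>

lemma CPhi_13_polynomial:
  assumes "Im t > 0"
  defines "q \<equiv> cis1 t" and "u \<equiv> hauptmodul_q (cis1 t)"
  shows "CPhi 13 q * qpoch_inf (q ^ 13) (q ^ 13)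
    = 1 + 169 * (u + 36 * u ^ 2 + 494 * u ^ 3 + 3380 * u ^ 4 + 13182 * u ^ 5 + 28561 * u ^ 6 + 28561 * u ^ 7)"
proof -
  define P :: "complex \<Rightarrow> complex" where "P = (\<lambda>u. 1 + 169 * (u + 36 * u ^ 2 + 494 * u ^ 3 + 3380 * u ^ 4 + 13182 * u ^ 5 + 28561 * u ^ 6 + 28561 * u ^ 7))"
  define F where "F = (\<lambda>a b t. theta_quot a b (1 / 2) t - P (hauptmodul a b t))"
  define FF where "FF = (\<lambda>q. CPhi 13 q * qpoch_inf (q ^ 13) (q ^ 13) - P (hauptmodul_q q))"
  have "FF (cis1 t) = 0"
  proof (rule modular_family_vanish[of F FF])
    show "modular_family F"
      unfolding F_def P_def by (intro modular_family_intros modular_family_theta_quot modular_family_hauptmodul)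
    show "FF holomorphic_on ball 0 1"
      unfolding FF_def P_def
      by (intro holomorphic_intros CPhi_holomorphic qpoch_inf_13_holomorphic hauptmodul_q_holomorphic)
    show "FF 0 = 0"
      by (simp add: FF_def P_def CPhi_0 hauptmodul_q_def)
    show "F 0 1 t = FF (cis1 t)" if "Im t > 0" for t
      using that theta_quot_0_1[OF that klein_half_nonzero(1)[OF that]]
      by (simp add: F_def FF_def hauptmodul_q_cis1)
    have "(\<lambda>x. (theta_num x - qpoch_inf (- x) x ^ 2 * poly_part x) / (13 * x ^ 7 * qpoch_inf (- x) x ^ 2) - 1) \<in> O[at 0](\<lambda>_. 1)"
      by (intro sum_in_bigo theta_num_cong trunc7_poly_part) simp
    thus "F 1 0 \<in> O[at_ioo](\<lambda>_. 1)"
    proof (rule at_ioo_bigoI)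
      fix t assume t: "Im t > 0"
      define x where "x = cis1 (t / 13)"
      have x: "norm x < 1" "x \<noteq> 0"
        using norm_cis1_less_1[of "t / 13"] t by (simp_all add: x_def)
      have D: "qpoch_inf (- x) x ^ 2 \<noteq> 0"
        using x by (simp add: qpoch_inf_nonzero)
      define w where "w = eta_ratio x ^ 2"
      have P: "P (w / (13 * x)) = 1 + poly_part x / (13 * x ^ 7)"
      proof -
        have w: "eta_ratio x ^ 4 = w ^ 2" "eta_ratio x ^ 6 = w ^ 3" "eta_ratio x ^ 8 = w ^ 4" "eta_ratio x ^ 10 = w ^ 5"
          "eta_ratio x ^ 12 = w ^ 6" "eta_ratio x ^ 14 = w ^ 7"
          by (simp_all add: w_def flip: power_mult)
        have pw: "169 * (c * (w / (13 * x)) ^ k) = (c * 2197 / 13 ^ k) * (x ^ (7 - k) * w ^ k) / (13 * x ^ 7)"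
          if "k \<le> 7" for k :: nat and c
        proof -
          have "x ^ 7 = x ^ (7 - k) * x ^ k"
            using that by (simp flip: power_add)
          thus ?thesis
            using x by (simp add: power_divide power_mult_distrib)
        qed
        show ?thesis
          unfolding P_def poly_part_def w w_def[symmetric] distrib_left
          using pw[of 1 1] pw[of 2 36] pw[of 3 494] pw[of 4 3380] pw[of 5 13182] pw[of 6 28561] pw[of 7 28561]
          by (simp add: add_divide_distrib)
      qed
      have gen: "n / (c * d) - (1 + s / c) = (n - d * s) / (c * d) - 1" if "d \<noteq> 0" for n c d s :: complex
        using that by (cases "c = 0") (simp_all add: field_simps)
      show "F 1 0 t = (theta_num (cis1 (t / 13)) - qpoch_inf (- cis1 (t / 13)) (cis1 (t / 13)) ^ 2 * poly_part (cis1 (t / 13)))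
          / (13 * cis1 (t / 13) ^ 7 * qpoch_inf (- cis1 (t / 13)) (cis1 (t / 13)) ^ 2) - 1"
        unfolding F_def theta_quot_1_0_eq[OF t] hauptmodul_1_0_eq[OF t] x_def[symmetric] w_def[symmetric] P
        by (rule gen[OF D])
    qed
  qed (fact assms(1))
  thus ?thesis
    by (simp add: FF_def P_def q_def u_def)
qed

text \<open>One power of \<open>q\<close> is split off, which makes this a power series from
  exponent 0 and gives holomorphy at the cusp.\<close>

definition partition_series :: "complex \<Rightarrow> complex" where
  "partition_series q = (\<Sum>j. of_nat (num_partitions (13 * Suc j - 7)) * q ^ j)"

lemma ex_cis1:
  assumes "norm q < 1" "q \<noteq> 0"
  obtains t where "Im t > 0" "q = cis1 t"
proof
  define t where "t = Ln q / (2 * of_real pi * \<i>)"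
  show "q = cis1 t"
    using assms by (simp add: t_def cis1_def)
  hence "norm (cis1 t) < 1"
    using assms by simp
  thus "Im t > 0"
    by (simp add: norm_cis1 zero_less_mult_iff)
qed

text \<open>Convergence is inherited from \<open>partition_residue_sums\<close> after division by
  \<open>q\<close>.\<close>

lemma partition_series_sums:
  assumes "norm q < 1"
  shows "(\<lambda>j. of_nat (num_partitions (13 * Suc j - 7)) * q ^ j) sums partition_series q"
proof (cases "q = 0")
  case True
  thus ?thesis
    using powser_sums_zero[of "\<lambda>j. of_nat (num_partitions (13 * Suc j - 7))"]
    by (simp add: partition_series_def sums_iff)
next
  case False
  then obtain t where t: "Im t > 0" "q = cis1 t"
    using ex_cis1[OF assms] by blast
  have "summable (\<lambda>j. of_nat (num_partitions (13 * Suc j - 7)) * q ^ Suc j)"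
    using sums_summable[OF partition_residue_sums[OF t(1)]] unfolding t(2) .
  hence "summable (\<lambda>j. inverse q * (of_nat (num_partitions (13 * Suc j - 7)) * q ^ Suc j))"
    by (rule summable_mult)
  moreover have "inverse q * (of_nat (num_partitions (13 * Suc j - 7)) * q ^ Suc j)
      = of_nat (num_partitions (13 * Suc j - 7)) * q ^ j" for j
    using False by (simp add: field_simps)
  ultimately have "summable (\<lambda>j. of_nat (num_partitions (13 * Suc j - 7)) * q ^ j)"
    by (simp only:)
  thus ?thesis
    unfolding partition_series_def by (rule summable_sums)
qed

lemma partition_series_Suc_sums:
  assumes "norm q < 1"
  shows "(\<lambda>j. of_nat (num_partitions (13 * Suc j - 7)) * q ^ Suc j) sums (q * partition_series q)"
  using sums_mult[OF partition_series_sums[OF assms], of q] by (simp only: power_Suc mult.left_commute)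

lemma partition_series_holomorphic: "partition_series holomorphic_on ball 0 1"
proof (rule power_series_holomorphic)
  fix w :: complex assume "w \<in> ball 0 1"
  thus "(\<lambda>n. of_nat (num_partitions (13 * Suc n - 7)) * (w - 0) ^ n) sums partition_series w"
    using partition_series_sums[of w] by simp
qed

lemma CPhi_13_partitions:
  assumes "Im t > 0"
  defines "q \<equiv> cis1 t"
  shows "CPhi 13 q * qpoch_inf (q ^ 13) (q ^ 13)
    = 1 + 13 * qpoch_inf (q ^ 13) (q ^ 13) * (q * partition_series q) + 26 * hauptmodul_q q"
proof -
  define s where "s = complex_of_real (sqrt 13)"
  have s: "s * s = 13" "s \<noteq> 0"
    by (simp_all add: s_def flip: of_real_mult)
  \<comment> \<open>The trace enters with a plus sign because the constant in
    \<open>eprod_trace_partitions\<close> is negative; dividing by \<open>s\<close> leaves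
    -13.\<close>
  define F where "F = (\<lambda>a b t. theta_quot a b (1 / 2) t - 1 + eprod_trace a b t / s - 26 * hauptmodul a b t)"
  define FF where "FF = (\<lambda>q. CPhi 13 q * qpoch_inf (q ^ 13) (q ^ 13) - 1
      - 13 * qpoch_inf (q ^ 13) (q ^ 13) * (q * partition_series q) - 26 * hauptmodul_q q)"
  have "FF (cis1 t) = 0"
  proof (rule modular_family_vanish[of F FF])
    show "modular_family F"
      unfolding F_def
      by (intro modular_family_intros modular_family_theta_quot modular_family_hauptmodul modular_family_eprod_trace)
    show "FF holomorphic_on ball 0 1"
      unfolding FF_def
      by (intro holomorphic_intros CPhi_holomorphic qpoch_inf_13_holomorphic hauptmodul_q_holomorphic
          partition_series_holomorphic)
    show "FF 0 = 0"
      by (simp add: FF_def CPhi_0 hauptmodul_q_def)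
    show "F 0 1 t = FF (cis1 t)" if "Im t > 0" for t
    proof -
      have "(\<Sum>j. of_nat (num_partitions (13 * Suc j - 7)) * cis1 t ^ Suc j) = cis1 t * partition_series (cis1 t)"
        by (rule sums_unique[OF partition_series_Suc_sums[OF norm_cis1_less_1[OF that]], symmetric])
      hence "eprod_trace 0 1 t / s = - 13 * qpoch_inf (cis1 t ^ 13) (cis1 t ^ 13) * (cis1 t * partition_series (cis1 t))"
        unfolding eprod_trace_partitions[OF that] s_def[symmetric] using s(2) by simp
      thus ?thesis
        using theta_quot_0_1[OF that klein_half_nonzero(1)[OF that]] hauptmodul_q_cis1[OF that]
        by (simp add: F_def FF_def)
    qed
    \<comment> \<open>The first summand is the pole of \<open>eprod 1 0 t / eprod 0 1 t\<close>,
      with Euler's coefficients 1, -1, -1, 0, 0, 1, 0 up to order 7. The criterion asks for 26 at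
      x^6, and \<open>26 * hauptmodul\<close> provides it.\<close>
    define T where "T = (\<lambda>x. qpoch_inf x x * (1 / qpoch_inf (x ^ 169) (x ^ 169)) + 26 * (x ^ 6 * eta_ratio x ^ 2))"
    have "trunc7 (\<lambda>x. qpoch_inf (1 * x ^ 169) (x ^ 169)) 1"
      by (rule trunc7_qpoch) auto
    hence "trunc7 (\<lambda>x. 1 / qpoch_inf (x ^ 169) (x ^ 169)) 1"
      by (intro trunc7_inverse) simp
    hence "trunc7 T ([:1, -1, -1, 0, 0, 1:] * 1 + [:26:] * (monom 1 6 * [:1, -2, -1, 2, 1, 2, -2:]))"
      unfolding T_def
      by (intro trunc7_add trunc7_mult trunc7_const trunc7_monom trunc7_qpoch_self trunc7_eta_ratio)
    hence "trunc7 T [:1, -1, -1, 0, 0, 1, 26:]"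
      by (rule trunc7_reduceI) (simp_all add: coeff_monom_mult coeff_pCons')
    hence "(\<lambda>x. (theta_num x - qpoch_inf (- x) x ^ 2 * T x) / (13 * x ^ 7 * qpoch_inf (- x) x ^ 2) - 1) \<in> O[at 0](\<lambda>_. 1)"
      by (intro sum_in_bigo theta_num_cong) simp_all
    hence main: "(\<lambda>t. F 1 0 t - (eprod_trace 1 0 t - eprod 1 0 t / eprod 0 1 t) * (1 / s)) \<in> O[at_ioo](\<lambda>_. 1)"
    proof (rule at_ioo_bigoI)
      fix t assume t: "Im t > 0"
      define x where "x = cis1 (t / 13)"
      have x: "norm x < 1" "norm (x ^ 13) < 1" "norm (x ^ 169) < 1" "x \<noteq> 0"
        using norm_cis1_less_1[of "t / 13"] t by (simp_all add: x_def norm_power power_less_one_iff)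
      have D: "qpoch_inf (- x) x ^ 2 \<noteq> 0"
        using x by (simp add: qpoch_inf_nonzero)
      define A where "A = qpoch_inf (x ^ 13) (x ^ 13)"
      have A: "A \<noteq> 0"
        using x by (simp add: A_def qpoch_inf_nonzero)
      define B where "B = qpoch_inf (x ^ 169) (x ^ 169)"
      have q: "cis1 t = x ^ 13"
        by (simp add: x_def cis1_power)
      have e1: "eprod 1 0 t = qpoch_inf x x / (x ^ 7 * A ^ 13)"
        unfolding A_def x_def by (rule eprod_1_0[OF t])
      have e2: "eprod 0 1 t = - s * B / A ^ 13"
        using eprod_0_1[OF t] unfolding q by (simp add: A_def B_def s_def flip: power_mult)
      have "n / (c * a) / (- s * b / a) * (1 / s) = - (n * (1 / b)) / (13 * c)" if "a \<noteq> 0" for a b c n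
        unfolding s(1)[symmetric] using that s(2)
        by (cases "b = 0"; cases "c = 0") (simp_all add: field_simps)
      hence e3: "eprod 1 0 t / eprod 0 1 t * (1 / s) = - (qpoch_inf x x * (1 / B)) / (13 * x ^ 7)"
        unfolding e1 e2 using A by simp
      have e4: "26 * (eta_ratio x ^ 2 / (13 * x)) = 26 * (x ^ 6 * eta_ratio x ^ 2) / (13 * x ^ 7)"
      proof -
        have "x ^ 7 = x ^ 6 * x"
          by (simp flip: power_Suc2)
        thus ?thesis
          using x by simp
      qed
      have gen: "n / (c * d) - 1 + r / s - v / c - (r - e) * (1 / s) = (n - d * (m + v)) / (c * d) - 1"
        if "d \<noteq> 0" "e * (1 / s) = - m / c" for n c d r v e m
      proof -
        have "n / (c * d) - 1 + r / s - v / c - (r - e) * (1 / s) = n / (c * d) - 1 - v / c + e * (1 / s)"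
          by (simp add: diff_divide_distrib left_diff_distrib)
        also have "\<dots> = (n - d * (m + v)) / (c * d) - 1"
          unfolding that(2) using that(1) by (cases "c = 0") (simp_all add: field_simps)
        finally show ?thesis .
      qed
      show "F 1 0 t - (eprod_trace 1 0 t - eprod 1 0 t / eprod 0 1 t) * (1 / s)
        = (theta_num (cis1 (t / 13)) - qpoch_inf (- cis1 (t / 13)) (cis1 (t / 13)) ^ 2 * T (cis1 (t / 13)))
          / (13 * cis1 (t / 13) ^ 7 * qpoch_inf (- cis1 (t / 13)) (cis1 (t / 13)) ^ 2) - 1"
        unfolding F_def theta_quot_1_0_eq[OF t] hauptmodul_1_0_eq[OF t] x_def[symmetric] T_def e4 B_def[symmetric]
        by (rule gen[OF D e3])
    qed
    have "(\<lambda>t. (eprod_trace 1 0 t - eprod 1 0 t / eprod 0 1 t) * (1 / s)) \<in> O[at_ioo](\<lambda>_. 1 * 1)"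
      by (intro landau_o.big.mult eprod_trace_1_0 bigo_const)
    from sum_in_bigo(1)[OF main this[simplified]] show "F 1 0 \<in> O[at_ioo](\<lambda>_. 1)"
      by simp
  qed (fact assms(1))
  thus ?thesis
    by (simp add: FF_def q_def algebra_simps)
qed

theorem theorem3p6:
  fixes q :: complex
  assumes "norm q < 1"
  shows "summable (\<lambda>n. of_nat (cphi 13 n) * q ^ n)
    \<and> CPhi 13 q =
      1 / qpoch_inf (q^13) (q^13)
      + 169 * (q * (qpoch_inf (q^13) (q^13) / qpoch_inf q q ^ 2)
        + 36 * q^2 * (qpoch_inf (q^13) (q^13) ^ 3 / qpoch_inf q q ^ 4)
        + 494 * q^3 * (qpoch_inf (q^13) (q^13) ^ 5 / qpoch_inf q q ^ 6)
        + 3380 * q^4 * (qpoch_inf (q^13) (q^13) ^ 7 / qpoch_inf q q ^ 8)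
        + 13182 * q^5 * (qpoch_inf (q^13) (q^13) ^ 9 / qpoch_inf q q ^ 10)
        + 28561 * q^6 * (qpoch_inf (q^13) (q^13) ^ 11 / qpoch_inf q q ^ 12)
        + 28561 * q^7 * (qpoch_inf (q^13) (q^13) ^ 13 / qpoch_inf q q ^ 14))
    \<and> summable (\<lambda>j. of_nat (num_partitions (13 * Suc j - 7)) * q ^ Suc j)
    \<and> CPhi 13 q =
      1 / qpoch_inf (q^13) (q^13)
      + 13 * (\<Sum>j. of_nat (num_partitions (13 * Suc j - 7)) * q ^ Suc j)
      + 26 * q * (qpoch_inf (q^13) (q^13) / qpoch_inf q q ^ 2)"
proof (intro conjI)
  define A B u where "A = qpoch_inf q q" and "B = qpoch_inf (q ^ 13) (q ^ 13)" and "u = hauptmodul_q q"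
  have AB: "A \<noteq> 0" "B \<noteq> 0"
    using assms by (simp_all add: A_def B_def qpoch_inf_nonzero norm_power power_less_one_iff)
  have u: "u = q * B ^ 2 / A ^ 2"
    by (simp add: u_def hauptmodul_q_def A_def B_def)
  \<comment> \<open>Division by \<open>B\<close> turns the even powers of \<open>B\<close> in
    \<open>u ^ k\<close> into the odd ones of the statement.\<close>
  have uk: "c * u ^ k / B = c * q ^ k * (B ^ (2 * k - 1) / A ^ (2 * k))" if "k \<ge> 1" for k and c
  proof -
    have "B ^ (2 * k) = B ^ (2 * k - 1) * B"
      using that by (metis Suc_pred' mult_pos_pos power_Suc2 pos2 zero_less_one_class.zero_less_one order_less_le_trans)
    thus ?thesis
      using AB by (simp add: u power_mult_distrib power_divide power_mult[symmetric])
  qed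
  show "summable (\<lambda>n. of_nat (cphi 13 n) * q ^ n)"
    using cphi_sums_charge_coeff[OF assms] by (rule sums_summable)
  show "summable (\<lambda>j. of_nat (num_partitions (13 * Suc j - 7)) * q ^ Suc j)"
    using partition_series_Suc_sums[OF assms] by (rule sums_summable)
  have sum: "(\<Sum>j. of_nat (num_partitions (13 * Suc j - 7)) * q ^ Suc j) = q * partition_series q"
    by (rule sums_unique[OF partition_series_Suc_sums[OF assms], symmetric])
  have eqs: "CPhi 13 q * B = 1 + 169 * (u + 36 * u ^ 2 + 494 * u ^ 3 + 3380 * u ^ 4 + 13182 * u ^ 5 + 28561 * u ^ 6 + 28561 * u ^ 7)"
    "CPhi 13 q * B = 1 + 13 * B * (q * partition_series q) + 26 * u"
  proof -
    \<comment> \<open>The value \<open>q = 0\<close> is not of the form \<open>cis1 t\<close>; there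
      \<open>u = 0\<close> and all sides equal 1.\<close>
    consider "q = 0" | t where "Im t > 0" "q = cis1 t"
      using ex_cis1[OF assms] by blast
    hence "CPhi 13 q * B = 1 + 169 * (u + 36 * u ^ 2 + 494 * u ^ 3 + 3380 * u ^ 4 + 13182 * u ^ 5 + 28561 * u ^ 6 + 28561 * u ^ 7)
      \<and> CPhi 13 q * B = 1 + 13 * B * (q * partition_series q) + 26 * u"
    proof cases
      case 1
      thus ?thesis
        by (simp add: CPhi_0 B_def u)
    next
      case 2
      thus ?thesis
        using CPhi_13_polynomial[OF 2(1)] CPhi_13_partitions[OF 2(1)] by (simp add: B_def u_def)
    qed
    thus "CPhi 13 q * B = 1 + 169 * (u + 36 * u ^ 2 + 494 * u ^ 3 + 3380 * u ^ 4 + 13182 * u ^ 5 + 28561 * u ^ 6 + 28561 * u ^ 7)"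
      "CPhi 13 q * B = 1 + 13 * B * (q * partition_series q) + 26 * u"
      by blast+
  qed
  have C: "CPhi 13 q = (CPhi 13 q * B) / B"
    using AB by simp
  have "CPhi 13 q = 1 / B + 169 * (1 * u ^ 1 / B + 36 * u ^ 2 / B + 494 * u ^ 3 / B + 3380 * u ^ 4 / B
      + 13182 * u ^ 5 / B + 28561 * u ^ 6 / B + 28561 * u ^ 7 / B)"
    by (subst C, subst eqs(1)) (simp add: add_divide_distrib)
  also have "\<dots> = 1 / B + 169 * (q * (B / A ^ 2) + 36 * q ^ 2 * (B ^ 3 / A ^ 4) + 494 * q ^ 3 * (B ^ 5 / A ^ 6)
      + 3380 * q ^ 4 * (B ^ 7 / A ^ 8) + 13182 * q ^ 5 * (B ^ 9 / A ^ 10) + 28561 * q ^ 6 * (B ^ 11 / A ^ 12)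
      + 28561 * q ^ 7 * (B ^ 13 / A ^ 14))"
    using uk[of 1 1] uk[of 2 36] uk[of 3 494] uk[of 4 3380] uk[of 5 13182] uk[of 6 28561] uk[of 7 28561] by simp
  finally show "CPhi 13 q =
      1 / qpoch_inf (q^13) (q^13)
      + 169 * (q * (qpoch_inf (q^13) (q^13) / qpoch_inf q q ^ 2)
        + 36 * q^2 * (qpoch_inf (q^13) (q^13) ^ 3 / qpoch_inf q q ^ 4)
        + 494 * q^3 * (qpoch_inf (q^13) (q^13) ^ 5 / qpoch_inf q q ^ 6)
        + 3380 * q^4 * (qpoch_inf (q^13) (q^13) ^ 7 / qpoch_inf q q ^ 8)
        + 13182 * q^5 * (qpoch_inf (q^13) (q^13) ^ 9 / qpoch_inf q q ^ 10)
        + 28561 * q^6 * (qpoch_inf (q^13) (q^13) ^ 11 / qpoch_inf q q ^ 12)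
        + 28561 * q^7 * (qpoch_inf (q^13) (q^13) ^ 13 / qpoch_inf q q ^ 14))"
    unfolding A_def B_def .
  have "CPhi 13 q = 1 / B + 13 * (q * partition_series q) + 26 * u ^ 1 / B"
    using AB by (subst C, subst eqs(2)) (simp add: add_divide_distrib)
  also have "\<dots> = 1 / B + 13 * (q * partition_series q) + 26 * q * (B / A ^ 2)"
    using uk[of 1 26] by simp
  finally show "CPhi 13 q =
      1 / qpoch_inf (q^13) (q^13)
      + 13 * (\<Sum>j. of_nat (num_partitions (13 * Suc j - 7)) * q ^ Suc j)
      + 26 * q * (qpoch_inf (q^13) (q^13) / qpoch_inf q q ^ 2)"
    unfolding sum A_def B_def .
qed

end
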